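(* Let $n\ge 2$, let $x\in\mathbf{R}^n$, and let $c$ be a constant. For $\varepsilon>0$ let $\theta^{\varepsilon}_t$ be the switching process of intensity $\lambda=\varepsilon^{-2}$ on $\Theta$, and let the Markov symmetry random evolution be $$\xi_t^{\varepsilon}:=x+v\int_0^t s(\theta_{\tau}^{\varepsilon})\,d\tau,\qquad v=c\,\varepsilon^{-1},\quad t\ge 0.$$ Then, as $\varepsilon\to 0$ $(\varepsilon>0)$, $\xi^{\varepsilon}_t$ converges weakly in the Skorokhod space $\mathbf{D}_{\mathbf{R}^n}[0,\infty)$ to the Wiener process $w(t):=\xi^0_t\in\mathbf{R}^n$ started at $x$ and defined by the generator $$L^{0}\varphi(x_1,\dots,x_n)=\frac{c^2}{n}\Delta\varphi(x_1,\dots,x_n),\qquad \Delta\varphi:=\left(\frac{\partial^2}{\partial x_1^2}+\dots+\frac{\partial^2}{\partial x_n^2}\right)\varphi .$$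
   Context: Directions: $\Theta$ is the set of angles $\theta=(\theta_1,\dots,\theta_{n-1})$ with $\theta_i\in[0,\pi)$ for $1\le i\le n-2$ and $\theta_{n-1}\in[0,2\pi)$, parametrizing the unit sphere $S_n$ of $\mathbf{R}^n$ through $$s(\theta)=(\cos\theta_1,\ \sin\theta_1\cos\theta_2,\ \dots,\ \sin\theta_1\cdots\sin\theta_{n-2}\cos\theta_{n-1},\ \sin\theta_1\cdots\sin\theta_{n-2}\sin\theta_{n-1}).$$ The element of volume of the sphere is $\mu(d\theta)=\sin^{n-2}\theta_1\sin^{n-3}\theta_2\cdots\sin\theta_{n-2}\,d\theta_1\cdots d\theta_{n-1}$, and $N=\int_{S_n}\mu(d\theta)$ is its total mass. Switching process: $\theta^{\varepsilon}_t$ is the pure-jump Markov process on $\Theta$ whose jump times are those of a Poisson process of intensity $\varepsilon^{-2}$ and which at every jump time takes a new value chosen independently of the past with law $\frac1N\mu(d\theta)$. Equivalently, its generator is $\varepsilon^{-2}Q$ with $Q\varphi(\theta)=\frac1N\int_{S_n}\varphi(\theta')\mu(d\theta')-\varphi(\theta)$. No condition is imposed on the initial value $\theta^\varepsilon_0$. *)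

theory Defs
  imports "HOL-Probability.Probability"
begin

text \<open>Angles are extensional functions on the index set \<open>{1..n - 1}\<close>.\<close>

definition angle_range :: "nat \<Rightarrow> nat \<Rightarrow> real set" where
  "angle_range n i = (if i \<le> n - 2 then {0..<pi} else {0..<2 * pi})"

text \<open>The volume element of the sphere, as a measure whose space is the set of angles.\<close>

definition angle_volume :: "nat \<Rightarrow> (nat \<Rightarrow> real) measure" where
  "angle_volume n =
     density (\<Pi>\<^sub>M i\<in>{1..n - 1}. restrict_space lborel (angle_range n i))
       (\<lambda>\<theta>. ennreal (\<Prod>i = 1..n - 2. sin (\<theta> i) ^ (n - 1 - i)))"

definition angle_law :: "nat \<Rightarrow> (nat \<Rightarrow> real) measure" where
  "angle_law n =
     scale_measure (1 / emeasure (angle_volume n) (space (angle_volume n))) (angle_volume n)"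

text \<open>The linear order on the index type only serves to number the coordinates from
  \<open>1\<close> to \<open>CARD('n)\<close>.\<close>

definition coord_number :: "'n::{finite,linorder} \<Rightarrow> nat" where
  "coord_number i = card {j. j \<le> i}"

definition direction :: "(nat \<Rightarrow> real) \<Rightarrow> real ^ 'n::{finite,linorder}" where
  "direction \<theta> =
     (\<chi> i. (\<Prod>j = 1..<coord_number i. sin (\<theta> j)) *
           (if coord_number i < CARD('n) then cos (\<theta> (coord_number i)) else 1))"

text \<open>With holding times \<open>T 0, T 1, \<dots>\<close> the \<open>k\<close>-th jump, \<open>k \<ge> 1\<close>, happens at time
  \<open>T 0 + \<dots> + T (k - 1)\<close>. The set below is almost surely finite for every \<open>t\<close>.\<close>

definition jump_count :: "(nat \<Rightarrow> real) \<Rightarrow> real \<Rightarrow> nat" where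
  "jump_count T t = card {k. 1 \<le> k \<and> (\<Sum>i<k. T i) \<le> t}"

text \<open>The jump times are those of a Poisson process of intensity \<open>l\<close> (independent exponential
  holding times), \<open>Z k\<close> is the value taken at the \<open>k\<close>-th jump, and \<open>Z 0\<close> is the initial value,
  whose law is arbitrary.\<close>

definition switching_process ::
    "nat \<Rightarrow> real \<Rightarrow> 'a measure \<Rightarrow> (real \<Rightarrow> 'a \<Rightarrow> nat \<Rightarrow> real) \<Rightarrow> bool" where
  "switching_process n l M \<theta> \<longleftrightarrow>
     prob_space M \<and>
     (\<exists>(Z :: nat \<Rightarrow> 'a \<Rightarrow> nat \<Rightarrow> real) (T :: nat \<Rightarrow> 'a \<Rightarrow> real).
        prob_space.indep_vars M (\<lambda>_. angle_law n) Z UNIV \<and>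
        prob_space.indep_vars M (\<lambda>_. borel) T UNIV \<and>
        prob_space.indep_set M
          (sets (vimage_algebra (space M) (\<lambda>\<omega> k. Z k \<omega>) (\<Pi>\<^sub>M k\<in>UNIV. angle_law n)))
          (sets (vimage_algebra (space M) (\<lambda>\<omega> k. T k \<omega>) (\<Pi>\<^sub>M k\<in>UNIV. borel))) \<and>
        (\<forall>k\<ge>1. distr M (angle_law n) (Z k) = angle_law n) \<and>
        (\<forall>k. distributed M lborel (T k) (exponential_density l)) \<and>
        (\<forall>\<omega>\<in>space M. \<forall>t\<ge>0. \<theta> t \<omega> = Z (jump_count (\<lambda>k. T k \<omega>) t) \<omega>))"

definition random_evolution ::
    "real ^ 'n::{finite,linorder} \<Rightarrow> real \<Rightarrow> (real \<Rightarrow> 'a \<Rightarrow> nat \<Rightarrow> real)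
      \<Rightarrow> real \<Rightarrow> 'a \<Rightarrow> real ^ 'n::{finite,linorder}"
  where
  "random_evolution x v \<theta> t \<omega> = x + v *\<^sub>R (LINT \<tau>:{0..t}|lborel. direction (\<theta> \<tau> \<omega>))"

text \<open>Elements of the space are made extensional on \<open>{0..}\<close>, so that a path is determined by its
  values at nonnegative times.\<close>

definition cadlag :: "(real \<Rightarrow> 'b::metric_space) set" where
  "cadlag = {f \<in> extensional {0..}.
     (\<forall>t\<ge>0. (f \<longlongrightarrow> f t) (at_right t)) \<and> (\<forall>t>0. \<exists>l. (f \<longlongrightarrow> l) (at_left t))}"

text \<open>The distance of Ethier and Kurtz (Markov Processes, Section 3.5):
  \<open>d(f, g) = inf\<^sub>\<lambda> max (\<gamma>(\<lambda>)) (\<integral>\<^sub>0\<^sup>\<infinity> exp(-u) sup\<^sub>t min 1 |f(t \<and> u) - g(\<lambda>(t) \<and> u)| du)\<close>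
  where \<open>\<lambda>\<close> runs over the increasing bijections of \<open>{0..}\<close> with finite \<open>\<gamma>(\<lambda>)\<close>, the supremum of
  the absolute logarithms of the slopes of \<open>\<lambda>\<close>.\<close>

definition log_slopes :: "(real \<Rightarrow> real) \<Rightarrow> real set" where
  "log_slopes h = {\<bar>ln ((h s - h t) / (s - t))\<bar> | s t. 0 \<le> t \<and> t < s}"

definition time_changes :: "(real \<Rightarrow> real) set" where
  "time_changes = {h. strict_mono_on {0..} h \<and> h ` {0..} = {0..} \<and> bdd_above (log_slopes h)}"

definition skorokhod_gap ::
    "(real \<Rightarrow> 'b::metric_space) \<Rightarrow> (real \<Rightarrow> 'b) \<Rightarrow> (real \<Rightarrow> real) \<Rightarrow> real \<Rightarrow> real" where
  "skorokhod_gap f g h u = (SUP t\<in>{0..}. min 1 (dist (f (min t u)) (g (min (h t) u))))"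

definition skorokhod_dist :: "(real \<Rightarrow> 'b::metric_space) \<Rightarrow> (real \<Rightarrow> 'b) \<Rightarrow> real" where
  "skorokhod_dist f g =
     (INF h\<in>time_changes.
        max (Sup (log_slopes h)) (LINT u:{0..}|lborel. exp (- u) * skorokhod_gap f g h u))"

definition skorokhod :: "(real \<Rightarrow> 'b::metric_space) topology" where
  "skorokhod = topology (\<lambda>U. U \<subseteq> cadlag \<and>
     (\<forall>f\<in>U. \<exists>r>0. \<forall>g\<in>cadlag. skorokhod_dist f g < r \<longrightarrow> g \<in> U))"

lemma openin_skorokhod:
  fixes U :: "(real \<Rightarrow> 'b::metric_space) set"
  shows "openin skorokhod U \<longleftrightarrow>
     U \<subseteq> cadlag \<and> (\<forall>f\<in>U. \<exists>r>0. \<forall>g\<in>cadlag. skorokhod_dist f g < r \<longrightarrow> g \<in> U)"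
proof -
  let ?P = "\<lambda>U :: (real \<Rightarrow> 'b) set. U \<subseteq> cadlag \<and>
     (\<forall>f\<in>U. \<exists>r>0. \<forall>g\<in>cadlag. skorokhod_dist f g < r \<longrightarrow> g \<in> U)"
  have "?P (S \<inter> T)" if S: "?P S" and T: "?P T" for S T
  proof (intro conjI ballI)
    show "S \<inter> T \<subseteq> cadlag"
      using S by blast
    fix f assume f: "f \<in> S \<inter> T"
    obtain r where r: "r > 0" "\<forall>g\<in>cadlag. skorokhod_dist f g < r \<longrightarrow> g \<in> S"
      using S f by blast
    obtain r' where r': "r' > 0" "\<forall>g\<in>cadlag. skorokhod_dist f g < r' \<longrightarrow> g \<in> T"
      using T f by blast
    show "\<exists>r>0. \<forall>g\<in>cadlag. skorokhod_dist f g < r \<longrightarrow> g \<in> S \<inter> T"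
      using r r' by (intro exI[of _ "min r r'"]) auto
  qed
  moreover have "?P (\<Union>\<K>)" if \<K>: "\<forall>K\<in>\<K>. ?P K" for \<K>
  proof (intro conjI ballI)
    show "\<Union>\<K> \<subseteq> cadlag"
      using \<K> by blast
    fix f assume "f \<in> \<Union>\<K>"
    then obtain K where K: "K \<in> \<K>" "f \<in> K"
      by blast
    then obtain r where "r > 0" "\<forall>g\<in>cadlag. skorokhod_dist f g < r \<longrightarrow> g \<in> K"
      using \<K> by blast
    then show "\<exists>r>0. \<forall>g\<in>cadlag. skorokhod_dist f g < r \<longrightarrow> g \<in> \<Union>\<K>"
      using K by blast
  qed
  ultimately have "istopology ?P"
    unfolding istopology_def by blast
  then show ?thesis
    unfolding skorokhod_def by (simp add: topology_inverse')
qed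

lemma topspace_skorokhod: "topspace skorokhod = (cadlag :: (real \<Rightarrow> 'b::metric_space) set)"
proof -
  have "openin skorokhod (cadlag :: (real \<Rightarrow> 'b) set)"
    unfolding openin_skorokhod by (auto intro: exI[of _ 1])
  moreover have "topspace skorokhod \<subseteq> (cadlag :: (real \<Rightarrow> 'b) set)"
    using openin_topspace[of skorokhod] unfolding openin_skorokhod by blast
  ultimately show ?thesis
    using openin_subset by blast
qed

definition borel_sets_of :: "'b topology \<Rightarrow> 'b measure" where
  "borel_sets_of X = sigma (topspace X) {U. openin X U}"

definition converges_weakly ::
    "'b topology \<Rightarrow> ('i \<Rightarrow> 'b measure) \<Rightarrow> 'b measure \<Rightarrow> 'i filter \<Rightarrow> bool" where
  "converges_weakly X \<mu> \<nu> F \<longleftrightarrow>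
     (\<forall>f. continuous_map X euclideanreal f \<and> bounded (f ` topspace X) \<longrightarrow>
        ((\<lambda>i. LINT z|\<mu> i. f z) \<longlongrightarrow> (LINT z|\<nu>. f z)) F)"

definition path_of :: "(real \<Rightarrow> 'a \<Rightarrow> 'b) \<Rightarrow> 'a \<Rightarrow> real \<Rightarrow> 'b" where
  "path_of X \<omega> = (\<lambda>t\<in>{0..}. X t \<omega>)"

definition path_law :: "'a measure \<Rightarrow> (real \<Rightarrow> 'a \<Rightarrow> 'b::metric_space) \<Rightarrow> (real \<Rightarrow> 'b) measure"
  where
  "path_law M X = distr M (borel_sets_of skorokhod) (path_of X)"

definition partial :: "'n::finite \<Rightarrow> (real ^ 'n \<Rightarrow> real) \<Rightarrow> real ^ 'n \<Rightarrow> real" where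
  "partial i \<phi> y = deriv (\<lambda>h. \<phi> (y + h *\<^sub>R axis i 1)) 0"

definition laplacian :: "(real ^ 'n::finite \<Rightarrow> real) \<Rightarrow> real ^ 'n \<Rightarrow> real" where
  "laplacian \<phi> y = (\<Sum>i\<in>UNIV. partial i (partial i \<phi>) y)"

definition has_partials :: "(real ^ 'n::finite \<Rightarrow> real) \<Rightarrow> bool" where
  "has_partials \<phi> \<longleftrightarrow> (\<forall>i y. (\<lambda>h. \<phi> (y + h *\<^sub>R axis i 1)) differentiable (at 0))"

definition C0 :: "(real ^ 'n::finite \<Rightarrow> real) set" where
  "C0 = {\<phi>. continuous_on UNIV \<phi> \<and> (\<phi> \<longlongrightarrow> 0) at_infinity}"

text \<open>Twice continuously differentiable functions vanishing at infinity together with their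
  partial derivatives of order at most two.\<close>

definition C02 :: "(real ^ 'n::finite \<Rightarrow> real) set" where
  "C02 = {\<phi> \<in> C0. has_partials \<phi> \<and>
     (\<forall>i. partial i \<phi> \<in> C0 \<and> has_partials (partial i \<phi>) \<and>
        (\<forall>j. partial j (partial i \<phi>) \<in> C0))}"

definition markov_semigroup :: "(real \<Rightarrow> 'b \<Rightarrow> 'b::topological_space measure) \<Rightarrow> bool" where
  "markov_semigroup K \<longleftrightarrow>
     (\<forall>t\<ge>0. K t \<in> borel \<rightarrow>\<^sub>M prob_algebra borel) \<and>
     (\<forall>y. K 0 y = return borel y) \<and>
     (\<forall>s\<ge>0. \<forall>t\<ge>0. \<forall>y. K (s + t) y = K s y \<bind> K t)"

text \<open>\<open>L\<close> is, on the domain \<open>D\<close>, the derivative at time zero of the semigroup in supremum norm.\<close>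

definition generated_by ::
    "(real \<Rightarrow> 'b \<Rightarrow> 'b measure) \<Rightarrow> ('b \<Rightarrow> real) set \<Rightarrow> (('b \<Rightarrow> real) \<Rightarrow> 'b \<Rightarrow> real) \<Rightarrow> bool" where
  "generated_by K D L \<longleftrightarrow>
     (\<forall>\<phi>\<in>D. uniform_limit UNIV (\<lambda>h y. ((LINT z|K h y. \<phi> z) - \<phi> y) / h) (L \<phi>) (at_right 0))"

definition past :: "'a measure \<Rightarrow> (real \<Rightarrow> 'a \<Rightarrow> 'b::topological_space) \<Rightarrow> real \<Rightarrow> 'a measure" where
  "past M X s = sigma (space M) {X u -` A \<inter> space M | u A. 0 \<le> u \<and> u \<le> s \<and> A \<in> sets borel}"

definition markov_process ::
    "'a measure \<Rightarrow> (real \<Rightarrow> 'a \<Rightarrow> 'b::topological_space) \<Rightarrow> (real \<Rightarrow> 'b \<Rightarrow> 'b measure) \<Rightarrow> bool" where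
  "markov_process M X K \<longleftrightarrow>
     prob_space M \<and> (\<forall>t\<ge>0. X t \<in> borel_measurable M) \<and>
     (\<forall>s\<ge>0. \<forall>t\<ge>0. \<forall>A\<in>sets borel. AE \<omega> in M.
        real_cond_exp M (past M X s) (\<lambda>\<omega>. indicator A (X (s + t) \<omega>)) \<omega>
          = measure (K t (X s \<omega>)) A)"

text \<open>The transition semigroup is determined by \<open>L\<close> on \<open>C02\<close> in the case \<open>L = a * laplacian\<close>,
  \<open>a \<ge> 0\<close>, because \<open>C02\<close> is invariant under the heat semigroup.\<close>

definition wiener_process ::
    "((real ^ 'n::finite \<Rightarrow> real) \<Rightarrow> real ^ 'n \<Rightarrow> real) \<Rightarrow> real ^ 'n \<Rightarrow> 'a measure
      \<Rightarrow> (real \<Rightarrow> 'a \<Rightarrow> real ^ 'n) \<Rightarrow> bool" where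
  "wiener_process L x M w \<longleftrightarrow>
     (\<exists>K. markov_semigroup K \<and> generated_by K C02 L \<and> markov_process M w K) \<and>
     (\<forall>\<omega>\<in>space M. w 0 \<omega> = x \<and> continuous_on {0..} (\<lambda>t. w t \<omega>))"

end

theory Submission
  imports Defs
begin

text \<open>At the \<open>k\<close>-th jump time the evolution sits at \<open>x\<close> plus a sum of independent steps
  \<open>(c / \<epsilon>) T\<^sub>i s(Z\<^sub>i)\<close>, which, except for the first one, are centred with covariance
  \<open>2 c\<^sup>2 \<epsilon>\<^sup>2 / n\<close> times the identity. The jump times are close to \<open>k \<epsilon>\<^sup>2\<close> by Chebyshev's inequality
  and the oscillation between two of them is controlled by a maximal inequality for fourth moments;
  hence the path is close to a polygon whose vertices are values of the random walk at
  deterministic indices. The joint characteristic function of finitely many increments of the walk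
  converges to that of the Wiener process, which is computed by testing the generator against plane
  waves with a slowly decaying Gaussian envelope.

  No compactness argument is needed: every path is continuous, Lipschitz functionals (for the
  supremum on a compact interval) determine weak convergence through inf-convolutions, and such a
  functional changes little when the path is replaced by the polygon.\<close>

section \<open>Lipschitz functionals of continuous paths\<close>

text \<open>The factor 2 in the step covariance is the second moment of an exponential time, twice
  its squared mean. About \<open>t / \<epsilon>^2\<close> steps give covariance
  \<open>2 c^2 t / n\<close>, and half of it is the coefficient of the Laplacian.

  Fourth moments are forced by the number of blocks. Over a time \<open>1 / m\<close> the fourth
  moment of the walk is of order \<open>1 / m^2\<close>, so a union bound over about m blocks still
  vanishes as m grows; second moments would leave a constant. The limits are taken in this order:
  \<epsilon> to 0 for fixed m, then m to infinity.

  A Skorokhod-continuous functional has no modulus of continuity, and the Borel sets of the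
  Skorokhod topology are not compared with coordinate events. One remedy serves both difficulties:
  at a continuous path Skorokhod neighbourhoods contain locally uniform ones, so the functional and
  its negative are lower semicontinuous for locally uniform convergence. If bounded, they are limits
  from below of Lipschitz functionals, and these are limits of functions of finitely many polygon
  vertices.\<close>

definition cont_paths :: "(real \<Rightarrow> 'b::metric_space) set" where
  "cont_paths = {f \<in> extensional {0..}. continuous_on {0..} f}"

lemma cont_paths_subset_cadlag: "(cont_paths :: (real \<Rightarrow> 'b::metric_space) set) \<subseteq> cadlag"
proof
  fix f :: "real \<Rightarrow> 'b" assume "f \<in> cont_paths"
  then have e: "f \<in> extensional {0..}" and c: "continuous_on {0..} f"
    by (auto simp: cont_paths_def)
  have r: "(f \<longlongrightarrow> f t) (at_right t)" if "t \<ge> 0" for t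
  proof -
    have "(f \<longlongrightarrow> f t) (at t within {0..})" using c that by (auto simp: continuous_on)
    then show ?thesis by (rule tendsto_within_subset) (use that in auto)
  qed
  have l: "(f \<longlongrightarrow> f t) (at_left t)" if "t > 0" for t
  proof -
    have "(f \<longlongrightarrow> f t) (at t within {0..})" using c that by (auto simp: continuous_on)
    then have "(f \<longlongrightarrow> f t) (at t within {0..<t})" by (rule tendsto_within_subset) (use that in auto)
    moreover have "at t within {0..<t} = at_left t"
      by (rule at_within_nhd[of _ "{0<..}"]) (use that in auto)
    ultimately show ?thesis by simp
  qed
  show "f \<in> cadlag" using e r l by (auto simp: cadlag_def)
qed

lemma log_slopes_id: "log_slopes (\<lambda>t. t) = {0}"
proof -
  have "log_slopes (\<lambda>t. t) \<subseteq> {0}" by (auto simp: log_slopes_def)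
  moreover have "0 \<in> log_slopes (\<lambda>t. t)"
    unfolding log_slopes_def by (rule CollectI, rule exI[of _ 1], rule exI[of _ 0]) auto
  ultimately show ?thesis by blast
qed

lemma skorokhod_gap_nonneg: "0 \<le> skorokhod_gap f g h u"
  unfolding skorokhod_gap_def
  by (rule cSUP_upper2[where x = 0]) (auto intro!: bdd_aboveI[where M = 1])

text \<open>The identity is used as time change, with log slopes 0. The gap is at most \<delta> for
  horizons \<open>u \<le> N\<close> and at most \<open>1 \<le> u / N\<close> beyond; integrating
  \<open>\<delta> + u / N\<close> against \<open>exp (- u)\<close> gives the bound.\<close>

lemma skorokhod_dist_le:
  fixes f g :: "real \<Rightarrow> 'b::metric_space"
  assumes "N > 0" "\<delta> \<ge> 0" and d: "\<And>t. t \<in> {0..N} \<Longrightarrow> dist (f t) (g t) \<le> \<delta>"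
  shows "skorokhod_dist f g \<le> \<delta> + 1 / N"
proof -
  let ?J = "\<lambda>h. max (Sup (log_slopes h)) (LINT u:{0..}|lborel. exp (- u) * skorokhod_gap f g h u)"
  have id: "(\<lambda>t. t) \<in> time_changes"
    by (auto simp: time_changes_def log_slopes_id strict_mono_on_def)
  have nn: "0 \<le> ?J h" for h
    unfolding set_lebesgue_integral_def
    by (intro max.coboundedI2 integral_nonneg) (auto simp: indicator_def skorokhod_gap_nonneg)
  have "skorokhod_dist f g \<le> ?J (\<lambda>t. t)"
    unfolding skorokhod_dist_def by (rule cINF_lower[OF _ id]) (use nn in \<open>auto intro!: bdd_belowI2\<close>)
  moreover have "(LINT u:{0..}|lborel. exp (- u) * skorokhod_gap f g (\<lambda>t. t) u) \<le> \<delta> + 1 / N"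
  proof -
    have i0: "has_bochner_integral lborel (\<lambda>u. exp (- u) * indicator {0..} u) (1::real)"
      using has_bochner_integral_I0i_power_exp_m'[of 0] by simp
    have i1: "has_bochner_integral lborel (\<lambda>u. u * exp (- u) * indicator {0..} u) (1::real)"
      using has_bochner_integral_I0i_power_exp_m'[of 1] by simp
    have i: "has_bochner_integral lborel (\<lambda>u. \<delta> * (exp (- u) * indicator {0..} u) +
        (1 / N) * (u * exp (- u) * indicator {0..} u)) (\<delta> * 1 + (1 / N) * 1)"
      by (intro has_bochner_integral_add has_bochner_integral_mult_right i0 i1)
    have g1: "skorokhod_gap f g (\<lambda>t. t) u \<le> \<delta>" if "0 \<le> u" "u \<le> N" for u
      unfolding skorokhod_gap_def by (rule cSUP_least) (use that d in \<open>auto simp: min_le_iff_disj\<close>)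
    have g2: "skorokhod_gap f g (\<lambda>t. t) u \<le> 1" for u
      unfolding skorokhod_gap_def by (rule cSUP_least) auto
    have g: "skorokhod_gap f g (\<lambda>t. t) u \<le> \<delta> + (1 / N) * u" if "0 \<le> u" for u
    proof (cases "u \<le> N")
      case True then show ?thesis using g1[OF that True] that \<open>N > 0\<close> by (simp add: add_increasing2)
    next
      case False then have "1 \<le> (1 / N) * u" using \<open>N > 0\<close> by (simp add: field_simps)
      then show ?thesis using g2[of u] \<open>\<delta> \<ge> 0\<close> by linarith
    qed
    have "(LINT u:{0..}|lborel. exp (- u) * skorokhod_gap f g (\<lambda>t. t) u) \<le>
      (LINT u|lborel. \<delta> * (exp (- u) * indicator {0..} u) + (1 / N) * (u * exp (- u) * indicator {0..} u))"
      unfolding set_lebesgue_integral_def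
    proof (rule integral_mono')
      show "integrable lborel (\<lambda>u. \<delta> * (exp (- u) * indicator {0..} u) + (1 / N) * (u * exp (- u) * indicator {0..} u))"
        using i by (simp add: has_bochner_integral_iff)
      fix u :: real
      show "0 \<le> \<delta> * (exp (- u) * indicator {0..} u) + (1 / N) * (u * exp (- u) * indicator {0..} u)"
        using assms by (auto simp: indicator_def)
      show "indicator {0..} u *\<^sub>R (exp (- u) * skorokhod_gap f g (\<lambda>t. t) u)
          \<le> \<delta> * (exp (- u) * indicator {0..} u) + (1 / N) * (u * exp (- u) * indicator {0..} u)"
      proof (cases "0 \<le> u")
        case True
        have "exp (- u) * skorokhod_gap f g (\<lambda>t. t) u \<le> exp (- u) * (\<delta> + (1 / N) * u)"
          by (intro mult_left_mono g True) simp
        then show ?thesis using True by (simp add: algebra_simps)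
      qed simp
    qed
    then show ?thesis using i by (simp add: has_bochner_integral_iff)
  qed
  moreover have "0 \<le> \<delta> + 1 / N" using \<open>\<delta> \<ge> 0\<close> \<open>N > 0\<close> by simp
  ultimately show ?thesis by (simp add: log_slopes_id max_def split: if_splits)
qed

text \<open>One index serves as time horizon and as precision. With \<open>k > 2 / r\<close> the
  locally uniform neighbourhood lies in the Skorokhod ball of radius r. Later arguments touch the
  Skorokhod distance only through this fact.\<close>

lemma skorokhod_open_local:
  fixes U :: "(real \<Rightarrow> 'b::metric_space) set"
  assumes "openin skorokhod U" "f \<in> U"
  obtains k :: nat where "\<And>g. g \<in> cadlag \<Longrightarrow>
    (\<And>t. t \<in> {0..real k} \<Longrightarrow> dist (f t) (g t) \<le> 1 / Suc k) \<Longrightarrow> g \<in> U"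
proof -
  obtain r where r: "r > 0" "\<And>g. g \<in> cadlag \<Longrightarrow> skorokhod_dist f g < r \<Longrightarrow> g \<in> U"
    using assms by (auto simp: openin_skorokhod)
  obtain k :: nat where k: "2 / r < real k" using reals_Archimedean2 by blast
  then have kp: "0 < real k" using r(1) by (meson divide_pos_pos less_trans zero_less_numeral)
  show thesis
  proof
    fix g assume g: "g \<in> cadlag" "\<And>t. t \<in> {0..real k} \<Longrightarrow> dist (f t) (g t) \<le> 1 / Suc k"
    have "skorokhod_dist f g \<le> 1 / Suc k + 1 / real k"
      by (rule skorokhod_dist_le) (use kp g in auto)
    also have "\<dots> \<le> 1 / real k + 1 / real k" using kp by (intro add_right_mono divide_left_mono) auto
    also have "\<dots> = 2 / real k" by simp
    also have "\<dots> < r" using k kp r(1) by (simp add: field_simps)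
    finally show "g \<in> U" using r g by blast
  qed
qed

text \<open>Quantifying over every bound \<delta> of the distance on [0, K] avoids suprema over the
  interval.\<close>

definition path_lipschitz :: "real \<Rightarrow> real \<Rightarrow> ((real \<Rightarrow> 'b::metric_space) \<Rightarrow> real) \<Rightarrow> bool" where
  "path_lipschitz K L H \<longleftrightarrow> (\<forall>f\<in>cont_paths. \<forall>g\<in>cont_paths. \<forall>\<delta>\<ge>0.
     (\<forall>t\<in>{0..K}. dist (f t) (g t) \<le> \<delta>) \<longrightarrow> \<bar>H f - H g\<bar> \<le> L * \<delta>)"

lemma path_lipschitzD:
  assumes "path_lipschitz K L H" "f \<in> cont_paths" "g \<in> cont_paths" "0 \<le> \<delta>"
    and "\<And>t. t \<in> {0..K} \<Longrightarrow> dist (f t) (g t) \<le> \<delta>"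
  shows "\<bar>H f - H g\<bar> \<le> L * \<delta>"
  using assms by (auto simp: path_lipschitz_def)

text \<open>The clamp of \<open>m t - j\<close> to [0, 1] is the fraction of edge j run through by
  time t. So this is linear interpolation of the values \<open>y j\<close> at the times
  \<open>j / m\<close>, constant after \<open>M / m\<close>; written as a sum over all edges it is
  visibly continuous.\<close>

definition polygon :: "nat \<Rightarrow> nat \<Rightarrow> (nat \<Rightarrow> 'b::real_normed_vector) \<Rightarrow> real \<Rightarrow> 'b" where
  "polygon m M y = (\<lambda>t\<in>{0..}. y 0 + (\<Sum>j<M. min 1 (max 0 (real m * t - real j)) *\<^sub>R (y (Suc j) - y j)))"

lemma polygon_in_cont_paths: "polygon m M y \<in> cont_paths"
proof -
  have "continuous_on {0..} (\<lambda>t. y 0 + (\<Sum>j<M. min 1 (max 0 (real m * t - real j)) *\<^sub>R (y (Suc j) - y j)))"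
    by (intro continuous_intros)
  then have "continuous_on {0..} (polygon m M y)"
    unfolding polygon_def by (subst continuous_on_cong[OF refl]) (auto simp: restrict_def)
  then show ?thesis by (simp add: cont_paths_def polygon_def)
qed

lemma polygon_near_vertex:
  assumes "j < M" "real j \<le> real m * t" "real m * t \<le> real j + 1" "0 \<le> t"
  shows "dist (polygon m M y t) (y j) \<le> dist (y (Suc j)) (y j)"
proof -
  have *: "(\<Sum>i<M. min 1 (max 0 (real m * t - real i)) *\<^sub>R (y (Suc i) - y i)) =
    (\<Sum>i<M. (if i < j then y (Suc i) - y i else 0) + (if i = j then (real m * t - real j) *\<^sub>R (y (Suc j) - y j) else 0))"
  proof (rule sum.cong[OF refl])
    fix i
    consider "i < j" | "i = j" | "i > j" by linarith
    then show "min 1 (max 0 (real m * t - real i)) *\<^sub>R (y (Suc i) - y i) =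
        (if i < j then y (Suc i) - y i else 0) + (if i = j then (real m * t - real j) *\<^sub>R (y (Suc j) - y j) else 0)"
    proof cases
      case 1 then have "real i + 1 \<le> real j" by linarith
      then have "min 1 (max 0 (real m * t - real i)) = 1" using assms by (simp add: min_def max_def)
      then show ?thesis using 1 by simp
    next
      case 2 then show ?thesis using assms by (simp add: min_def max_def)
    next
      case 3 then have "real j + 1 \<le> real i" by linarith
      then have "min 1 (max 0 (real m * t - real i)) = 0" using assms by (simp add: min_def max_def)
      then show ?thesis using 3 by simp
    qed
  qed
  have "(\<Sum>i<M. if i < j then y (Suc i) - y i else 0) = (\<Sum>i<j. y (Suc i) - y i)"
    by (rule sum.mono_neutral_cong_right) (use assms in auto)
  also have "\<dots> = y j - y 0" by (rule sum_lessThan_telescope)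
  finally have "polygon m M y t - y j = (real m * t - real j) *\<^sub>R (y (Suc j) - y j)"
    unfolding polygon_def using assms by (simp add: * sum.distrib sum.delta)
  then show ?thesis
    using assms by (simp add: dist_norm mult_left_le_one_le)
qed

text \<open>Each of the M increments changes by at most 2 \<delta> and the starting point by
  \<delta>. The growth with M is harmless, because M stays fixed while the vertices vary.\<close>

lemma polygon_diff:
  assumes "\<And>j. j \<le> M \<Longrightarrow> dist (y j) (z j) \<le> \<delta>" "0 \<le> t"
  shows "dist (polygon m M y t) (polygon m M z t) \<le> (1 + 2 * real M) * \<delta>"
proof -
  have "(\<Sum>j<M. min 1 (max 0 (real m * t - real j)) *\<^sub>R ((y (Suc j) - z (Suc j)) - (y j - z j))) =
    (\<Sum>j<M. min 1 (max 0 (real m * t - real j)) *\<^sub>R (y (Suc j) - y j) -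
      min 1 (max 0 (real m * t - real j)) *\<^sub>R (z (Suc j) - z j))"
    by (intro sum.cong refl) (simp only: scaleR_diff_right, simp)
  then have "norm (polygon m M y t - polygon m M z t) = norm ((y 0 - z 0) +
    (\<Sum>j<M. min 1 (max 0 (real m * t - real j)) *\<^sub>R ((y (Suc j) - z (Suc j)) - (y j - z j))))"
    using assms(2) unfolding polygon_def
    by (simp add: sum_subtractf add_diff_add del: scaleR_diff_right)
  also have "\<dots> \<le> norm (y 0 - z 0) + (\<Sum>j<M. 2 * \<delta>)"
  proof (intro norm_triangle_le add_mono order_refl sum_norm_le)
    fix j assume "j \<in> {..<M}"
    then have "norm ((y (Suc j) - z (Suc j)) - (y j - z j)) \<le> \<delta> + \<delta>"
      using assms(1)[of j] assms(1)[of "Suc j"] unfolding dist_norm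
      using norm_triangle_ineq4[of "y (Suc j) - z (Suc j)" "y j - z j"] by simp
    then show "norm (min 1 (max 0 (real m * t - real j)) *\<^sub>R ((y (Suc j) - z (Suc j)) - (y j - z j))) \<le> 2 * \<delta>"
      by (auto simp: intro!: order_trans[OF mult_left_le_one_le])
  qed
  also have "\<dots> \<le> \<delta> + 2 * real M * \<delta>" using assms(1)[of 0] by (simp add: dist_norm)
  finally show ?thesis by (simp add: dist_norm algebra_simps)
qed

text \<open>On the mesh interval of t both the path and the polygon stay within \<delta> of the left
  vertex. The range of t is half open so that the mesh index, the floor of \<open>m t\<close>, stays
  below \<open>m * K\<close>.\<close>

lemma polygon_near_path:
  fixes f :: "real \<Rightarrow> 'b::real_normed_vector"
  assumes "m > 0" and o: "\<And>j t. \<lbrakk>j < m * K; real j / m \<le> t; t \<le> (real j + 1) / m\<rbrakk> \<Longrightarrow> dist (f t) (y j) \<le> \<delta>"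
    "\<And>j. j < m * K \<Longrightarrow> dist (y (Suc j)) (y j) \<le> \<delta>" and t: "t \<in> {0..<real K}"
  shows "dist (f t) (polygon m (m * K) y t) \<le> 2 * \<delta>"
proof -
  define j where "j = nat \<lfloor>real m * t\<rfloor>"
  have j: "real j \<le> real m * t" "real m * t \<le> real j + 1" using t by (auto simp: j_def)
  have "real m * t < real m * real K" using t assms(1) by simp
  then have jM: "j < m * K" using j by (metis le_less_trans of_nat_less_iff of_nat_mult)
  have "dist (f t) (y j) \<le> \<delta>"
    by (rule o(1)[OF jM]) (use j assms(1) in \<open>auto simp: field_simps\<close>)
  moreover have "dist (polygon m (m * K) y t) (y j) \<le> \<delta>"
    using order_trans[OF polygon_near_vertex[OF jM j] o(2)[OF jM]] t by simp
  ultimately show ?thesis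
    using dist_triangle2[of "f t" "polygon m (m * K) y t" "y j"] by linarith
qed

lemma polygon_approx:
  fixes f :: "real \<Rightarrow> 'b::real_normed_vector"
  assumes "f \<in> cont_paths" "e > 0"
  shows "eventually (\<lambda>m. \<forall>t\<in>{0..<real K}. dist (f t) (polygon m (m * K) (\<lambda>j. f (real j / real m)) t) \<le> e) sequentially"
proof -
  have "uniformly_continuous_on {0..real K} f"
    by (rule compact_uniformly_continuous)
      (use assms in \<open>auto simp: cont_paths_def intro: continuous_on_subset\<close>)
  then obtain d where d: "d > 0" "\<And>s t. \<lbrakk>s \<in> {0..real K}; t \<in> {0..real K}; dist s t < d\<rbrakk> \<Longrightarrow> dist (f s) (f t) < e / 2"
    unfolding uniformly_continuous_on_def using assms(2) by (metis half_gt_zero)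
  obtain m0 :: nat where m0: "1 / d < real m0" using reals_Archimedean2 by blast
  have m0p: "m0 > 0" using m0 d(1) by (metis divide_pos_pos less_trans of_nat_0_less_iff zero_less_one)
  show ?thesis
    unfolding eventually_sequentially
  proof (intro exI[of _ m0] allI impI ballI)
    fix m t assume m: "m0 \<le> m" and t: "t \<in> {0..<real K}"
    have mp: "0 < real m" and md: "1 / real m < d"
      using m m0 m0p d(1) by (auto simp: field_simps) (smt (verit) mult_left_mono of_nat_mono)
    have aux: "(real j + 1) / real m \<le> real K" if "j < m * K" for j
    proof -
      have "real (Suc j) \<le> real (m * K)" using that by (intro of_nat_mono) simp
      then show ?thesis using mp by (simp add: field_simps)
    qed
    have "dist (f t) (polygon m (m * K) (\<lambda>j. f (real j / real m)) t) \<le> 2 * (e / 2)"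
    proof (rule polygon_near_path[OF _ _ _ t])
      fix j s assume js: "j < m * K" "real j / real m \<le> s" "s \<le> (real j + 1) / real m"
      have "dist s (real j / real m) \<le> 1 / real m" using js mp by (simp add: dist_real_def add_divide_distrib)
      then have "dist s (real j / real m) < d" using md by linarith
      then show "dist (f s) (f (real j / real m)) \<le> e / 2"
        using d(2)[of s "real j / real m"] js aux[OF js(1)] mp
        by (smt (verit) atLeastAtMost_iff divide_nonneg_nonneg of_nat_0_le_iff)
    next
      fix j assume j: "j < m * K"
      have "dist (real (Suc j) / real m) (real j / real m) = 1 / real m" using mp by (simp add: dist_real_def field_simps)
      then have "dist (real (Suc j) / real m) (real j / real m) < d" using md by linarith
      moreover have "real j / real m \<le> real (Suc j) / real m" "0 \<le> real j / real m"
        using mp by (auto simp: divide_right_mono)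
      ultimately show "dist (f (real (Suc j) / real m)) (f (real j / real m)) \<le> e / 2"
        using d(2)[of "real (Suc j) / real m" "real j / real m"] aux[OF j]
        by (smt (verit) atLeastAtMost_iff of_nat_Suc)
    qed (use mp in auto)
    then show "dist (f t) (polygon m (m * K) (\<lambda>j. f (real j / real m)) t) \<le> e" by simp
  qed
qed


text \<open>Continuity is meant for the product topology on vertex sequences, where only the
  coordinates up to M matter. It serves to make \<open>H\<close> of a random polygon
  measurable.\<close>

lemma path_lipschitz_polygon_continuous:
  fixes H :: "(real \<Rightarrow> 'b::real_normed_vector) \<Rightarrow> real"
  assumes H: "path_lipschitz K L H"
  shows "continuous_on UNIV (\<lambda>y. H (polygon m M y))"
proof -
  have "((\<lambda>z. H (polygon m M z)) \<longlongrightarrow> H (polygon m M y)) (at y)" for y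
  proof (rule tendstoI)
    fix e :: real assume "e > 0"
    define \<delta> where "\<delta> = e / ((\<bar>L\<bar> + 1) * (1 + 2 * real M))"
    have \<delta>: "\<delta> > 0" using \<open>e > 0\<close> by (simp add: \<delta>_def)
    have "(\<bar>L\<bar> + 1) * ((1 + 2 * real M) * \<delta>) = e"
    proof -
      have "(\<bar>L\<bar> + 1) * (1 + 2 * real M) > 0" by (intro mult_pos_pos) auto
      then show ?thesis unfolding \<delta>_def by (simp add: mult.assoc[symmetric])
    qed
    moreover have "0 < (1 + 2 * real M) * \<delta>" using \<delta> by simp
    ultimately have Le: "L * ((1 + 2 * real M) * \<delta>) < e"
      by (smt (verit) mult_strict_right_mono)
    have "eventually (\<lambda>z. \<forall>j\<in>{..M}. dist (z j) (y j) < \<delta>) (at y)"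
    proof (rule eventually_ball_finite)
      show "\<forall>j\<in>{..M}. eventually (\<lambda>z. dist (z j) (y j) < \<delta>) (at y)"
      proof
        fix j
        have "isCont (\<lambda>z. z j) y"
          using continuous_on_product_coordinates[of j] continuous_on_eq_continuous_at[OF open_UNIV] by blast
        then show "eventually (\<lambda>z. dist (z j) (y j) < \<delta>) (at y)"
          using \<delta> by (auto simp: isCont_def dest: tendstoD)
      qed
    qed simp
    then show "eventually (\<lambda>z. dist (H (polygon m M z)) (H (polygon m M y)) < e) (at y)"
    proof eventually_elim
      case (elim z)
      have "\<bar>H (polygon m M z) - H (polygon m M y)\<bar> \<le> L * ((1 + 2 * real M) * \<delta>)"
      proof -
        have "\<forall>t\<in>{0..K}. dist (polygon m M z t) (polygon m M y t) \<le> (1 + 2 * real M) * \<delta>"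
          using elim by (intro ballI polygon_diff) (auto intro: less_imp_le)
        then show ?thesis
          using H \<delta> polygon_in_cont_paths unfolding path_lipschitz_def by (simp add: polygon_in_cont_paths)
      qed
      then show ?case using Le by (simp add: dist_real_def)
    qed
  qed
  then show ?thesis by (simp add: continuous_on_eq_continuous_at isCont_def)
qed

text \<open>The polygons run up to time \<open>Suc K\<close>, since the approximation holds on a
  half-open interval and this must contain [0, K].\<close>

lemma path_lipschitz_polygon_LIMSEQ:
  fixes H :: "(real \<Rightarrow> 'b::real_normed_vector) \<Rightarrow> real"
  assumes H: "path_lipschitz (real K) L H" and f: "f \<in> cont_paths"
  shows "(\<lambda>m. H (polygon m (m * Suc K) (\<lambda>j. f (real j / real m)))) \<longlonglongrightarrow> H f"
proof (rule LIMSEQ_I)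
  fix r :: real assume r: "r > 0"
  define e where "e = r / (\<bar>L\<bar> + 1)"
  have e: "e > 0" using r by (simp add: e_def)
  have "(\<bar>L\<bar> + 1) * e = r" by (simp add: e_def)
  then have Le: "L * e < r" using e by (smt (verit) mult_strict_right_mono)
  have "eventually (\<lambda>m. norm (H (polygon m (m * Suc K) (\<lambda>j. f (real j / real m))) - H f) < r) sequentially"
    using polygon_approx[OF f e, of "Suc K"]
  proof eventually_elim
    case (elim m)
    have "\<forall>t\<in>{0..real K}. dist (f t) (polygon m (m * Suc K) (\<lambda>j. f (real j / real m)) t) \<le> e"
      using elim by auto
    then have "\<bar>H f - H (polygon m (m * Suc K) (\<lambda>j. f (real j / real m)))\<bar> \<le> L * e"
      using H f e polygon_in_cont_paths unfolding path_lipschitz_def by (metis less_imp_le)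
    then show ?case using Le by simp
  qed
  then show "\<exists>no. \<forall>n\<ge>no. norm (H (polygon n (n * Suc K) (\<lambda>j. f (real j / real n))) - H f) < r"
    by (simp add: eventually_sequentially)
qed

section \<open>Measurability of Lipschitz functionals of a random path\<close>

lemma polygon_measurable:
  fixes H :: "(real \<Rightarrow> 'b::{real_normed_vector, second_countable_topology}) \<Rightarrow> real"
  assumes H: "path_lipschitz K L H" and Y: "\<And>j. Y j \<in> borel_measurable M"
  shows "(\<lambda>\<omega>. H (polygon m N (\<lambda>j. Y j \<omega>))) \<in> borel_measurable M"
  by (rule measurable_compose[of "\<lambda>\<omega> j. Y j \<omega>" M borel])
     (auto intro: measurable_coordinatewise_then_product Y
       borel_measurable_continuous_onI path_lipschitz_polygon_continuous[OF H])

text \<open>\<open>H\<close> of the path is the pointwise limit of its values on polygons through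
  finitely many of the variables \<open>X (j / m)\<close>, so measurability of each
  \<open>X t\<close> carries over.\<close>

lemma path_lipschitz_measurable:
  fixes X :: "real \<Rightarrow> 'a \<Rightarrow> 'b::{real_normed_vector, second_countable_topology}"
  assumes H: "path_lipschitz (real K) L H"
    and X: "\<And>t. 0 \<le> t \<Longrightarrow> X t \<in> borel_measurable M"
    and c: "\<And>\<omega>. \<omega> \<in> space M \<Longrightarrow> path_of X \<omega> \<in> cont_paths"
  shows "(\<lambda>\<omega>. H (path_of X \<omega>)) \<in> borel_measurable M"
proof (rule borel_measurable_LIMSEQ_real)
  show "(\<lambda>\<omega>. H (polygon m (m * Suc K) (\<lambda>j. path_of X \<omega> (real j / real m)))) \<in> borel_measurable M" for m
    by (rule polygon_measurable[OF H]) (simp add: path_of_def X)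
qed (use path_lipschitz_polygon_LIMSEQ[OF H c] in simp)

text \<open>Inf-convolution of \<open>F\<close> with k times the uniform distance on [0, k]; the
  index k is both slope and horizon. As in \<open>path_lipschitz\<close>, a bound \<delta> stands
  for the supremum distance.\<close>

definition inf_conv :: "nat \<Rightarrow> ((real \<Rightarrow> 'b::metric_space) \<Rightarrow> real) \<Rightarrow> (real \<Rightarrow> 'b) \<Rightarrow> real" where
  "inf_conv k F g = Inf {F h + real k * \<delta> | h \<delta>. h \<in> cont_paths \<and> 0 \<le> \<delta> \<and>
     (\<forall>t\<in>{0..real k}. dist (g t) (h t) \<le> \<delta>)}"

text \<open>Lower semicontinuity at continuous paths for locally uniform convergence, with one index
  for horizon and precision so as to match \<open>skorokhod_open_local\<close>.\<close>

definition path_lsc :: "((real \<Rightarrow> 'b::metric_space) \<Rightarrow> real) \<Rightarrow> bool" where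
  "path_lsc F \<longleftrightarrow> (\<forall>f\<in>cont_paths. \<forall>e>0. \<exists>k::nat. \<forall>g\<in>cont_paths.
     (\<forall>t\<in>{0..real k}. dist (f t) (g t) \<le> 1 / Suc k) \<longrightarrow> F f - e < F g)"

context
  fixes F :: "(real \<Rightarrow> 'b::metric_space) \<Rightarrow> real" and B :: real
  assumes F: "\<And>f. f \<in> cont_paths \<Longrightarrow> 0 \<le> F f \<and> F f \<le> B"
begin

lemma inf_conv_bdd:
  "bdd_below {F h + real k * \<delta> | h \<delta>. h \<in> cont_paths \<and> 0 \<le> \<delta> \<and> (\<forall>t\<in>{0..real k}. dist (g t) (h t) \<le> \<delta>)}"
  using F by (intro bdd_belowI[of _ 0]) auto

lemma inf_conv_le:
  assumes "g \<in> cont_paths" shows "inf_conv k F g \<le> F g"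
  unfolding inf_conv_def
  by (rule cInf_lower[OF _ inf_conv_bdd]) (use assms in \<open>auto intro!: exI[of _ g] exI[of _ 0]\<close>)

lemma inf_conv_nonneg:
  assumes "g \<in> cont_paths" shows "0 \<le> inf_conv k F g"
  unfolding inf_conv_def
  by (rule cInf_greatest) (use assms F in \<open>auto intro!: exI[of _ g] exI[of _ 0]\<close>)

text \<open>Triangle inequality: a competitor \<open>(h, \<delta>')\<close> for g is a competitor
  \<open>(h, \<delta> + \<delta>')\<close> for f.\<close>

lemma inf_conv_lipschitz: "path_lipschitz (real k) (real k) (inf_conv k F)"
proof -
  have *: "inf_conv k F f \<le> inf_conv k F g + real k * \<delta>"
    if "f \<in> cont_paths" "g \<in> cont_paths" "0 \<le> \<delta>" and d: "\<forall>t\<in>{0..real k}. dist (f t) (g t) \<le> \<delta>" for f g \<delta>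
  proof -
    have "inf_conv k F f - real k * \<delta> \<le> inf_conv k F g"
      unfolding inf_conv_def[of k F g]
    proof (rule cInf_greatest)
      fix a assume "a \<in> {F h + real k * \<delta> | h \<delta>. h \<in> cont_paths \<and> 0 \<le> \<delta> \<and> (\<forall>t\<in>{0..real k}. dist (g t) (h t) \<le> \<delta>)}"
      then obtain h \<delta>' where h: "a = F h + real k * \<delta>'" "h \<in> cont_paths" "0 \<le> \<delta>'"
        "\<forall>t\<in>{0..real k}. dist (g t) (h t) \<le> \<delta>'" by auto
      have "\<forall>t\<in>{0..real k}. dist (f t) (h t) \<le> \<delta> + \<delta>'"
        using d h(4) by (meson add_mono dist_triangle order_trans)
      then have "inf_conv k F f \<le> F h + real k * (\<delta> + \<delta>')"
        unfolding inf_conv_def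
        by (intro cInf_lower inf_conv_bdd) (use h that in \<open>auto intro!: exI[of _ h] exI[of _ "\<delta> + \<delta>'"]\<close>)
      then show "inf_conv k F f - real k * \<delta> \<le> a" using h(1) by (simp add: algebra_simps)
    qed (use that in \<open>auto intro!: exI[of _ g] exI[of _ 0]\<close>)
    then show ?thesis by simp
  qed
  show ?thesis
    unfolding path_lipschitz_def
  proof (intro ballI allI impI)
    fix f g :: "real \<Rightarrow> 'b" and \<delta> :: real
    assume a: "f \<in> cont_paths" "g \<in> cont_paths" "0 \<le> \<delta>" "\<forall>t\<in>{0..real k}. dist (f t) (g t) \<le> \<delta>"
    then show "\<bar>inf_conv k F f - inf_conv k F g\<bar> \<le> real k * \<delta>"
      using *[of f g \<delta>] *[of g f \<delta>] by (simp add: dist_commute abs_le_iff)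
  qed
qed

lemma inf_conv_LIMSEQ:
  assumes lsc: "path_lsc F" and g: "g \<in> cont_paths"
  shows "(\<lambda>k. inf_conv k F g) \<longlonglongrightarrow> F g"
proof (rule LIMSEQ_I)
  fix r :: real assume r: "r > 0"
  obtain k :: nat where k: "\<And>h. h \<in> cont_paths \<Longrightarrow> \<forall>t\<in>{0..real k}. dist (g t) (h t) \<le> 1 / Suc k \<Longrightarrow> F g - r / 2 < F h"
    using lsc g r unfolding path_lsc_def by (metis half_gt_zero)
  \<comment> \<open>Beyond this m a competitor with \<delta> above \<open>1 / Suc k\<close> pays a
    penalty of at least \<open>B + 1\<close>, more than \<open>F g\<close>. Closer competitors are
    handled by semicontinuity.\<close>
  obtain m :: nat where m: "(B + 1) * Suc k < real m" using reals_Archimedean2 by blast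
  show "\<exists>no. \<forall>n\<ge>no. norm (inf_conv n F g - F g) < r"
  proof (intro exI[of _ "max k m"] allI impI)
    fix n assume n: "max k m \<le> n"
    have "F g - r / 2 \<le> inf_conv n F g"
      unfolding inf_conv_def
    proof (rule cInf_greatest)
      fix a assume "a \<in> {F h + real n * \<delta> | h \<delta>. h \<in> cont_paths \<and> 0 \<le> \<delta> \<and> (\<forall>t\<in>{0..real n}. dist (g t) (h t) \<le> \<delta>)}"
      then obtain h \<delta> where h: "a = F h + real n * \<delta>" "h \<in> cont_paths" "0 \<le> \<delta>"
        "\<forall>t\<in>{0..real n}. dist (g t) (h t) \<le> \<delta>" by auto
      show "F g - r / 2 \<le> a"
      proof (cases "\<delta> \<le> 1 / Suc k")
        case True
        have "real k \<le> real n" using n by simp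
        then have "\<forall>t\<in>{0..real k}. dist (g t) (h t) \<le> 1 / Suc k"
          using h(4) True by (meson atLeastAtMost_iff order_trans)
        then show ?thesis using k[OF h(2)] h(1,3) by (smt (verit) mult_nonneg_nonneg of_nat_0_le_iff)
      next
        case False
        have "B + 1 = ((B + 1) * Suc k) * (1 / Suc k)" by simp
        also have "\<dots> \<le> real n * \<delta>" using False m n F[OF g] by (intro mult_mono) auto
        finally show ?thesis using F[OF g] F[OF h(2)] h(1) r by linarith
      qed
    qed (use g in \<open>auto intro!: exI[of _ g] exI[of _ 0]\<close>)
    then show "norm (inf_conv n F g - F g) < r" using inf_conv_le[OF g, of n] r by simp
  qed
qed

end

section \<open>From Lipschitz to semicontinuous and Skorokhod-continuous functionals\<close>

lemma path_lsc_measurable: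
  fixes X :: "real \<Rightarrow> 'a \<Rightarrow> 'b::{real_normed_vector, second_countable_topology}"
  assumes F: "\<And>f. f \<in> cont_paths \<Longrightarrow> 0 \<le> F f \<and> F f \<le> B" "path_lsc F"
    and X: "\<And>t. 0 \<le> t \<Longrightarrow> X t \<in> borel_measurable M"
    and c: "\<And>\<omega>. \<omega> \<in> space M \<Longrightarrow> path_of X \<omega> \<in> cont_paths"
  shows "(\<lambda>\<omega>. F (path_of X \<omega>)) \<in> borel_measurable M"
proof (rule borel_measurable_LIMSEQ_real)
  show "(\<lambda>\<omega>. inf_conv k F (path_of X \<omega>)) \<in> borel_measurable M" for k
    by (rule path_lipschitz_measurable[OF inf_conv_lipschitz[of F B] X c]) (use F in auto)
qed (use inf_conv_LIMSEQ[of F B, OF _ _ c] F in simp)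

text \<open>It suffices to look at preimages of open sets. The indicator of an open set is lower
  semicontinuous, so its value at the random path is a random variable.\<close>

lemma path_of_measurable:
  fixes X :: "real \<Rightarrow> 'a \<Rightarrow> 'b::{real_normed_vector, second_countable_topology}"
  assumes X: "\<And>t. 0 \<le> t \<Longrightarrow> X t \<in> borel_measurable M"
    and c: "\<And>\<omega>. \<omega> \<in> space M \<Longrightarrow> path_of X \<omega> \<in> cont_paths"
  shows "path_of X \<in> M \<rightarrow>\<^sub>M borel_sets_of skorokhod"
  unfolding borel_sets_of_def
proof (rule measurable_measure_of)
  show "path_of X \<in> space M \<rightarrow> topspace skorokhod"
    using c cont_paths_subset_cadlag by (auto simp: topspace_skorokhod)
  fix U assume "U \<in> {U. openin (skorokhod :: (real \<Rightarrow> 'b) topology) U}"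
  then have U: "openin skorokhod U" by simp
  have "path_lsc (\<lambda>f. indicator U f)"
    unfolding path_lsc_def
  proof (intro ballI allI impI)
    fix f :: "real \<Rightarrow> 'b" and e :: real assume f: "f \<in> cont_paths" and e: "e > 0"
    show "\<exists>k. \<forall>g\<in>cont_paths. (\<forall>t\<in>{0..real k}. dist (f t) (g t) \<le> 1 / real (Suc k)) \<longrightarrow>
              indicator U f - e < indicator U g"
    proof (cases "f \<in> U")
      case True
      obtain k :: nat where "\<And>g. g \<in> cadlag \<Longrightarrow>
          (\<And>t. t \<in> {0..real k} \<Longrightarrow> dist (f t) (g t) \<le> 1 / Suc k) \<Longrightarrow> g \<in> U"
        using skorokhod_open_local[OF U True] by blast
      then show ?thesis using cont_paths_subset_cadlag e
        by (intro exI[of _ k] ballI impI) (auto simp: indicator_def)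
    next
      case False then show ?thesis using e by (auto simp: indicator_def)
    qed
  qed
  then have m: "(\<lambda>\<omega>. indicator U (path_of X \<omega>) :: real) \<in> borel_measurable M"
    by (intro path_lsc_measurable[where B = 1] X c) (auto simp: indicator_def)
  have "path_of X -` U \<inter> space M = {\<omega> \<in> space M. indicator U (path_of X \<omega>) > (1/2::real)}"
    by (auto simp: indicator_def)
  also have "\<dots> \<in> sets M" using m by measurable
  finally show "path_of X -` U \<inter> space M \<in> sets M" .
qed (auto dest: openin_subset)

text \<open>Half of a portmanteau argument: \<open>inf_conv k F\<close> lies below \<open>F\<close>,
  and its integral under the limit law approaches that of \<open>F\<close>. First k is fixed at a
  loss of e / 2, then the hypothesis \<open>lim\<close> for this Lipschitz functional costs the
  other e / 2.\<close>

lemma path_lsc_liminf: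
  fixes X :: "nat \<Rightarrow> real \<Rightarrow> 'a \<Rightarrow> 'b::{real_normed_vector, second_countable_topology}"
    and Y :: "real \<Rightarrow> 'c \<Rightarrow> 'b"
  assumes M: "\<And>n. prob_space (M n)" and N: "prob_space N"
    and X: "\<And>n t. 0 \<le> t \<Longrightarrow> X n t \<in> borel_measurable (M n)"
    and Xc: "\<And>n \<omega>. \<omega> \<in> space (M n) \<Longrightarrow> path_of (X n) \<omega> \<in> cont_paths"
    and Y: "\<And>t. 0 \<le> t \<Longrightarrow> Y t \<in> borel_measurable N"
    and Yc: "\<And>\<omega>. \<omega> \<in> space N \<Longrightarrow> path_of Y \<omega> \<in> cont_paths"
    and lim: "\<And>K H L B. \<lbrakk>path_lipschitz (real K) L H; \<And>f. f \<in> cont_paths \<Longrightarrow> 0 \<le> H f \<and> H f \<le> B\<rbrakk> \<Longrightarrow>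
        (\<lambda>n. LINT \<omega>|M n. H (path_of (X n) \<omega>)) \<longlonglongrightarrow> (LINT \<omega>|N. H (path_of Y \<omega>))"
    and F: "\<And>f. f \<in> cont_paths \<Longrightarrow> 0 \<le> F f \<and> F f \<le> B" "path_lsc F" and e: "e > 0"
  shows "eventually (\<lambda>n. (LINT \<omega>|N. F (path_of Y \<omega>)) - e < (LINT \<omega>|M n. F (path_of (X n) \<omega>))) sequentially"
proof -
  interpret N: prob_space N by fact
  note ic = inf_conv_le[of F B] inf_conv_nonneg[of F B]
  have icB: "0 \<le> inf_conv k F f \<and> inf_conv k F f \<le> B" if "f \<in> cont_paths" for k f
    using ic[of f k] F(1)[OF that] F(1) that by fastforce
  have "(\<lambda>k. LINT \<omega>|N. inf_conv k F (path_of Y \<omega>)) \<longlonglongrightarrow> (LINT \<omega>|N. F (path_of Y \<omega>))"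
  proof (rule integral_dominated_convergence[where w = "\<lambda>_. B"])
    show "(\<lambda>\<omega>. F (path_of Y \<omega>)) \<in> borel_measurable N"
      by (rule path_lsc_measurable[OF F Y Yc])
    show "(\<lambda>\<omega>. inf_conv k F (path_of Y \<omega>)) \<in> borel_measurable N" for k
      by (rule path_lipschitz_measurable[OF inf_conv_lipschitz[of F B] Y Yc]) (use F in auto)
    show "AE \<omega> in N. (\<lambda>k. inf_conv k F (path_of Y \<omega>)) \<longlonglongrightarrow> F (path_of Y \<omega>)"
      using inf_conv_LIMSEQ[of F B, OF _ _ Yc] F by simp
    show "AE \<omega> in N. norm (inf_conv k F (path_of Y \<omega>)) \<le> B" for k
      using icB[OF Yc] by simp
  qed simp
  then have "eventually (\<lambda>k. (LINT \<omega>|N. F (path_of Y \<omega>)) - e / 2 < (LINT \<omega>|N. inf_conv k F (path_of Y \<omega>))) sequentially"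
    by (rule order_tendstoD) (use e in simp)
  then obtain k where k: "(LINT \<omega>|N. F (path_of Y \<omega>)) - e / 2 < (LINT \<omega>|N. inf_conv k F (path_of Y \<omega>))"
    by (auto simp: eventually_sequentially)
  have "(\<lambda>n. LINT \<omega>|M n. inf_conv k F (path_of (X n) \<omega>)) \<longlonglongrightarrow> (LINT \<omega>|N. inf_conv k F (path_of Y \<omega>))"
    by (rule lim[OF inf_conv_lipschitz[of F B]]) (use F icB in auto)
  then have "eventually (\<lambda>n. (LINT \<omega>|N. inf_conv k F (path_of Y \<omega>)) - e / 2 < (LINT \<omega>|M n. inf_conv k F (path_of (X n) \<omega>))) sequentially"
    by (rule order_tendstoD) (use e in simp)
  then show ?thesis
  proof eventually_elim
    case (elim n)
    interpret Mn: prob_space "M n" by (rule M)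
    have "(LINT \<omega>|M n. inf_conv k F (path_of (X n) \<omega>)) \<le> (LINT \<omega>|M n. F (path_of (X n) \<omega>))"
    proof (rule integral_mono)
      show "integrable (M n) (\<lambda>\<omega>. inf_conv k F (path_of (X n) \<omega>))"
        by (rule Mn.integrable_const_bound[where B = B])
           (use icB[OF Xc[of _ n]] path_lipschitz_measurable[OF inf_conv_lipschitz[of F B] X Xc] F in auto)
      show "integrable (M n) (\<lambda>\<omega>. F (path_of (X n) \<omega>))"
        by (rule Mn.integrable_const_bound[where B = B])
           (use F(1)[OF Xc[of _ n]] path_lsc_measurable[OF F X Xc] in auto)
    qed (use ic(1)[OF _ Xc] F in auto)
    then show ?case using elim k by linarith
  qed
qed

text \<open>The set where \<open>F\<close> exceeds \<open>F f - e\<close> is Skorokhod open and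
  contains f.\<close>

lemma skorokhod_continuous_path_lsc:
  fixes F :: "(real \<Rightarrow> 'b::metric_space) \<Rightarrow> real"
  assumes "continuous_map skorokhod euclideanreal F"
  shows "path_lsc F"
  unfolding path_lsc_def
proof (intro ballI allI impI)
  fix f :: "real \<Rightarrow> 'b" and e :: real assume f: "f \<in> cont_paths" and e: "e > 0"
  have U: "openin skorokhod {g \<in> topspace skorokhod. F g \<in> {F f - e<..}}"
    by (rule openin_continuous_map_preimage[OF assms]) simp
  have "f \<in> {g \<in> topspace skorokhod. F g \<in> {F f - e<..}}"
    using f e cont_paths_subset_cadlag by (auto simp: topspace_skorokhod)
  from skorokhod_open_local[OF U this] obtain k :: nat where "\<And>g. g \<in> cadlag \<Longrightarrow>
          (\<And>t. t \<in> {0..real k} \<Longrightarrow> dist (f t) (g t) \<le> 1 / Suc k) \<Longrightarrow> g \<in> {g \<in> topspace skorokhod. F g \<in> {F f - e<..}}"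
    by blast
  then show "\<exists>k. \<forall>g\<in>cont_paths. (\<forall>t\<in>{0..real k}. dist (f t) (g t) \<le> 1 / real (Suc k)) \<longrightarrow> F f - e < F g"
    using cont_paths_subset_cadlag by (intro exI[of _ k]) auto
qed

text \<open>The one-sided estimate is applied to \<open>b + F\<close> and to \<open>b - F\<close>,
  both nonnegative and lower semicontinuous; the two bounds together give convergence.\<close>

lemma path_law_LIMSEQ:
  fixes X :: "nat \<Rightarrow> real \<Rightarrow> 'a \<Rightarrow> 'b::{real_normed_vector, second_countable_topology}"
    and Y :: "real \<Rightarrow> 'c \<Rightarrow> 'b"
  assumes M: "\<And>n. prob_space (M n)" and N: "prob_space N"
    and X: "\<And>n t. 0 \<le> t \<Longrightarrow> X n t \<in> borel_measurable (M n)"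
    and Xc: "\<And>n \<omega>. \<omega> \<in> space (M n) \<Longrightarrow> path_of (X n) \<omega> \<in> cont_paths"
    and Y: "\<And>t. 0 \<le> t \<Longrightarrow> Y t \<in> borel_measurable N"
    and Yc: "\<And>\<omega>. \<omega> \<in> space N \<Longrightarrow> path_of Y \<omega> \<in> cont_paths"
    and lim: "\<And>K H L B. \<lbrakk>path_lipschitz (real K) L H; \<And>f. f \<in> cont_paths \<Longrightarrow> 0 \<le> H f \<and> H f \<le> B\<rbrakk> \<Longrightarrow>
        (\<lambda>n. LINT \<omega>|M n. H (path_of (X n) \<omega>)) \<longlonglongrightarrow> (LINT \<omega>|N. H (path_of Y \<omega>))"
    and F: "continuous_map skorokhod euclideanreal F" "bounded (F ` topspace skorokhod)"
  shows "(\<lambda>n. LINT z|path_law (M n) (X n). F z) \<longlonglongrightarrow> (LINT z|path_law N Y. F z)"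
proof -
  obtain b where b: "\<And>f. f \<in> cadlag \<Longrightarrow> \<bar>F f\<bar> \<le> b"
    using F(2) by (auto simp: bounded_iff topspace_skorokhod)
  have b: "\<bar>F f\<bar> \<le> b" if "f \<in> cont_paths" for f
    using b that cont_paths_subset_cadlag by blast
  interpret N: prob_space N by fact
  have sh: "path_lsc (\<lambda>f. b + s * F f)" if "s = 1 \<or> s = -1" for s :: real
    by (rule skorokhod_continuous_path_lsc) (intro continuous_intros F(1) | simp)+
  have sb: "0 \<le> b + s * F f \<and> b + s * F f \<le> 2 * b" if "s = 1 \<or> s = -1" "f \<in> cont_paths" for s f
    using b[OF that(2)] that(1) by auto
  have F_borel: "F \<in> borel_measurable (borel_sets_of skorokhod)"
  proof (rule borel_measurableI)
    fix S :: "real set" assume "open S"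
    then have "openin skorokhod {x \<in> topspace skorokhod. F x \<in> S}"
      by (intro openin_continuous_map_preimage[OF F(1)]) simp
    then have "{x \<in> topspace skorokhod. F x \<in> S} \<in> sets (borel_sets_of skorokhod)"
      unfolding borel_sets_of_def by (subst sets_measure_of) (auto dest: openin_subset)
    moreover have "F -` S \<inter> space (borel_sets_of skorokhod) = {x \<in> topspace skorokhod. F x \<in> S}"
      unfolding borel_sets_of_def by (auto simp: space_measure_of_conv)
    ultimately show "F -` S \<inter> space (borel_sets_of skorokhod) \<in> sets (borel_sets_of skorokhod)" by simp
  qed
  have eX: "(LINT z|path_law (M n) (X n). F z) = (LINT \<omega>|M n. F (path_of (X n) \<omega>))" for n
    unfolding path_law_def by (intro integral_distr path_of_measurable X Xc F_borel)
  have eY: "(LINT z|path_law N Y. F z) = (LINT \<omega>|N. F (path_of Y \<omega>))"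
    unfolding path_law_def by (intro integral_distr path_of_measurable Y Yc F_borel)
  have intX: "integrable (M n) (\<lambda>\<omega>. F (path_of (X n) \<omega>))" for n
  proof -
    interpret Mn: prob_space "M n" by (rule M)
    show ?thesis
      by (rule Mn.integrable_const_bound[where B = b])
         (use b[OF Xc[of _ n]] measurable_compose[OF path_of_measurable[OF X Xc] F_borel] in auto)
  qed
  have intY: "integrable N (\<lambda>\<omega>. F (path_of Y \<omega>))"
    by (rule N.integrable_const_bound[where B = b])
       (use b[OF Yc] measurable_compose[OF path_of_measurable[OF Y Yc] F_borel] in auto)
  have one: "eventually (\<lambda>n. s * (LINT \<omega>|N. F (path_of Y \<omega>)) - e < s * (LINT \<omega>|M n. F (path_of (X n) \<omega>))) sequentially"
    if s: "s = 1 \<or> s = -1" and "e > 0" for s e :: real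
  proof -
    have a: "(LINT \<omega>|N. b + s * F (path_of Y \<omega>)) = b + s * (LINT \<omega>|N. F (path_of Y \<omega>))"
      using intY by (simp add: N.prob_space)
    have a': "(LINT \<omega>|M n. b + s * F (path_of (X n) \<omega>)) = b + s * (LINT \<omega>|M n. F (path_of (X n) \<omega>))" for n
    proof -
      interpret Mn: prob_space "M n" by (rule M)
      show ?thesis using intX[of n] by (simp add: Mn.prob_space)
    qed
    have "eventually (\<lambda>n. (LINT \<omega>|N. b + s * F (path_of Y \<omega>)) - e < (LINT \<omega>|M n. b + s * F (path_of (X n) \<omega>))) sequentially"
      by (rule path_lsc_liminf[where B = "2 * b", OF M N X Xc Y Yc lim sb[OF s] sh[OF s] \<open>e > 0\<close>])
    then show ?thesis unfolding a a' by simp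
  qed
  show ?thesis
    unfolding eX eY
  proof (rule tendstoI)
    fix e :: real assume "e > 0"
    show "eventually (\<lambda>n. dist (LINT \<omega>|M n. F (path_of (X n) \<omega>)) (LINT \<omega>|N. F (path_of Y \<omega>)) < e) sequentially"
      using one[of 1, OF _ \<open>e > 0\<close>, simplified] one[of "-1", OF _ \<open>e > 0\<close>, simplified]
      by eventually_elim (simp add: dist_real_def)
  qed
qed

section \<open>Convergence of characteristic functions\<close>

lemma prod_iexp: "finite J \<Longrightarrow> (\<Prod>j\<in>J. iexp (f j)) = iexp (\<Sum>j\<in>J. f j)"
  by (induction J rule: finite_induct) (simp_all add: exp_add distrib_left)

text \<open>For positive \<sigma>, the density at y of a Gaussian vector with mean x and independent
  components of standard deviation \<sigma>.\<close>

definition gauss_kernel :: "'j set \<Rightarrow> real \<Rightarrow> ('j \<Rightarrow> real) \<Rightarrow> ('j \<Rightarrow> real) \<Rightarrow> real" where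
  "gauss_kernel J \<sigma> x y = (\<Prod>j\<in>J. normal_density (x j) \<sigma> (y j))"

lemma gauss_kernel_nonneg: "0 \<le> gauss_kernel J \<sigma> x y"
  by (simp add: gauss_kernel_def prod_nonneg)

lemma normal_density_comp[measurable]:
  "f \<in> borel_measurable M \<Longrightarrow> g \<in> borel_measurable M \<Longrightarrow> (\<lambda>x. normal_density (f x) \<sigma> (g x)) \<in> borel_measurable M"
  unfolding normal_density_def by simp

lemma std_normal_iexp:
  "(CLINT z|std_normal_distribution. iexp (t * z)) = complex_of_real (exp (- t\<^sup>2 / 2))"
  using fun_cong[OF char_std_normal_distribution, of t] by (simp add: char_def)

interpretation lb: product_sigma_finite "\<lambda>_. lborel :: real measure"
  by standard

interpretation std_normal: prob_space std_normal_distribution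
  by (rule prob_space_normal_density) simp

interpretation sn: product_sigma_finite "\<lambda>_. std_normal_distribution"
  by standard

context
  fixes J :: "'j set" and \<sigma> :: real
  assumes J[simp]: "finite J" and \<sigma>[simp]: "0 < \<sigma>"
begin

lemma gauss_kernel_measurable[measurable]:
  assumes "f \<in> M \<rightarrow>\<^sub>M PiM J (\<lambda>_. borel)" "g \<in> M \<rightarrow>\<^sub>M PiM J (\<lambda>_. borel)"
  shows "(\<lambda>x. gauss_kernel J \<sigma> (f x) (g x)) \<in> borel_measurable M"
proof -
  have [measurable]: "(\<lambda>x. f x j) \<in> borel_measurable M" "(\<lambda>x. g x j) \<in> borel_measurable M" if "j \<in> J" for j
    using that assms by (auto intro: measurable_compose[OF _ measurable_component_singleton])
  show ?thesis unfolding gauss_kernel_def by measurable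
qed

lemma integrable_gauss_kernel: "integrable (PiM J (\<lambda>_. lborel)) (gauss_kernel J \<sigma> x)"
  unfolding gauss_kernel_def by (rule lb.product_integrable_prod) auto

lemma integral_gauss_kernel: "(LINT y|PiM J (\<lambda>_. lborel). gauss_kernel J \<sigma> x y) = 1"
  unfolding gauss_kernel_def by (subst lb.product_integral_prod) auto

lemma gauss_kernel_moment:
  assumes j: "j \<in> J"
  shows "has_bochner_integral (PiM J (\<lambda>_. lborel)) (\<lambda>y. \<bar>y j - x j\<bar> * gauss_kernel J \<sigma> x y) (\<sigma> * sqrt (2 / pi))"
proof -
  \<comment> \<open>The absolute value is put into factor j, so that the integrand is again a
    product over the coordinates.\<close>
  let ?f = "\<lambda>i u. (if i = j then \<bar>u - x j\<bar> else 1) * normal_density (x i) \<sigma> u"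
  have hb: "has_bochner_integral lborel (?f i) (if i = j then \<sigma> * sqrt (2 / pi) else 1)" for i
    using normal_moment_abs_odd[of \<sigma> "x j" 0]
    by (auto simp: has_bochner_integral_iff mult.commute)
  have eq: "(\<lambda>y. \<bar>y j - x j\<bar> * gauss_kernel J \<sigma> x y) = (\<lambda>y. \<Prod>i\<in>J. ?f i (y i))"
    using j by (auto simp: gauss_kernel_def prod.distrib fun_eq_iff prod.delta if_distrib cong: if_cong)
       (simp add: prod.remove[OF J j])
  show ?thesis
    unfolding eq has_bochner_integral_iff
  proof
    show "integrable (PiM J (\<lambda>_. lborel)) (\<lambda>y. \<Prod>i\<in>J. ?f i (y i))"
      by (rule lb.product_integrable_prod[OF J]) (use hb in \<open>auto simp: has_bochner_integral_iff\<close>)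
    have "(LINT y|PiM J (\<lambda>_. lborel). (\<Prod>i\<in>J. ?f i (y i))) = (\<Prod>i\<in>J. LINT u|lborel. ?f i u)"
      by (rule lb.product_integral_prod[OF J]) (use hb in \<open>auto simp: has_bochner_integral_iff\<close>)
    also have "\<dots> = (\<Prod>i\<in>J. if i = j then \<sigma> * sqrt (2 / pi) else 1)"
      using hb unfolding has_bochner_integral_iff by (intro prod.cong) auto
    also have "\<dots> = \<sigma> * sqrt (2 / pi)" using j by (simp add: prod.delta)
    finally show "(LINT y|PiM J (\<lambda>_. lborel). (\<Prod>i\<in>J. ?f i (y i))) = \<sigma> * sqrt (2 / pi)" .
  qed
qed

text \<open>The integral averages \<open>g\<close> over Gaussian perturbations of x, and each
  coordinate of the perturbation has mean absolute value
  \<open>\<sigma> * sqrt (2 / pi)\<close>.\<close>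

lemma gauss_smoothing:
  assumes g[measurable]: "g \<in> borel_measurable (PiM J (\<lambda>_. borel))"
    and B: "\<And>x. \<bar>g x\<bar> \<le> B" and L: "\<And>x y. \<bar>g x - g y\<bar> \<le> L * (\<Sum>j\<in>J. \<bar>x j - y j\<bar>)"
  shows "\<bar>(LINT y|PiM J (\<lambda>_. lborel). g y * gauss_kernel J \<sigma> x y) - g x\<bar> \<le> L * (card J * (\<sigma> * sqrt (2 / pi)))"
proof -
  let ?M = "PiM J (\<lambda>_. lborel :: real measure)"
  have gM[measurable]: "g \<in> borel_measurable ?M"
    using g by (subst measurable_cong_sets[OF sets_PiM_cong refl]) auto
  have i1: "integrable ?M (\<lambda>y. g y * gauss_kernel J \<sigma> x y)"
  proof (rule Bochner_Integration.integrable_bound[where f = "\<lambda>y. B * gauss_kernel J \<sigma> x y"])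
    show "AE y in ?M. norm (g y * gauss_kernel J \<sigma> x y) \<le> norm (B * gauss_kernel J \<sigma> x y)"
      using B by (intro AE_I2) (auto simp: abs_mult intro!: mult_right_mono order_trans[OF B])
    show "(\<lambda>y. g y * gauss_kernel J \<sigma> x y) \<in> borel_measurable ?M"
      by (intro borel_measurable_times gM borel_measurable_integrable integrable_gauss_kernel)
  qed (intro integrable_mult_right integrable_gauss_kernel)
  have i2: "integrable ?M (\<lambda>y. g x * gauss_kernel J \<sigma> x y)"
    by (intro integrable_mult_right integrable_gauss_kernel)
  have hs: "has_bochner_integral ?M (\<lambda>y. L * (\<Sum>j\<in>J. \<bar>y j - x j\<bar> * gauss_kernel J \<sigma> x y)) (L * (\<Sum>j\<in>J. \<sigma> * sqrt (2 / pi)))"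
    by (intro has_bochner_integral_mult_right has_bochner_integral_sum gauss_kernel_moment)
  have "(LINT y|?M. g y * gauss_kernel J \<sigma> x y) - g x =
      (LINT y|?M. g y * gauss_kernel J \<sigma> x y - g x * gauss_kernel J \<sigma> x y)"
    by (subst Bochner_Integration.integral_diff[OF i1 i2]) (simp add: integral_gauss_kernel)
  also have "\<bar>\<dots>\<bar> \<le> (LINT y|?M. L * (\<Sum>j\<in>J. \<bar>y j - x j\<bar> * gauss_kernel J \<sigma> x y))"
  proof (rule order_trans[OF integral_abs_bound integral_mono])
    show "integrable ?M (\<lambda>y. \<bar>g y * gauss_kernel J \<sigma> x y - g x * gauss_kernel J \<sigma> x y\<bar>)"
      by (intro integrable_abs Bochner_Integration.integrable_diff i1 i2)
    show "integrable ?M (\<lambda>y. L * (\<Sum>j\<in>J. \<bar>y j - x j\<bar> * gauss_kernel J \<sigma> x y))"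
      using hs by (simp add: has_bochner_integral_iff)
    fix y
    have "\<bar>g y * gauss_kernel J \<sigma> x y - g x * gauss_kernel J \<sigma> x y\<bar> = \<bar>g y - g x\<bar> * gauss_kernel J \<sigma> x y"
      by (simp add: left_diff_distrib[symmetric] abs_mult gauss_kernel_nonneg)
    also have "\<dots> \<le> (L * (\<Sum>j\<in>J. \<bar>y j - x j\<bar>)) * gauss_kernel J \<sigma> x y"
      by (intro mult_right_mono L gauss_kernel_nonneg)
    finally show "\<bar>g y * gauss_kernel J \<sigma> x y - g x * gauss_kernel J \<sigma> x y\<bar>
        \<le> L * (\<Sum>j\<in>J. \<bar>y j - x j\<bar> * gauss_kernel J \<sigma> x y)"
      by (simp add: sum_distrib_right mult.assoc)
  qed
  also have "\<dots> = L * (card J * (\<sigma> * sqrt (2 / pi)))" using hs by (simp add: has_bochner_integral_iff)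
  finally show ?thesis .
qed

text \<open>A Gaussian is its own Fourier transform up to scaling: \<open>exp (- t^2 / 2)\<close> at
  \<open>t = (x j - y j) / \<sigma>\<close> is the characteristic function of a standard normal
  variable. Thus x enters only through plane waves.\<close>

lemma gauss_kernel_Fourier:
  "complex_of_real (gauss_kernel J \<sigma> x y) = of_real ((1 / sqrt (2 * pi * \<sigma>\<^sup>2)) ^ card J) *
     (CLINT z|PiM J (\<lambda>_. std_normal_distribution). iexp (\<Sum>j\<in>J. (x j - y j) / \<sigma> * z j))"
proof -
  have "(CLINT z|PiM J (\<lambda>_. std_normal_distribution). iexp (\<Sum>j\<in>J. (x j - y j) / \<sigma> * z j)) =
      (CLINT z|PiM J (\<lambda>_. std_normal_distribution). (\<Prod>j\<in>J. iexp ((x j - y j) / \<sigma> * z j)))"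
    by (simp only: prod_iexp[OF J])
  also have "\<dots> = (\<Prod>j\<in>J. CLINT u|std_normal_distribution. iexp ((x j - y j) / \<sigma> * u))"
    by (rule sn.product_integral_prod[OF J]) (auto intro!: std_normal.integrable_const_bound[where B = 1])
  also have "\<dots> = (\<Prod>j\<in>J. of_real (exp (- (y j - x j)\<^sup>2 / (2 * \<sigma>\<^sup>2))))"
    by (intro prod.cong refl, subst std_normal_iexp) (simp add: power_divide power2_commute)
  finally show ?thesis
    by (simp add: gauss_kernel_def normal_density_def prod.distrib prod_dividef power_divide)
qed

text \<open>Fubini exchanges the auxiliary normal vector z with \<open>X\<close>. The density of
  \<open>X\<close> plus Gaussian noise then depends on the law of \<open>X\<close> only through its
  characteristic function, taken at the points \<open>z / \<sigma>\<close>.\<close>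

lemma gauss_density_Fourier:
  assumes M: "prob_space M" and X[measurable]: "X \<in> M \<rightarrow>\<^sub>M PiM J (\<lambda>_. borel)"
  shows "complex_of_real (LINT \<omega>|M. gauss_kernel J \<sigma> (X \<omega>) y) = of_real ((1 / sqrt (2 * pi * \<sigma>\<^sup>2)) ^ card J) *
    (CLINT z|PiM J (\<lambda>_. std_normal_distribution). iexp (\<Sum>j\<in>J. - y j / \<sigma> * z j) *
       (CLINT \<omega>|M. iexp (\<Sum>j\<in>J. z j / \<sigma> * X \<omega> j)))"
proof -
  interpret M: prob_space M by fact
  interpret S: prob_space "PiM J (\<lambda>_. std_normal_distribution)" by (rule prob_space_PiM) (rule std_normal.prob_space_axioms)
  interpret MS: pair_prob_space M "PiM J (\<lambda>_. std_normal_distribution)" ..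
  have [measurable]: "(\<lambda>w. X w j) \<in> borel_measurable M" if "j \<in> J" for j
    using that X by (auto intro: measurable_compose[OF _ measurable_component_singleton])
  have m[measurable]: "(\<lambda>(w, z). iexp (\<Sum>j\<in>J. (X w j - y j) / \<sigma> * z j)) \<in> borel_measurable (M \<Otimes>\<^sub>M PiM J (\<lambda>_. std_normal_distribution))"
    by measurable
  have int: "integrable (M \<Otimes>\<^sub>M PiM J (\<lambda>_. std_normal_distribution)) (\<lambda>(w, z). iexp (\<Sum>j\<in>J. (X w j - y j) / \<sigma> * z j))"
    by (rule MS.integrable_const_bound[where B = 1]) (use m in auto)
  have "complex_of_real (LINT \<omega>|M. gauss_kernel J \<sigma> (X \<omega>) y) =
      (CLINT \<omega>|M. of_real ((1 / sqrt (2 * pi * \<sigma>\<^sup>2)) ^ card J) *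
       (CLINT z|PiM J (\<lambda>_. std_normal_distribution). iexp (\<Sum>j\<in>J. (X \<omega> j - y j) / \<sigma> * z j)))"
    by (simp only: integral_complex_of_real[symmetric] gauss_kernel_Fourier)
  also have "\<dots> = of_real ((1 / sqrt (2 * pi * \<sigma>\<^sup>2)) ^ card J) * (CLINT \<omega>|M.
       (CLINT z|PiM J (\<lambda>_. std_normal_distribution). iexp (\<Sum>j\<in>J. (X \<omega> j - y j) / \<sigma> * z j)))"
    by (rule integral_mult_right_zero)
  also have "(CLINT \<omega>|M. (CLINT z|PiM J (\<lambda>_. std_normal_distribution). iexp (\<Sum>j\<in>J. (X \<omega> j - y j) / \<sigma> * z j))) =
      (CLINT z|PiM J (\<lambda>_. std_normal_distribution). (CLINT \<omega>|M. iexp (\<Sum>j\<in>J. (X \<omega> j - y j) / \<sigma> * z j)))"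
    by (rule MS.Fubini_integral[OF int, symmetric])
  also have "\<dots> = (CLINT z|PiM J (\<lambda>_. std_normal_distribution). (CLINT \<omega>|M. iexp (\<Sum>j\<in>J. - y j / \<sigma> * z j) * iexp (\<Sum>j\<in>J. z j / \<sigma> * X \<omega> j)))"
  proof -
    have "(\<Sum>j\<in>J. (X \<omega> j - y j) / \<sigma> * z j) = (\<Sum>j\<in>J. - y j / \<sigma> * z j) + (\<Sum>j\<in>J. z j / \<sigma> * X \<omega> j)" for \<omega> and z :: "'j \<Rightarrow> real"
      unfolding sum.distrib[symmetric] using \<sigma> by (intro sum.cong refl) (simp add: field_simps add_divide_distrib[symmetric])
    then show ?thesis by (simp only: exp_add distrib_left of_real_add)
  qed
  finally show ?thesis by (simp only: integral_mult_right_zero)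
qed

text \<open>Characteristic functions have modulus at most 1 and z has a probability law, so
  pointwise convergence passes through the integral over z.\<close>

lemma gauss_density_LIMSEQ:
  fixes M :: "nat \<Rightarrow> 'a measure" and N :: "'b measure"
  assumes M: "\<And>n. prob_space (M n)" and N: "prob_space N"
    and X: "\<And>n. X n \<in> M n \<rightarrow>\<^sub>M PiM J (\<lambda>_. borel)" and Y: "Y \<in> N \<rightarrow>\<^sub>M PiM J (\<lambda>_. borel)"
    and char: "\<And>\<xi>. (\<lambda>n. CLINT \<omega>|M n. iexp (\<Sum>j\<in>J. \<xi> j * X n \<omega> j)) \<longlonglongrightarrow> (CLINT \<omega>|N. iexp (\<Sum>j\<in>J. \<xi> j * Y \<omega> j))"
  shows "(\<lambda>n. LINT \<omega>|M n. gauss_kernel J \<sigma> (X n \<omega>) y) \<longlonglongrightarrow> (LINT \<omega>|N. gauss_kernel J \<sigma> (Y \<omega>) y)"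
proof -
  interpret S: prob_space "PiM J (\<lambda>_. std_normal_distribution)" by (rule prob_space_PiM) (rule std_normal.prob_space_axioms)
  have meas: "(\<lambda>z. CLINT \<omega>|K. iexp (\<Sum>j\<in>J. z j / \<sigma> * Z \<omega> j)) \<in> borel_measurable (PiM J (\<lambda>_. std_normal_distribution))"
    if "prob_space K" "Z \<in> K \<rightarrow>\<^sub>M PiM J (\<lambda>_. borel)" for K :: "'k measure" and Z
  proof -
    interpret K: prob_space K by fact
    have [measurable]: "(\<lambda>w. Z w j) \<in> borel_measurable K" if "j \<in> J" for j
      using that \<open>Z \<in> _\<close> by (auto intro: measurable_compose[OF _ measurable_component_singleton])
    show ?thesis by measurable
  qed
  have "(\<lambda>n. CLINT z|PiM J (\<lambda>_. std_normal_distribution). iexp (\<Sum>j\<in>J. - y j / \<sigma> * z j) *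
       (CLINT \<omega>|M n. iexp (\<Sum>j\<in>J. z j / \<sigma> * X n \<omega> j))) \<longlonglongrightarrow>
     (CLINT z|PiM J (\<lambda>_. std_normal_distribution). iexp (\<Sum>j\<in>J. - y j / \<sigma> * z j) *
       (CLINT \<omega>|N. iexp (\<Sum>j\<in>J. z j / \<sigma> * Y \<omega> j)))"
  proof (rule integral_dominated_convergence[where w = "\<lambda>_. 1"])
    show "(\<lambda>z. iexp (\<Sum>j\<in>J. - y j / \<sigma> * z j) * (CLINT \<omega>|N. iexp (\<Sum>j\<in>J. z j / \<sigma> * Y \<omega> j)))
        \<in> borel_measurable (PiM J (\<lambda>_. std_normal_distribution))"
      by (intro borel_measurable_times meas[OF N Y]) measurable
    show "(\<lambda>z. iexp (\<Sum>j\<in>J. - y j / \<sigma> * z j) * (CLINT \<omega>|M n. iexp (\<Sum>j\<in>J. z j / \<sigma> * X n \<omega> j)))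
        \<in> borel_measurable (PiM J (\<lambda>_. std_normal_distribution))" for n
      by (intro borel_measurable_times meas[OF M X]) measurable
    show "AE z in PiM J (\<lambda>_. std_normal_distribution). (\<lambda>n. iexp (\<Sum>j\<in>J. - y j / \<sigma> * z j) * (CLINT \<omega>|M n. iexp (\<Sum>j\<in>J. z j / \<sigma> * X n \<omega> j)))
        \<longlonglongrightarrow> iexp (\<Sum>j\<in>J. - y j / \<sigma> * z j) * (CLINT \<omega>|N. iexp (\<Sum>j\<in>J. z j / \<sigma> * Y \<omega> j))"
      by (intro AE_I2 tendsto_mult tendsto_const char)
    show "AE z in PiM J (\<lambda>_. std_normal_distribution).
        norm (iexp (\<Sum>j\<in>J. - y j / \<sigma> * z j) * (CLINT \<omega>|M n. iexp (\<Sum>j\<in>J. z j / \<sigma> * X n \<omega> j))) \<le> 1" for n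
    proof (rule AE_I2)
      fix z
      interpret Mn: prob_space "M n" by (rule M)
      have [measurable]: "(\<lambda>w. X n w j) \<in> borel_measurable (M n)" if "j \<in> J" for j
        using that X[of n] by (auto intro: measurable_compose[OF _ measurable_component_singleton])
      have "norm (CLINT \<omega>|M n. iexp (\<Sum>j\<in>J. z j / \<sigma> * X n \<omega> j)) \<le> (LINT \<omega>|M n. norm (iexp (\<Sum>j\<in>J. z j / \<sigma> * X n \<omega> j)))"
        by (rule integral_norm_bound)
      also have "\<dots> = 1" by (simp add: Mn.prob_space)
      finally show "norm (iexp (\<Sum>j\<in>J. - y j / \<sigma> * z j) * (CLINT \<omega>|M n. iexp (\<Sum>j\<in>J. z j / \<sigma> * X n \<omega> j))) \<le> 1"
        by (simp add: norm_mult)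
    qed
  qed simp
  then have "(\<lambda>n. complex_of_real (LINT \<omega>|M n. gauss_kernel J \<sigma> (X n \<omega>) y)) \<longlonglongrightarrow>
      complex_of_real (LINT \<omega>|N. gauss_kernel J \<sigma> (Y \<omega>) y)"
    unfolding gauss_density_Fourier[OF M X] gauss_density_Fourier[OF N Y] by (intro tendsto_mult tendsto_const)
  then show ?thesis by (simp only: tendsto_of_real_iff)
qed

text \<open>Fubini: testing the smoothed density against \<open>g\<close> amounts to smoothing
  \<open>g\<close> and evaluating it at \<open>X\<close>.\<close>

lemma gauss_density_integral:
  assumes M: "prob_space M" and X[measurable]: "X \<in> M \<rightarrow>\<^sub>M PiM J (\<lambda>_. borel)"
    and g: "g \<in> borel_measurable (PiM J (\<lambda>_. borel))" and B: "\<And>x. \<bar>g x\<bar> \<le> B"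
  shows "integrable (PiM J (\<lambda>_. lborel)) (\<lambda>y. g y * (LINT \<omega>|M. gauss_kernel J \<sigma> (X \<omega>) y))"
    and "(LINT y|PiM J (\<lambda>_. lborel). g y * (LINT \<omega>|M. gauss_kernel J \<sigma> (X \<omega>) y)) =
      (LINT \<omega>|M. LINT y|PiM J (\<lambda>_. lborel). g y * gauss_kernel J \<sigma> (X \<omega>) y)"
    and "integrable M (\<lambda>\<omega>. LINT y|PiM J (\<lambda>_. lborel). g y * gauss_kernel J \<sigma> (X \<omega>) y)"
proof -
  let ?P = "PiM J (\<lambda>_. lborel :: real measure)"
  interpret M: prob_space M by fact
  interpret P: finite_product_sigma_finite "\<lambda>_. lborel :: real measure" J by standard simp
  interpret MP: pair_sigma_finite M ?P ..
  have gM[measurable]: "g \<in> borel_measurable ?P"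
    using g by (subst measurable_cong_sets[OF sets_PiM_cong refl]) auto
  have id[measurable]: "(\<lambda>x. x) \<in> ?P \<rightarrow>\<^sub>M PiM J (\<lambda>_. borel)"
    by (rule measurable_ident_sets) (rule sets_PiM_cong, simp_all)
  have id2[measurable]: "snd \<in> M \<Otimes>\<^sub>M ?P \<rightarrow>\<^sub>M PiM J (\<lambda>_. borel)"
    using measurable_compose[OF measurable_snd id] by simp
  have m[measurable]: "(\<lambda>(\<omega>, y). g y * gauss_kernel J \<sigma> (X \<omega>) y) \<in> borel_measurable (M \<Otimes>\<^sub>M ?P)"
    unfolding split_beta' by measurable
  have int_y: "integrable ?P (\<lambda>y. g y * gauss_kernel J \<sigma> x y)" for x
  proof (rule Bochner_Integration.integrable_bound[where f = "\<lambda>y. B * gauss_kernel J \<sigma> x y"])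
    show "AE y in ?P. norm (g y * gauss_kernel J \<sigma> x y) \<le> norm (B * gauss_kernel J \<sigma> x y)"
      using B by (intro AE_I2) (auto simp: abs_mult intro!: mult_right_mono order_trans[OF B])
    show "(\<lambda>y. g y * gauss_kernel J \<sigma> x y) \<in> borel_measurable ?P"
      by (intro borel_measurable_times gM borel_measurable_integrable integrable_gauss_kernel)
  qed (intro integrable_mult_right integrable_gauss_kernel)
  have int: "integrable (M \<Otimes>\<^sub>M ?P) (\<lambda>(\<omega>, y). g y * gauss_kernel J \<sigma> (X \<omega>) y)"
  proof (rule MP.Fubini_integrable[OF m])
    show "AE x in M. integrable ?P (\<lambda>y. case (x, y) of (\<omega>, y) \<Rightarrow> g y * gauss_kernel J \<sigma> (X \<omega>) y)"
      using int_y by simp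
    have m2: "(\<lambda>x. LINT y|?P. norm (g y * gauss_kernel J \<sigma> (X x) y)) \<in> borel_measurable M"
      using m by measurable
    have "integrable M (\<lambda>x. LINT y|?P. norm (g y * gauss_kernel J \<sigma> (X x) y))"
    proof (rule M.integrable_const_bound[OF _ m2])
      have "(LINT y|?P. norm (g y * gauss_kernel J \<sigma> x y)) \<le> B" for x
      proof -
        have "(LINT y|?P. norm (g y * gauss_kernel J \<sigma> x y)) \<le> (LINT y|?P. B * gauss_kernel J \<sigma> x y)"
          by (rule integral_mono[OF integrable_norm[OF int_y] integrable_mult_right[OF integrable_gauss_kernel]])
             (auto simp: abs_mult gauss_kernel_nonneg intro!: mult_right_mono B)
        then show ?thesis by (simp add: integral_gauss_kernel)
      qed
      then show "AE x in M. norm (LINT y|?P. norm (g y * gauss_kernel J \<sigma> (X x) y)) \<le> B" by simp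
    qed
    then show "integrable M (\<lambda>x. LINT y|?P. norm (case (x, y) of (\<omega>, y) \<Rightarrow> g y * gauss_kernel J \<sigma> (X \<omega>) y))"
      by simp
  qed
  show "integrable ?P (\<lambda>y. g y * (LINT \<omega>|M. gauss_kernel J \<sigma> (X \<omega>) y))"
    using MP.integrable_snd[OF int] by simp
  show "(LINT y|?P. g y * (LINT \<omega>|M. gauss_kernel J \<sigma> (X \<omega>) y)) =
      (LINT \<omega>|M. LINT y|?P. g y * gauss_kernel J \<sigma> (X \<omega>) y)"
    using MP.Fubini_integral[OF int] by simp
  show "integrable M (\<lambda>\<omega>. LINT y|?P. g y * gauss_kernel J \<sigma> (X \<omega>) y)"
    using MP.integrable_fst[OF int] by simp
qed

end

text \<open>Convolving with a small Gaussian turns convergence of characteristic functions into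
  pointwise convergence of densities, which by Scheffe's lemma is convergence in total variation.\<close>

lemma char_LIMSEQ_imp_expectation_LIMSEQ:
  fixes M :: "nat \<Rightarrow> 'a measure" and N :: "'b measure" and J :: "'j set"
  assumes J[simp]: "finite J" and M: "\<And>n. prob_space (M n)" and N: "prob_space N"
    and X: "\<And>n. X n \<in> M n \<rightarrow>\<^sub>M PiM J (\<lambda>_. borel)" and Y: "Y \<in> N \<rightarrow>\<^sub>M PiM J (\<lambda>_. borel)"
    and char: "\<And>\<xi>. (\<lambda>n. CLINT \<omega>|M n. iexp (\<Sum>j\<in>J. \<xi> j * X n \<omega> j)) \<longlonglongrightarrow> (CLINT \<omega>|N. iexp (\<Sum>j\<in>J. \<xi> j * Y \<omega> j))"
    and g: "g \<in> borel_measurable (PiM J (\<lambda>_. borel))"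
    and B: "\<And>x. \<bar>g x\<bar> \<le> B" and L: "\<And>x y. \<bar>g x - g y\<bar> \<le> L * (\<Sum>j\<in>J. \<bar>x j - y j\<bar>)"
  shows "(\<lambda>n. LINT \<omega>|M n. g (X n \<omega>)) \<longlonglongrightarrow> (LINT \<omega>|N. g (Y \<omega>))"
proof (rule LIMSEQ_I)
  fix r :: real assume r: "r > 0"
  let ?P = "PiM J (\<lambda>_. lborel :: real measure)"
  define c where "c = \<bar>L\<bar> * (card J * sqrt (2 / pi)) + 1"
  have c: "c > 0" unfolding c_def by (intro add_nonneg_pos mult_nonneg_nonneg) auto
  \<comment> \<open>With this choice smoothing costs at most \<open>r / 3\<close>. It is paid once
    for \<open>M n\<close> and once for \<open>N\<close>; the last third is for the total variation
    distance.\<close>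
  define \<sigma> where "\<sigma> = r / (3 * c)"
  have \<sigma>[simp]: "0 < \<sigma>" using r c by (simp add: \<sigma>_def)
  have err: "L * (card J * (\<sigma> * sqrt (2 / pi))) \<le> r / 3"
  proof -
    have "L * (card J * (\<sigma> * sqrt (2 / pi))) \<le> \<bar>L\<bar> * (card J * (\<sigma> * sqrt (2 / pi)))"
      by (intro mult_right_mono) (auto intro!: mult_nonneg_nonneg less_imp_le[OF \<sigma>])
    also have "\<dots> = (\<bar>L\<bar> * (card J * sqrt (2 / pi))) * \<sigma>" by (simp add: ac_simps)
    also have "\<dots> \<le> c * \<sigma>" unfolding c_def using less_imp_le[OF \<sigma>] by (intro mult_right_mono) auto
    also have "\<dots> = r / 3" using c by (simp add: \<sigma>_def)
    finally show ?thesis .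
  qed
  have sm: "\<bar>(LINT y|?P. g y * gauss_kernel J \<sigma> x y) - g x\<bar> \<le> r / 3" for x
    using gauss_smoothing[OF J \<sigma> g B L, of x] err by linarith
  have close: "\<bar>(LINT y|?P. g y * (LINT \<omega>|K. gauss_kernel J \<sigma> (Z \<omega>) y)) - (LINT \<omega>|K. g (Z \<omega>))\<bar> \<le> r / 3"
    if K: "prob_space K" and Z: "Z \<in> K \<rightarrow>\<^sub>M PiM J (\<lambda>_. borel)" for K :: "'k measure" and Z
  proof -
    interpret K: prob_space K by fact
    have ig: "integrable K (\<lambda>\<omega>. g (Z \<omega>))"
      by (rule K.integrable_const_bound[where B = B]) (use B measurable_compose[OF Z g] in auto)
    have "\<bar>(LINT y|?P. g y * (LINT \<omega>|K. gauss_kernel J \<sigma> (Z \<omega>) y)) - (LINT \<omega>|K. g (Z \<omega>))\<bar>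
       = \<bar>LINT \<omega>|K. (LINT y|?P. g y * gauss_kernel J \<sigma> (Z \<omega>) y) - g (Z \<omega>)\<bar>"
      using gauss_density_integral[OF J \<sigma> K Z g B] ig by simp
    also have "\<dots> \<le> (LINT \<omega>|K. \<bar>(LINT y|?P. g y * gauss_kernel J \<sigma> (Z \<omega>) y) - g (Z \<omega>)\<bar>)"
      by (rule integral_abs_bound)
    also have "\<dots> \<le> (LINT \<omega>|K. r / 3)"
      by (rule integral_mono) (use gauss_density_integral(3)[OF J \<sigma> K Z g B] ig sm in auto)
    finally show ?thesis by (simp add: K.prob_space)
  qed
  have one: "(\<lambda>_. 1) \<in> borel_measurable (PiM J (\<lambda>_. borel :: real measure))" by simp
  define p where "p n y = (LINT \<omega>|M n. gauss_kernel J \<sigma> (X n \<omega>) y)" for n y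
  define p' where "p' y = (LINT \<omega>|N. gauss_kernel J \<sigma> (Y \<omega>) y)" for y
  have p: "integrable ?P (p n)" "(LINT y|?P. p n y) = 1" for n
  proof -
    interpret Mn: prob_space "M n" by (rule M)
    show "integrable ?P (p n)" "(LINT y|?P. p n y) = 1"
      using gauss_density_integral(1,2)[OF J \<sigma> M[of n] X one, of 1]
      by (auto simp: p_def[abs_def] integral_gauss_kernel Mn.prob_space)
  qed
  have p': "integrable ?P p'" "(LINT y|?P. p' y) = 1"
  proof -
    interpret N: prob_space N by (rule N)
    show "integrable ?P p'" "(LINT y|?P. p' y) = 1"
      using gauss_density_integral(1,2)[OF J \<sigma> N Y one, of 1]
      by (auto simp: p'_def[abs_def] integral_gauss_kernel N.prob_space)
  qed
  have nn: "0 \<le> p n y" "0 \<le> p' y" for n y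
    by (auto simp: p_def p'_def gauss_kernel_nonneg)
  have "(\<lambda>n. \<integral>\<^sup>+ y. norm (p n y - p' y) \<partial>?P) \<longlonglongrightarrow> 0"
  proof (rule Scheffe_lemma2)
    show "AE y in ?P. (\<lambda>n. p n y) \<longlonglongrightarrow> p' y"
      unfolding p_def p'_def by (intro AE_I2 gauss_density_LIMSEQ[OF J \<sigma> M N X Y char])
    show "(\<integral>\<^sup>+ y. norm (p n y) \<partial>?P) \<le> (\<integral>\<^sup>+ y. norm (p' y) \<partial>?P)" for n
      using p[of n] p' nn by (simp add: nn_integral_eq_integral)
  qed (use p p' in auto)
  then have "(\<lambda>n. ennreal (LINT y|?P. \<bar>p n y - p' y\<bar>)) \<longlonglongrightarrow> ennreal 0"
    using p p' by (simp add: nn_integral_eq_integral)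
  then have tv: "(\<lambda>n. LINT y|?P. \<bar>p n y - p' y\<bar>) \<longlonglongrightarrow> 0"
    by (subst (asm) tendsto_ennreal_iff) auto
  have "(\<lambda>n. B * (LINT y|?P. \<bar>p n y - p' y\<bar>)) \<longlonglongrightarrow> 0"
    using tendsto_mult_right_zero[OF tv] .
  then have "eventually (\<lambda>n. B * (LINT y|?P. \<bar>p n y - p' y\<bar>) < r / 3) sequentially"
    by (rule order_tendstoD) (use r in simp)
  then have "eventually (\<lambda>n. norm ((LINT \<omega>|M n. g (X n \<omega>)) - (LINT \<omega>|N. g (Y \<omega>))) < r) sequentially"
  proof eventually_elim
    case (elim n)
    have gp: "integrable ?P (\<lambda>y. g y * p n y)" "integrable ?P (\<lambda>y. g y * p' y)"
      unfolding p_def p'_def by (rule gauss_density_integral(1)[OF J \<sigma> M X g B] gauss_density_integral(1)[OF J \<sigma> N Y g B])+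
    have "\<bar>(LINT y|?P. g y * p n y) - (LINT y|?P. g y * p' y)\<bar> = \<bar>LINT y|?P. g y * p n y - g y * p' y\<bar>"
      using gp by simp
    also have "\<dots> \<le> (LINT y|?P. \<bar>g y * p n y - g y * p' y\<bar>)" by (rule integral_abs_bound)
    also have "\<dots> \<le> (LINT y|?P. B * \<bar>p n y - p' y\<bar>)"
    proof (rule integral_mono)
      show "integrable ?P (\<lambda>y. \<bar>g y * p n y - g y * p' y\<bar>)"
        by (intro integrable_abs Bochner_Integration.integrable_diff gp)
      show "integrable ?P (\<lambda>y. B * \<bar>p n y - p' y\<bar>)" using p[of n] p' by auto
      show "\<bar>g y * p n y - g y * p' y\<bar> \<le> B * \<bar>p n y - p' y\<bar>" for y
        by (simp add: right_diff_distrib[symmetric] abs_mult mult_right_mono B)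
    qed
    also have "\<dots> < r / 3" using elim by simp
    finally show ?case
      using close[OF M X, of n] close[OF N Y] unfolding p_def p'_def real_norm_def by linarith
  qed
  then show "\<exists>no. \<forall>n\<ge>no. norm ((LINT \<omega>|M n. g (X n \<omega>)) - (LINT \<omega>|N. g (Y \<omega>))) < r"
    by (simp add: eventually_sequentially)
qed

section \<open>The transition kernels of the Wiener process\<close>

text \<open>Adding \<open>c\<close> makes the integrand nonnegative, which reduces the claim to the
  rule for nonnegative integrals under \<open>bind\<close>. The bound \<open>c\<close> on all the
  integrals permits the return to real numbers.\<close>

lemma integral_bind_bounded:
  fixes f :: "'b \<Rightarrow> real"
  assumes M: "prob_space M" and N: "N \<in> M \<rightarrow>\<^sub>M prob_algebra B"
    and f[measurable]: "f \<in> borel_measurable B" and c: "\<And>x. \<bar>f x\<bar> \<le> c"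
  shows "(LINT y|(M \<bind> N). f y) = (LINT x|M. LINT y|N x. f y)"
    and "(\<lambda>x. LINT y|N x. f y) \<in> borel_measurable M"
proof -
  interpret M: prob_space M by fact
  note N' = measurable_prob_algebraD[OF N]
  have Nx: "prob_space (N x)" "sets (N x) = sets B" if "x \<in> space M" for x
    using measurable_space[OF N that] by (auto simp: space_prob_algebra)
  have b: "prob_space (M \<bind> N)"
    by (rule M.prob_space_bind[OF _ N']) (use Nx in auto)
  interpret b: prob_space "M \<bind> N" by fact
  have sb: "sets (M \<bind> N) = sets B" by (rule sets_bind[OF _ M.not_empty]) (rule Nx(2))
  have fb: "f \<in> borel_measurable (M \<bind> N)" using f by (simp add: measurable_cong_sets[OF sb refl])
  have fN: "f \<in> borel_measurable (N x)" if "x \<in> space M" for x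
    using f by (simp add: measurable_cong_sets[OF Nx(2)[OF that] refl])
  have fc: "0 \<le> f y + c" for y using c[of y] by linarith
  have nn: "(\<integral>\<^sup>+ y. ennreal (f y + c) \<partial>N x) = ennreal ((LINT y|N x. f y) + c)" if "x \<in> space M" for x
  proof -
    interpret Nx: prob_space "N x" by (rule Nx(1)[OF that])
    have i: "integrable (N x) f" by (rule Nx.integrable_const_bound[OF _ fN[OF that]]) (use c in auto)
    have "(\<integral>\<^sup>+ y. ennreal (f y + c) \<partial>N x) = ennreal (LINT y|N x. f y + c)"
      by (rule nn_integral_eq_integral) (use i in \<open>auto simp: fc\<close>)
    then show ?thesis using i by (simp add: Nx.prob_space)
  qed
  have bd: "\<bar>LINT y|N x. f y\<bar> \<le> c" if "x \<in> space M" for x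
  proof -
    interpret Nx: prob_space "N x" by (rule Nx(1)[OF that])
    have i: "integrable (N x) f" by (rule Nx.integrable_const_bound[OF _ fN[OF that]]) (use c in auto)
    have "\<bar>LINT y|N x. f y\<bar> \<le> (LINT y|N x. \<bar>f y\<bar>)" by (rule integral_abs_bound)
    also have "\<dots> \<le> (LINT y|N x. c)" by (rule integral_mono) (use i c in auto)
    finally show ?thesis by (simp add: Nx.prob_space)
  qed
  have m1: "(\<lambda>x. \<integral>\<^sup>+ y. ennreal (f y + c) \<partial>N x) \<in> borel_measurable M"
    by (rule measurable_compose[OF N' nn_integral_measurable_subprob_algebra]) simp
  have "(\<lambda>x. enn2real (\<integral>\<^sup>+ y. ennreal (f y + c) \<partial>N x) - c) \<in> borel_measurable M"
    using m1 by measurable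
  moreover have eq: "enn2real (\<integral>\<^sup>+ y. ennreal (f y + c) \<partial>N x) - c = (LINT y|N x. f y)" if "x \<in> space M" for x
    using bd[OF that] by (simp add: nn[OF that])
  ultimately show m: "(\<lambda>x. LINT y|N x. f y) \<in> borel_measurable M"
    by (simp cong: measurable_cong)
  have ib: "integrable (M \<bind> N) f" by (rule b.integrable_const_bound[OF _ fb]) (use c in auto)
  have im: "integrable M (\<lambda>x. LINT y|N x. f y)" by (rule M.integrable_const_bound[OF _ m]) (use bd in auto)
  have "ennreal ((LINT y|(M \<bind> N). f y) + c) = (\<integral>\<^sup>+ y. ennreal (f y + c) \<partial>(M \<bind> N))"
    by (subst nn_integral_eq_integral)
       (use ib in \<open>auto simp: b.prob_space fc\<close>)
  also have "\<dots> = (\<integral>\<^sup>+ x. \<integral>\<^sup>+ y. ennreal (f y + c) \<partial>N x \<partial>M)"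
    by (rule nn_integral_bind[OF _ N']) simp
  also have "\<dots> = (\<integral>\<^sup>+ x. ennreal ((LINT y|N x. f y) + c) \<partial>M)"
    by (intro nn_integral_cong nn)
  also have "\<dots> = ennreal ((LINT x|M. LINT y|N x. f y) + c)"
    by (subst nn_integral_eq_integral)
       (use im bd in \<open>force simp: M.prob_space abs_le_iff\<close>)+
  finally have *: "ennreal ((LINT y|(M \<bind> N). f y) + c) = ennreal ((LINT x|M. LINT y|N x. f y) + c)" .
  have "\<bar>LINT y|(M \<bind> N). f y\<bar> \<le> c"
  proof -
    have "\<bar>LINT y|(M \<bind> N). f y\<bar> \<le> (LINT y|(M \<bind> N). \<bar>f y\<bar>)" by (rule integral_abs_bound)
    also have "\<dots> \<le> (LINT y|(M \<bind> N). c)" by (rule integral_mono) (use ib c in auto)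
    finally show ?thesis by (simp add: b.prob_space)
  qed
  moreover have "\<bar>LINT x|M. LINT y|N x. f y\<bar> \<le> c"
  proof -
    have "\<bar>LINT x|M. LINT y|N x. f y\<bar> \<le> (LINT x|M. \<bar>LINT y|N x. f y\<bar>)" by (rule integral_abs_bound)
    also have "\<dots> \<le> (LINT x|M. c)" by (rule integral_mono) (use im bd in auto)
    finally show ?thesis by (simp add: M.prob_space)
  qed
  ultimately show "(LINT y|(M \<bind> N). f y) = (LINT x|M. LINT y|N x. f y)"
    using * by simp
qed

section \<open>Plane waves with a Gaussian envelope\<close>

context
  fixes \<xi> :: "real ^ 'n::finite" and b \<delta> :: real
begin

text \<open>Plane waves do not vanish at infinity and so are not in \<open>C02\<close>; with the envelope they are, and
  for small \<open>\<delta>\<close> they are nearly eigenfunctions of the Laplacian.\<close>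

definition gauss_wave :: "real \<Rightarrow> real \<Rightarrow> real ^ 'n \<Rightarrow> real" where
  "gauss_wave p q y = (p * cos (\<xi> \<bullet> y + b) + q * sin (\<xi> \<bullet> y + b)) * exp (- \<delta> * (y \<bullet> y))"

text \<open>The coefficients p and q may depend on y, which makes the family closed under partial
  derivatives; a single product rule then yields derivatives of both orders.\<close>

lemma gauss_wave_has_derivative:
  assumes "((\<lambda>h. p (y + h *\<^sub>R axis i 1)) has_real_derivative p') (at 0)"
    and "((\<lambda>h. q (y + h *\<^sub>R axis i 1)) has_real_derivative q') (at 0)"
  shows "((\<lambda>h. gauss_wave (p (y + h *\<^sub>R axis i 1)) (q (y + h *\<^sub>R axis i 1)) (y + h *\<^sub>R axis i 1)) has_real_derivative
    gauss_wave (p' + \<xi> $ i * q y - 2 * \<delta> * y $ i * p y) (q' - \<xi> $ i * p y - 2 * \<delta> * y $ i * q y) y) (at 0)"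
proof -
  have e: "\<xi> \<bullet> (y + h *\<^sub>R axis i 1) + b = (\<xi> \<bullet> y + b) + h * \<xi> $ i"
    "(y + h *\<^sub>R axis i 1) \<bullet> (y + h *\<^sub>R axis i 1) = y \<bullet> y + 2 * h * y $ i + h\<^sup>2" for h
    by (simp_all add: inner_add_left inner_add_right inner_axis inner_axis' power2_eq_square algebra_simps)
  define P Q where "P h = p (y + h *\<^sub>R axis i 1)" and "Q h = q (y + h *\<^sub>R axis i 1)" for h
  have PQ: "(P has_real_derivative p') (at 0)" "(Q has_real_derivative q') (at 0)"
    using assms by (simp_all add: P_def[abs_def] Q_def[abs_def])
  have PQ0: "p y = P 0" "q y = Q 0" by (simp_all add: P_def Q_def)
  have c: "((\<lambda>h. cos (\<xi> \<bullet> y + b + h * \<xi> $ i)) has_real_derivative - sin (\<xi> \<bullet> y + b) * \<xi> $ i) (at 0)"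
    and s: "((\<lambda>h. sin (\<xi> \<bullet> y + b + h * \<xi> $ i)) has_real_derivative cos (\<xi> \<bullet> y + b) * \<xi> $ i) (at 0)"
    and x: "((\<lambda>h. exp (- \<delta> * (y \<bullet> y + 2 * h * y $ i + h\<^sup>2))) has_real_derivative
        exp (- \<delta> * (y \<bullet> y)) * (- 2 * \<delta> * y $ i)) (at 0)"
    by (auto intro!: derivative_eq_intros)
  show ?thesis
    unfolding gauss_wave_def e PQ0 P_def[symmetric] Q_def[symmetric]
    by (rule DERIV_cong[OF DERIV_mult[OF DERIV_add[OF DERIV_mult[OF PQ(1) c] DERIV_mult[OF PQ(2) s]] x]])
       (simp add: algebra_simps)
qed

lemma gauss_wave_continuous:
  "continuous_on UNIV p \<Longrightarrow> continuous_on UNIV q \<Longrightarrow> continuous_on UNIV (\<lambda>y. gauss_wave (p y) (q y) y)"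
  unfolding gauss_wave_def by (intro continuous_intros)

lemma gauss_wave_bound:
  assumes "\<bar>p\<bar> + \<bar>q\<bar> \<le> c" shows "\<bar>gauss_wave p q y\<bar> \<le> c * exp (- \<delta> * (y \<bullet> y))"
proof -
  have "\<bar>p * cos (\<xi> \<bullet> y + b) + q * sin (\<xi> \<bullet> y + b)\<bar> \<le> \<bar>p\<bar> * 1 + \<bar>q\<bar> * 1"
    by (rule order_trans[OF abs_triangle_ineq]) (intro add_mono, auto simp: abs_mult mult_left_le)
  then show ?thesis using assms unfolding gauss_wave_def by (simp add: abs_mult)
qed

text \<open>Coefficients of at most quadratic growth are beaten by the envelope; two
  differentiations of a wave with constant coefficients produce no faster growth.\<close>

lemma gauss_wave_C0:
  assumes \<delta>: "\<delta> > 0" and c: "continuous_on UNIV p" "continuous_on UNIV q"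
    and C: "\<And>y. \<bar>p y\<bar> + \<bar>q y\<bar> \<le> C * (1 + y \<bullet> y)"
  shows "(\<lambda>y. gauss_wave (p y) (q y) y) \<in> C0"
proof -
  have "((\<lambda>y::real^'n. C * (1 + y \<bullet> y) * exp (- \<delta> * (y \<bullet> y))) \<longlongrightarrow> 0) at_infinity"
  proof -
    have "filterlim (\<lambda>y::real^'n. \<delta> * (norm y)\<^sup>2) at_top at_infinity"
      by (intro filterlim_tendsto_pos_mult_at_top[OF tendsto_const \<delta>] filterlim_compose[OF filterlim_pow_at_top filterlim_norm_at_top] filterlim_ident) simp_all
    then have s: "filterlim (\<lambda>y::real^'n. \<delta> * (y \<bullet> y)) at_top at_infinity" by (simp add: power2_norm_eq_inner)
    have "((\<lambda>y::real^'n. C * ((\<delta> * (y \<bullet> y)) ^ 0 / exp (\<delta> * (y \<bullet> y)) + (1 / \<delta>) * ((\<delta> * (y \<bullet> y)) ^ 1 / exp (\<delta> * (y \<bullet> y))))) \<longlongrightarrow> C * (0 + (1 / \<delta>) * 0)) at_infinity"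
      by (intro tendsto_intros filterlim_compose[OF tendsto_power_div_exp_0 s])
    moreover have "C * ((\<delta> * (y \<bullet> y)) ^ 0 / exp (\<delta> * (y \<bullet> y)) + (1 / \<delta>) * ((\<delta> * (y \<bullet> y)) ^ 1 / exp (\<delta> * (y \<bullet> y))))
        = C * (1 + y \<bullet> y) * exp (- \<delta> * (y \<bullet> y))" for y :: "real^'n"
      using \<delta> by (simp add: exp_minus field_simps)
    ultimately show ?thesis by (simp only: mult_zero_right add_0_right)
  qed
  then have "((\<lambda>y. gauss_wave (p y) (q y) y) \<longlongrightarrow> 0) at_infinity"
    by (rule Lim_null_comparison[rotated]) (use gauss_wave_bound[OF C] in \<open>auto intro!: always_eventually\<close>)
  then show ?thesis using gauss_wave_continuous[OF c] by (simp add: C0_def)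
qed

lemma partial_gauss_wave:
  assumes "\<And>y. ((\<lambda>h. p (y + h *\<^sub>R axis i 1)) has_real_derivative p' y) (at 0)"
    and "\<And>y. ((\<lambda>h. q (y + h *\<^sub>R axis i 1)) has_real_derivative q' y) (at 0)"
  shows "partial i (\<lambda>y. gauss_wave (p y) (q y) y) =
    (\<lambda>y. gauss_wave (p' y + \<xi> $ i * q y - 2 * \<delta> * y $ i * p y) (q' y - \<xi> $ i * p y - 2 * \<delta> * y $ i * q y) y)"
  unfolding partial_def by (intro ext DERIV_imp_deriv gauss_wave_has_derivative assms)

lemma has_real_derivative_coord:
  "((\<lambda>h. c * (y + h *\<^sub>R axis j 1) $ i) has_real_derivative c * (if i = j then 1 else 0)) (at (0::real))"
  by (auto simp: axis_def intro!: derivative_eq_intros)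

lemma partial1_gauss_wave:
  "partial i (\<lambda>y. gauss_wave 1 0 y) = (\<lambda>y. gauss_wave (- (2 * \<delta>) * y $ i) (- \<xi> $ i) y)"
  by (subst partial_gauss_wave[where p' = "\<lambda>_. 0" and q' = "\<lambda>_. 0"]) simp_all

lemma partial2_gauss_wave:
  "partial j (partial i (\<lambda>y. gauss_wave 1 0 y)) = (\<lambda>y. gauss_wave
     (- (2 * \<delta>) * (if i = j then 1 else 0) - \<xi> $ j * \<xi> $ i + 4 * \<delta>\<^sup>2 * y $ j * y $ i)
     (2 * \<delta> * (\<xi> $ j * y $ i + y $ j * \<xi> $ i)) y)"
  unfolding partial1_gauss_wave
  by (subst partial_gauss_wave[where p = "\<lambda>y. - (2 * \<delta>) * y $ i" and q = "\<lambda>_. - \<xi> $ i"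
        and p' = "\<lambda>_. - (2 * \<delta>) * (if i = j then 1 else 0)" and q' = "\<lambda>_. 0", OF has_real_derivative_coord])
     (auto simp: algebra_simps power2_eq_square)

lemma coord_bounds: "\<bar>y $ i\<bar> \<le> 1 + y \<bullet> y" "\<bar>y $ i * y $ j\<bar> \<le> 1 + y \<bullet> y" for y :: "real ^ 'n"
proof -
  have n: "\<bar>y $ i\<bar> \<le> norm y" for i by (rule component_le_norm_cart)
  have "norm y \<le> 1 + (norm y)\<^sup>2"
    using zero_le_power2[of "norm y - 1"] zero_le_power2[of "norm y"] unfolding power2_diff power_one mult_1_right by linarith
  then show "\<bar>y $ i\<bar> \<le> 1 + y \<bullet> y" using n[of i] by (simp add: power2_norm_eq_inner)
  have "\<bar>y $ i * y $ j\<bar> \<le> norm y * norm y" unfolding abs_mult by (intro mult_mono n) auto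
  then show "\<bar>y $ i * y $ j\<bar> \<le> 1 + y \<bullet> y" by (simp add: power2_norm_eq_inner[symmetric] power2_eq_square)
qed

lemma gauss_wave_C02:
  assumes \<delta>: "\<delta> > 0"
  shows "(\<lambda>y. gauss_wave 1 0 y) \<in> C02"
proof -
  have a: "(\<lambda>y. gauss_wave 1 0 y) \<in> C0"
    by (rule gauss_wave_C0[OF \<delta>, where C = 1]) auto
  have b: "partial i (\<lambda>y. gauss_wave 1 0 y) \<in> C0" for i
    unfolding partial1_gauss_wave
  proof (rule gauss_wave_C0[OF \<delta>, where C = "2 * \<delta> + \<bar>\<xi> $ i\<bar>"])
    fix y :: "real ^ 'n"
    have "\<bar>- (2 * \<delta>) * y $ i\<bar> \<le> 2 * \<delta> * (1 + y \<bullet> y)"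
      using coord_bounds(1)[of y i] \<delta> by (simp add: abs_mult)
    moreover have "\<bar>\<xi> $ i\<bar> * 1 \<le> \<bar>\<xi> $ i\<bar> * (1 + y \<bullet> y)" by (intro mult_left_mono) auto
    ultimately show "\<bar>- (2 * \<delta>) * y $ i\<bar> + \<bar>- \<xi> $ i\<bar> \<le> (2 * \<delta> + \<bar>\<xi> $ i\<bar>) * (1 + y \<bullet> y)"
      by (simp add: distrib_right)
  qed (intro continuous_intros)+
  have c: "partial j (partial i (\<lambda>y. gauss_wave 1 0 y)) \<in> C0" for i j
    unfolding partial2_gauss_wave
  proof (rule gauss_wave_C0[OF \<delta>, where C = "2 * \<delta> + \<bar>\<xi> $ j * \<xi> $ i\<bar> + 4 * \<delta>\<^sup>2 + 2 * \<delta> * \<bar>\<xi> $ j\<bar> + 2 * \<delta> * \<bar>\<xi> $ i\<bar>"])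
    fix y :: "real ^ 'n"
    have 1: "1 \<le> 1 + y \<bullet> y" by simp
    have "\<bar>- (2 * \<delta>) * (if i = j then 1 else 0) - \<xi> $ j * \<xi> $ i + 4 * \<delta>\<^sup>2 * y $ j * y $ i\<bar> \<le>
        2 * \<delta> * 1 + \<bar>\<xi> $ j * \<xi> $ i\<bar> * 1 + 4 * \<delta>\<^sup>2 * \<bar>y $ j * y $ i\<bar>"
      using \<delta> by (intro order_trans[OF abs_triangle_ineq] order_trans[OF abs_triangle_ineq4] add_mono) (auto simp: abs_mult mult.assoc)
    also have "\<dots> \<le> 2 * \<delta> * (1 + y \<bullet> y) + \<bar>\<xi> $ j * \<xi> $ i\<bar> * (1 + y \<bullet> y) + 4 * \<delta>\<^sup>2 * (1 + y \<bullet> y)"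
      using \<delta> by (intro add_mono mult_left_mono 1 coord_bounds) auto
    finally have x: "\<bar>- (2 * \<delta>) * (if i = j then 1 else 0) - \<xi> $ j * \<xi> $ i + 4 * \<delta>\<^sup>2 * y $ j * y $ i\<bar> \<le> \<dots>" .
    have "\<bar>2 * \<delta> * (\<xi> $ j * y $ i + y $ j * \<xi> $ i)\<bar> \<le> 2 * \<delta> * (\<bar>\<xi> $ j\<bar> * \<bar>y $ i\<bar> + \<bar>\<xi> $ i\<bar> * \<bar>y $ j\<bar>)"
      using \<delta> abs_triangle_ineq[of "\<xi> $ j * y $ i" "y $ j * \<xi> $ i"] by (simp add: abs_mult mult.commute)
    also have "\<dots> \<le> 2 * \<delta> * (\<bar>\<xi> $ j\<bar> * (1 + y \<bullet> y) + \<bar>\<xi> $ i\<bar> * (1 + y \<bullet> y))"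
      using \<delta> by (intro add_mono mult_left_mono coord_bounds) auto
    finally show "\<bar>- (2 * \<delta>) * (if i = j then 1 else 0) - \<xi> $ j * \<xi> $ i + 4 * \<delta>\<^sup>2 * y $ j * y $ i\<bar> +
        \<bar>2 * \<delta> * (\<xi> $ j * y $ i + y $ j * \<xi> $ i)\<bar>
      \<le> (2 * \<delta> + \<bar>\<xi> $ j * \<xi> $ i\<bar> + 4 * \<delta>\<^sup>2 + 2 * \<delta> * \<bar>\<xi> $ j\<bar> + 2 * \<delta> * \<bar>\<xi> $ i\<bar>) * (1 + y \<bullet> y)"
      using x by (simp add: distrib_right distrib_left mult.assoc)
  qed (intro continuous_intros)+
  have h0: "has_partials (\<lambda>y. gauss_wave 1 0 y)"
    unfolding has_partials_def
    unfolding real_differentiable_def by (intro allI exI) (rule gauss_wave_has_derivative[where p = "\<lambda>_. 1" and q = "\<lambda>_. 0"], (rule DERIV_const)+)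
  have h1: "has_partials (partial i (\<lambda>y. gauss_wave 1 0 y))" for i
    unfolding has_partials_def partial1_gauss_wave
    unfolding real_differentiable_def
    by (intro allI exI)
       (rule gauss_wave_has_derivative[where p = "\<lambda>y. - (2 * \<delta>) * y $ i" and q = "\<lambda>_. - \<xi> $ i"],
        rule has_real_derivative_coord, rule DERIV_const)
  show ?thesis using a b c h0 h1 by (auto simp: C02_def)
qed

lemma laplacian_gauss_wave:
  "laplacian (\<lambda>y. gauss_wave 1 0 y) = (\<lambda>y. gauss_wave (4 * \<delta>\<^sup>2 * (y \<bullet> y) - 2 * \<delta> * CARD('n)) (4 * \<delta> * (\<xi> \<bullet> y)) y
     - (\<xi> \<bullet> \<xi>) * gauss_wave 1 0 y)"
proof
  fix y :: "real ^ 'n"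
  have "laplacian (\<lambda>y. gauss_wave 1 0 y) y = gauss_wave
     (\<Sum>i\<in>UNIV. - (2 * \<delta>) - \<xi> $ i * \<xi> $ i + 4 * \<delta>\<^sup>2 * y $ i * y $ i)
     (\<Sum>i\<in>UNIV. 2 * \<delta> * (\<xi> $ i * y $ i + y $ i * \<xi> $ i)) y"
    unfolding laplacian_def partial2_gauss_wave unfolding gauss_wave_def
    by (simp add: sum_distrib_right sum.distrib distrib_right)
  also have "(\<Sum>i\<in>UNIV. - (2 * \<delta>) - \<xi> $ i * \<xi> $ i + 4 * \<delta>\<^sup>2 * y $ i * y $ i) =
      4 * \<delta>\<^sup>2 * (y \<bullet> y) - 2 * \<delta> * CARD('n) - \<xi> \<bullet> \<xi>"
    by (simp add: inner_vec_def sum.distrib sum_subtractf sum_distrib_left mult.assoc)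
  also have "(\<Sum>i\<in>UNIV. 2 * \<delta> * (\<xi> $ i * y $ i + y $ i * \<xi> $ i)) = 4 * \<delta> * (\<xi> \<bullet> y)"
    by (simp add: inner_vec_def sum_distrib_left) (simp add: algebra_simps)
  finally show "laplacian (\<lambda>y. gauss_wave 1 0 y) y = gauss_wave (4 * \<delta>\<^sup>2 * (y \<bullet> y) - 2 * \<delta> * CARD('n)) (4 * \<delta> * (\<xi> \<bullet> y)) y
     - (\<xi> \<bullet> \<xi>) * gauss_wave 1 0 y"
    by (simp add: gauss_wave_def algebra_simps)
qed

text \<open>With \<open>s = \<delta> * (y \<bullet> y)\<close> the defect is made of terms
  \<open>\<delta> * (s * exp (- s))\<close>, \<open>\<delta> * exp (- s)\<close> and
  \<open>sqrt \<delta> * (sqrt s * exp (- s))\<close>. They are bounded uniformly in y and vanish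
  with \<delta>.\<close>

lemma laplacian_gauss_wave_error:
  assumes \<delta>: "\<delta> > 0"
  shows "\<bar>laplacian (\<lambda>y. gauss_wave 1 0 y) y + (\<xi> \<bullet> \<xi>) * gauss_wave 1 0 y\<bar> \<le> 2 * \<delta> * CARD('n) + 4 * \<delta> + 4 * sqrt \<delta> * norm \<xi>"
proof -
  define s where "s = \<delta> * (y \<bullet> y)"
  have s: "0 \<le> s" using \<delta> by (simp add: s_def)
  have e1: "s * exp (- s) \<le> 1"
    using order_trans[OF _ exp_ge_add_one_self[of s], of s] by (simp add: exp_minus divide_simps)
  have e2: "sqrt s * exp (- s) \<le> 1"
  proof -
    have "0 \<le> (sqrt s - 1)\<^sup>2" by simp
    then have "sqrt s \<le> 1 + s" using s by (simp add: power2_diff)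
    then have "sqrt s \<le> exp s" using exp_ge_add_one_self[of s] by linarith
    then show ?thesis by (simp add: exp_minus divide_simps)
  qed
  have "laplacian (\<lambda>y. gauss_wave 1 0 y) y + (\<xi> \<bullet> \<xi>) * gauss_wave 1 0 y =
      gauss_wave (4 * \<delta>\<^sup>2 * (y \<bullet> y) - 2 * \<delta> * CARD('n)) (4 * \<delta> * (\<xi> \<bullet> y)) y"
    by (simp add: laplacian_gauss_wave)
  also have "\<bar>\<dots>\<bar> \<le> (4 * \<delta> * s + 2 * \<delta> * CARD('n) + 4 * sqrt \<delta> * norm \<xi> * sqrt s) * exp (- \<delta> * (y \<bullet> y))"
  proof (rule gauss_wave_bound)
    have e: "4 * \<delta>\<^sup>2 * (y \<bullet> y) = 4 * \<delta> * s" by (simp add: s_def power2_eq_square)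
    have "0 \<le> 4 * \<delta> * s" "0 \<le> 2 * \<delta> * real CARD('n)" using \<delta> s by simp_all
    then have 1: "\<bar>4 * \<delta>\<^sup>2 * (y \<bullet> y) - 2 * \<delta> * CARD('n)\<bar> \<le> 4 * \<delta> * s + 2 * \<delta> * CARD('n)"
      unfolding e by linarith
    have "\<bar>4 * \<delta> * (\<xi> \<bullet> y)\<bar> \<le> 4 * \<delta> * (norm \<xi> * norm y)"
      using \<delta> by (simp add: abs_mult Cauchy_Schwarz_ineq2)
    also have "\<dots> = 4 * (sqrt \<delta> * sqrt \<delta>) * norm \<xi> * norm y" using \<delta> by simp
    also have "\<dots> = 4 * sqrt \<delta> * norm \<xi> * sqrt s"
      unfolding s_def by (simp only: real_sqrt_mult norm_eq_sqrt_inner ac_simps)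
    finally show "\<bar>4 * \<delta>\<^sup>2 * (y \<bullet> y) - 2 * \<delta> * CARD('n)\<bar> + \<bar>4 * \<delta> * (\<xi> \<bullet> y)\<bar>
       \<le> 4 * \<delta> * s + 2 * \<delta> * CARD('n) + 4 * sqrt \<delta> * norm \<xi> * sqrt s" using 1 by linarith
  qed
  also have "\<dots> = 4 * \<delta> * (s * exp (- s)) + 2 * \<delta> * CARD('n) * exp (- s) + 4 * sqrt \<delta> * norm \<xi> * (sqrt s * exp (- s))"
    by (simp add: s_def algebra_simps)
  also have "\<dots> \<le> 4 * \<delta> * 1 + 2 * \<delta> * CARD('n) * 1 + 4 * sqrt \<delta> * norm \<xi> * 1"
    using \<delta> s by (intro add_mono mult_left_mono e1 e2) auto
  finally show ?thesis by simp
qed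

end

section \<open>Action of the semigroup on plane waves\<close>

context
  fixes K :: "real \<Rightarrow> real ^ 'n::finite \<Rightarrow> (real ^ 'n) measure" and a :: real
  assumes sg: "markov_semigroup K" and gen: "generated_by K C02 (\<lambda>\<phi> y. a * laplacian \<phi> y)" and a: "0 \<le> a"
begin

lemma semigroup_kernel: "0 \<le> t \<Longrightarrow> K t \<in> borel \<rightarrow>\<^sub>M prob_algebra borel"
  using sg by (auto simp: markov_semigroup_def)

lemma semigroup_prob_space: "0 \<le> t \<Longrightarrow> prob_space (K t y)" and semigroup_sets: "0 \<le> t \<Longrightarrow> sets (K t y) = sets borel"
  using measurable_space[OF semigroup_kernel, of t y] by (auto simp: space_prob_algebra)

lemma semigroup_integral_bound:
  fixes f :: "real ^ 'n \<Rightarrow> real"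
  assumes "0 \<le> t" and [measurable]: "f \<in> borel_measurable borel" and f: "\<And>x. \<bar>f x\<bar> \<le> c"
  shows "integrable (K t y) f" "\<bar>LINT z|K t y. f z\<bar> \<le> c"
proof -
  interpret prob_space "K t y" by (rule semigroup_prob_space) fact
  have m: "f \<in> borel_measurable (K t y)"
    using semigroup_sets[OF assms(1), of y] by (simp cong: measurable_cong_sets)
  show i: "integrable (K t y) f" by (rule integrable_const_bound[OF _ m, where B = c]) (use f in auto)
  have "\<bar>LINT z|K t y. f z\<bar> \<le> (LINT z|K t y. \<bar>f z\<bar>)" by (rule integral_abs_bound)
  also have "\<dots> \<le> (LINT z|K t y. c)" by (rule integral_mono) (use i f in auto)
  finally show "\<bar>LINT z|K t y. f z\<bar> \<le> c" by (simp add: prob_space)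
qed

lemma semigroup_integral_add:
  fixes f :: "real ^ 'n \<Rightarrow> real"
  assumes "0 \<le> s" "0 \<le> t" "f \<in> borel_measurable borel" "\<And>x. \<bar>f x\<bar> \<le> c"
  shows "(LINT z|K (s + t) y. f z) = (LINT x|K s y. LINT z|K t x. f z)"
    and "(\<lambda>x. LINT z|K t x. f z) \<in> borel_measurable borel"
proof -
  have 1: "K (s + t) y = K s y \<bind> K t" using sg assms by (auto simp: markov_semigroup_def)
  have k: "K t \<in> K s y \<rightarrow>\<^sub>M prob_algebra borel"
    using semigroup_kernel[OF assms(2)] semigroup_sets[OF assms(1), of y] by (simp cong: measurable_cong_sets)
  show "(LINT z|K (s + t) y. f z) = (LINT x|K s y. LINT z|K t x. f z)"
    unfolding 1 by (rule integral_bind_bounded[OF semigroup_prob_space[OF assms(1)] k assms(3,4)])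
  show "(\<lambda>x. LINT z|K t x. f z) \<in> borel_measurable borel"
    using integral_bind_bounded(2)[OF semigroup_prob_space[OF assms(1)] k assms(3,4)]
      semigroup_sets[OF assms(1), of y] by (simp cong: measurable_cong_sets)
qed

text \<open>Euler steps of length \<open>t / N\<close>: on an approximate eigenfunction of the generator the semigroup
  acts approximately as multiplication by \<open>1 - \<kappa> t / N\<close>.\<close>

lemma semigroup_approx_eigenfunction:
  assumes \<phi>: "\<phi> \<in> C02" and c: "\<And>x. \<bar>\<phi> x\<bar> \<le> c" and \<kappa>: "0 \<le> \<kappa>" and t: "0 < t"
    and err: "\<And>x. \<bar>a * laplacian \<phi> x + \<kappa> * \<phi> x\<bar> \<le> \<eta>"
  shows "\<bar>(LINT z|K t y. \<phi> z) - exp (- \<kappa> * t) * \<phi> y\<bar> \<le> t * \<eta>"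
proof -
  have \<phi>m: "\<phi> \<in> borel_measurable borel"
    using \<phi> by (auto simp: C02_def C0_def intro: borel_measurable_continuous_onI)
  \<comment> \<open>\<rho> is the uniform error of the difference quotient for small steps; it is
    removed at the end by letting it tend to 0.\<close>
  have "\<bar>(LINT z|K t y. \<phi> z) - exp (- \<kappa> * t) * \<phi> y\<bar> \<le> t * (\<eta> + \<rho>)" if \<rho>: "\<rho> > 0" for \<rho>
  proof -
    have "uniform_limit UNIV (\<lambda>h y. ((LINT z|K h y. \<phi> z) - \<phi> y) / h) (\<lambda>y. a * laplacian \<phi> y) (at_right 0)"
      using gen \<phi> by (auto simp: generated_by_def)
    then have "eventually (\<lambda>h. \<forall>y. dist (((LINT z|K h y. \<phi> z) - \<phi> y) / h) (a * laplacian \<phi> y) < \<rho>) (at_right 0)"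
      using \<rho> by (auto dest: uniform_limitD)
    then obtain h0 where h0: "h0 > 0" and
      hd: "\<And>h y. 0 < h \<Longrightarrow> h < h0 \<Longrightarrow> dist (((LINT z|K h y. \<phi> z) - \<phi> y) / h) (a * laplacian \<phi> y) < \<rho>"
      by (auto simp: eventually_at_right_field)
    have step: "\<bar>(LINT z|K h y. \<phi> z) - (1 - \<kappa> * h) * \<phi> y\<bar> \<le> h * (\<eta> + \<rho>)" if h: "0 < h" "h < h0" for h y
    proof -
      have "\<bar>((LINT z|K h y. \<phi> z) - \<phi> y) / h + \<kappa> * \<phi> y\<bar> \<le> \<rho> + \<eta>"
        using hd[OF h, of y] err[of y] by (simp add: dist_real_def)
      then have "h * \<bar>((LINT z|K h y. \<phi> z) - \<phi> y) / h + \<kappa> * \<phi> y\<bar> \<le> h * (\<rho> + \<eta>)"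
        using h by simp
      also have "h * \<bar>((LINT z|K h y. \<phi> z) - \<phi> y) / h + \<kappa> * \<phi> y\<bar> = \<bar>h * (((LINT z|K h y. \<phi> z) - \<phi> y) / h + \<kappa> * \<phi> y)\<bar>"
        using h by (simp add: abs_mult)
      also have "h * (((LINT z|K h y. \<phi> z) - \<phi> y) / h + \<kappa> * \<phi> y) = (LINT z|K h y. \<phi> z) - (1 - \<kappa> * h) * \<phi> y"
        using h by (simp add: distrib_left left_diff_distrib)
      finally show ?thesis by (simp add: add.commute)
    qed
    \<comment> \<open>The one-step errors merely add up: neither integration against a probability
      kernel nor multiplication by \<open>1 - \<kappa> * h\<close>, which lies in [0, 1], enlarges
      them.\<close>
    have iter: "\<bar>(LINT z|K (real k * h) y. \<phi> z) - (1 - \<kappa> * h) ^ k * \<phi> y\<bar> \<le> real k * (h * (\<eta> + \<rho>))"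
      if h: "0 < h" "h < h0" "\<kappa> * h \<le> 1" for h k
    proof (induction k)
      case 0
      have "K 0 y = return borel y" using sg by (simp add: markov_semigroup_def)
      then show ?case using \<phi>m by (simp add: integral_return)
    next
      case (Suc k)
      have kh: "0 \<le> real k * h" using h by simp
      let ?T = "\<lambda>x. LINT z|K h x. \<phi> z"
      have Tm: "?T \<in> borel_measurable borel"
        by (rule semigroup_integral_add(2)[of 0 h, OF _ _ \<phi>m c]) (use h in auto)
      have Tb: "\<bar>?T x\<bar> \<le> c" for x by (rule semigroup_integral_bound[OF _ \<phi>m c]) (use h in auto)
      have e: "(LINT z|K (real (Suc k) * h) y. \<phi> z) = (LINT x|K (real k * h) y. ?T x)"
        using semigroup_integral_add(1)[OF kh _ \<phi>m c, of h y] h by (simp add: algebra_simps)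
      have i1: "integrable (K (real k * h) y) ?T" by (rule semigroup_integral_bound[OF kh Tm Tb])
      have i2: "integrable (K (real k * h) y) \<phi>" by (rule semigroup_integral_bound[OF kh \<phi>m c])
      have "\<bar>(LINT x|K (real k * h) y. ?T x - (1 - \<kappa> * h) * \<phi> x)\<bar> \<le> h * (\<eta> + \<rho>)"
        by (rule semigroup_integral_bound[OF kh]) (use Tm \<phi>m step[OF h(1,2)] in auto)
      then have 1: "\<bar>(LINT z|K (real (Suc k) * h) y. \<phi> z) - (1 - \<kappa> * h) * (LINT z|K (real k * h) y. \<phi> z)\<bar> \<le> h * (\<eta> + \<rho>)"
        using i1 i2 unfolding e by simp
      have "\<bar>(1 - \<kappa> * h) * ((LINT z|K (real k * h) y. \<phi> z) - (1 - \<kappa> * h) ^ k * \<phi> y)\<bar> \<le> 1 * (real k * (h * (\<eta> + \<rho>)))"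
        unfolding abs_mult using Suc h \<kappa> by (intro mult_mono) auto
      then have 2: "\<bar>(1 - \<kappa> * h) * (LINT z|K (real k * h) y. \<phi> z) - (1 - \<kappa> * h) ^ Suc k * \<phi> y\<bar> \<le> real k * (h * (\<eta> + \<rho>))"
        by (simp add: right_diff_distrib mult.assoc)
      have "real (Suc k) * (h * (\<eta> + \<rho>)) = h * (\<eta> + \<rho>) + real k * (h * (\<eta> + \<rho>))"
        by (simp add: algebra_simps)
      then show ?case using 1 2 by linarith
    qed
    have "eventually (\<lambda>N. t / h0 < real N \<and> \<kappa> * t < real N \<and> 0 < N) sequentially"
      by (intro eventually_conj eventually_gt_at_top
          eventually_compose_filterlim[OF eventually_gt_at_top filterlim_real_sequentially])
    then have ev: "eventually (\<lambda>N. \<bar>(LINT z|K t y. \<phi> z) - (1 + (- \<kappa> * t) / real N) ^ N * \<phi> y\<bar> \<le> t * (\<eta> + \<rho>)) sequentially"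
    proof eventually_elim
      case (elim N)
      then have h: "0 < t / real N" "t / real N < h0" "\<kappa> * (t / real N) \<le> 1"
        using t h0 by (simp_all add: field_simps)
      have "real N * (t / real N) = t" "real N * (t / real N * (\<eta> + \<rho>)) = t * (\<eta> + \<rho>)"
        "1 - \<kappa> * (t / real N) = 1 + (- \<kappa> * t) / real N"
        using elim by simp_all
      then show ?case using iter[OF h, of N] by (simp only:)
    qed
    have "(\<lambda>N. \<bar>(LINT z|K t y. \<phi> z) - (1 + (- \<kappa> * t) / real N) ^ N * \<phi> y\<bar>) \<longlonglongrightarrow>
        \<bar>(LINT z|K t y. \<phi> z) - exp (- \<kappa> * t) * \<phi> y\<bar>"
      by (intro tendsto_intros tendsto_exp_limit_sequentially)
    from tendsto_upperbound[OF this ev] show ?thesis by simp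
  qed
  then have *: "\<bar>(LINT z|K t y. \<phi> z) - exp (- \<kappa> * t) * \<phi> y\<bar> \<le> t * \<eta> + e" if "e > 0" for e
    using that t by (auto simp: distrib_left dest!: spec[of _ "e / t"] meta_spec[of _ "e / t"])
  show ?thesis by (rule field_le_epsilon) (rule *)
qed

text \<open>The estimate for approximate eigenfunctions is applied to waves with envelopes
  \<open>d n\<close> tending to 0. The free phase b includes sines and keeps the whole argument
  real-valued.\<close>

lemma semigroup_cos:
  assumes t: "0 \<le> t"
  shows "(LINT z|K t y. cos (\<xi> \<bullet> z + b)) = exp (- a * (\<xi> \<bullet> \<xi>) * t) * cos (\<xi> \<bullet> y + b)"
proof (cases "t = 0")
  case True
  have "K 0 y = return borel y" using sg by (simp add: markov_semigroup_def)
  then show ?thesis using True by (simp add: integral_return)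
next
  case False
  then have t: "t > 0" using t by simp
  interpret prob_space "K t y" by (rule semigroup_prob_space) (use t in simp)
  define d where "d n = 1 / real (Suc n)" for n
  have d: "d n > 0" for n by (simp add: d_def)
  have d0: "d \<longlonglongrightarrow> 0" unfolding d_def by (rule LIMSEQ_Suc[OF lim_1_over_n])
  let ?g = "\<lambda>n. gauss_wave \<xi> b (d n) 1 0"
  have gb: "\<bar>?g n z\<bar> \<le> 1" for n z
  proof -
    have "\<bar>?g n z\<bar> \<le> 1 * exp (- d n * (z \<bullet> z))" by (rule gauss_wave_bound) simp
    also have "\<dots> \<le> 1" using d[of n] by simp
    finally show ?thesis .
  qed
  have gl: "(\<lambda>n. ?g n z) \<longlonglongrightarrow> cos (\<xi> \<bullet> z + b)" for z
  proof -
    have "(\<lambda>n. (1 * cos (\<xi> \<bullet> z + b) + 0 * sin (\<xi> \<bullet> z + b)) * exp (- d n * (z \<bullet> z))) \<longlonglongrightarrow>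
      (1 * cos (\<xi> \<bullet> z + b) + 0 * sin (\<xi> \<bullet> z + b)) * exp (- 0 * (z \<bullet> z))"
      by (intro tendsto_intros d0)
    then show ?thesis by (simp add: gauss_wave_def)
  qed
  have gm: "?g n \<in> borel_measurable (K t y)" for n
  proof -
    have "?g n \<in> borel_measurable borel"
      by (intro borel_measurable_continuous_onI gauss_wave_continuous) auto
    then show ?thesis using semigroup_sets[of t y] t by (simp cong: measurable_cong_sets)
  qed
  have L1: "(\<lambda>n. LINT z|K t y. ?g n z) \<longlonglongrightarrow> (LINT z|K t y. cos (\<xi> \<bullet> z + b))"
  proof (rule integral_dominated_convergence[where w = "\<lambda>_. 1"])
    have "(\<lambda>z. cos (\<xi> \<bullet> z + b)) \<in> borel_measurable borel" by measurable
    then show "(\<lambda>z. cos (\<xi> \<bullet> z + b)) \<in> borel_measurable (K t y)"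
      using semigroup_sets[of t y] t by (simp cong: measurable_cong_sets)
  qed (use gb gl gm in auto)
  have L2: "(\<lambda>n. exp (- (a * (\<xi> \<bullet> \<xi>)) * t) * ?g n y) \<longlonglongrightarrow> exp (- (a * (\<xi> \<bullet> \<xi>)) * t) * cos (\<xi> \<bullet> y + b)"
    by (intro tendsto_intros gl)
  let ?err = "\<lambda>n. t * (a * (2 * d n * CARD('n) + 4 * d n + 4 * sqrt (d n) * norm \<xi>))"
  have "\<bar>(LINT z|K t y. ?g n z) - exp (- (a * (\<xi> \<bullet> \<xi>)) * t) * ?g n y\<bar> \<le> ?err n" for n
  proof (rule semigroup_approx_eigenfunction[OF gauss_wave_C02[OF d] gb _ t])
    show "0 \<le> a * (\<xi> \<bullet> \<xi>)" using a by simp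
    fix x
    have "a * laplacian (?g n) x + a * (\<xi> \<bullet> \<xi>) * ?g n x = a * (laplacian (?g n) x + (\<xi> \<bullet> \<xi>) * ?g n x)"
      by (simp add: algebra_simps)
    also have "\<bar>\<dots>\<bar> = a * \<bar>laplacian (?g n) x + (\<xi> \<bullet> \<xi>) * ?g n x\<bar>" using a by (simp add: abs_mult)
    also have "\<dots> \<le> a * (2 * d n * CARD('n) + 4 * d n + 4 * sqrt (d n) * norm \<xi>)"
      by (intro mult_left_mono laplacian_gauss_wave_error d a)
    finally show "\<bar>a * laplacian (?g n) x + a * (\<xi> \<bullet> \<xi>) * ?g n x\<bar> \<le>
      a * (2 * d n * CARD('n) + 4 * d n + 4 * sqrt (d n) * norm \<xi>)" .
  qed
  then have ev: "eventually (\<lambda>n. norm ((LINT z|K t y. ?g n z) - exp (- (a * (\<xi> \<bullet> \<xi>)) * t) * ?g n y) \<le> ?err n) sequentially"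
    unfolding real_norm_def by (intro always_eventually allI)
  have "?err \<longlonglongrightarrow> t * (a * (2 * (0::real) * CARD('n) + 4 * (0::real) + 4 * sqrt 0 * norm \<xi>))"
    by (intro tendsto_intros d0)
  then have "?err \<longlonglongrightarrow> 0"
    by (simp only: mult_zero_right mult_zero_left add_0_right real_sqrt_zero)
  from Lim_null_comparison[OF ev this]
  have "(\<lambda>n. (LINT z|K t y. ?g n z) - exp (- (a * (\<xi> \<bullet> \<xi>)) * t) * ?g n y) \<longlonglongrightarrow> 0" .
  then have "(LINT z|K t y. cos (\<xi> \<bullet> z + b)) - exp (- (a * (\<xi> \<bullet> \<xi>)) * t) * cos (\<xi> \<bullet> y + b) = 0"
    using LIMSEQ_unique[OF tendsto_diff[OF L1 L2]] by blast
  then show ?thesis by simp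
qed

text \<open>The Markov property is given for indicators. Under the measure with density
  \<open>V\<close> it says that the law of \<open>X (s + t)\<close> is the law of \<open>X s\<close>
  followed by \<open>K t\<close>; this equality of measures extends it to every nonnegative
  f.\<close>

lemma markov_process_nn_expectation:
  assumes X: "markov_process W X K" and s: "0 \<le> s" and t: "0 \<le> t"
    and V: "V \<in> borel_measurable (past W X s)" "\<And>\<omega>. 0 \<le> V \<omega> \<and> V \<omega> \<le> B"
    and f[measurable]: "f \<in> borel_measurable borel"
  shows "(\<integral>\<^sup>+\<omega>. ennreal (V \<omega>) * f (X (s + t) \<omega>) \<partial>W) = (\<integral>\<^sup>+\<omega>. ennreal (V \<omega>) * (\<integral>\<^sup>+z. f z \<partial>K t (X s \<omega>)) \<partial>W)"
proof -
  interpret prob_space W using X by (simp add: markov_process_def)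
  have Xm[measurable]: "X u \<in> borel_measurable W" if "0 \<le> u" for u using X that by (simp add: markov_process_def)
  have g: "{X u -` A \<inter> space W | u A. 0 \<le> u \<and> u \<le> s \<and> A \<in> sets borel} \<subseteq> sets W"
    by (auto intro: measurable_sets[OF Xm])
  then have sub: "subalgebra W (past W X s)"
    unfolding subalgebra_def past_def
    using order_trans[OF g sets.space_closed] sets.sigma_sets_subset[OF g] by simp
  interpret finite_measure_subalgebra W "past W X s" by standard (rule sub)
  have Vm[measurable]: "V \<in> borel_measurable W" by (rule measurable_from_subalg[OF sub V(1)])
  have Xs[measurable]: "X s \<in> borel_measurable W" and Xst[measurable]: "X (s + t) \<in> borel_measurable W"
    using s t by (auto intro: Xm)
  note k' = measurable_prob_algebraD[OF semigroup_kernel[OF t]]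
  let ?D = "density W (\<lambda>\<omega>. ennreal (V \<omega>))"
  let ?\<mu> = "distr ?D borel (X (s + t))" and ?\<nu> = "distr ?D borel (X s) \<bind> K t"
  have k'': "K t \<in> distr ?D borel (X s) \<rightarrow>\<^sub>M subprob_algebra borel" using k' by simp
  have "?\<mu> = ?\<nu>"
  proof (rule measure_eqI)
    have "sets ?\<nu> = sets borel" using semigroup_sets[OF t] by (intro sets_bind) auto
    then show "sets ?\<mu> = sets ?\<nu>" by simp
    fix A assume "A \<in> sets ?\<mu>"
    then have A[measurable]: "A \<in> sets borel" by simp
    have ce: "AE \<omega> in W. real_cond_exp W (past W X s) (\<lambda>\<omega>. indicator A (X (s + t) \<omega>)) \<omega> = measure (K t (X s \<omega>)) A"
      using X s t A by (simp add: markov_process_def)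
    have int: "integrable W (\<lambda>\<omega>. V \<omega> * indicator A (X (s + t) \<omega>))"
      by (rule integrable_const_bound[where B = B]) (use V(2) in \<open>auto simp: indicator_def intro: order_trans\<close>)
    have Km: "(\<lambda>\<omega>. measure (K t (X s \<omega>)) A) \<in> borel_measurable W"
      unfolding measure_def
      by (intro measurable_compose[OF Xs] borel_measurable_enn2real measurable_emeasure_kernel[OF k' A])
    have "emeasure ?\<mu> A = (\<integral>\<^sup>+\<omega>. ennreal (V \<omega> * indicator A (X (s + t) \<omega>)) \<partial>W)"
      by (subst emeasure_distr, simp, simp, subst emeasure_density)
         (auto intro!: nn_integral_cong simp: indicator_def)
    also have "\<dots> = ennreal (LINT \<omega>|W. V \<omega> * indicator A (X (s + t) \<omega>))"
      by (rule nn_integral_eq_integral[OF int]) (use V in auto)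
    also have "(LINT \<omega>|W. V \<omega> * indicator A (X (s + t) \<omega>)) =
        (LINT \<omega>|W. V \<omega> * real_cond_exp W (past W X s) (\<lambda>\<omega>. indicator A (X (s + t) \<omega>)) \<omega>)"
      by (rule real_cond_exp_intg(2)[OF int V(1), symmetric]) measurable
    also have "\<dots> = (LINT \<omega>|W. V \<omega> * measure (K t (X s \<omega>)) A)"
      by (rule integral_cong_AE) (use ce Km in auto)
    also have "ennreal \<dots> = (\<integral>\<^sup>+\<omega>. ennreal (V \<omega> * measure (K t (X s \<omega>)) A) \<partial>W)"
    proof (rule nn_integral_eq_integral[symmetric])
      show "integrable W (\<lambda>\<omega>. V \<omega> * measure (K t (X s \<omega>)) A)"
      proof (rule integrable_const_bound[where B = B])
        have "V \<omega> * measure (K t (X s \<omega>)) A \<le> B * 1" for \<omega>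
          using V(2)[of \<omega>] prob_space.prob_le_1[OF semigroup_prob_space[OF t]]
          by (intro mult_mono) auto
        then show "AE \<omega> in W. norm (V \<omega> * measure (K t (X s \<omega>)) A) \<le> B" using V(2) by auto
      qed (use Km in measurable)
    qed (use V in auto)
    also have "\<dots> = (\<integral>\<^sup>+\<omega>. ennreal (V \<omega>) * emeasure (K t (X s \<omega>)) A \<partial>W)"
      using V(2) prob_space.finite_measure[OF semigroup_prob_space[OF t]]
      by (intro nn_integral_cong) (simp add: ennreal_mult finite_measure.emeasure_eq_measure)
    also have "\<dots> = emeasure ?\<nu> A"
    proof -
      have m: "(\<lambda>x. emeasure (K t x) A) \<in> borel_measurable borel"
        by (rule measurable_emeasure_kernel[OF k' A])
      show ?thesis
        by (subst emeasure_bind[OF _ k''])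
           (simp_all add: nn_integral_distr nn_integral_density m measurable_compose[OF Xs m])
    qed
    finally show "emeasure ?\<mu> A = emeasure ?\<nu> A" .
  qed
  moreover have "(\<integral>\<^sup>+z. f z \<partial>?\<mu>) = (\<integral>\<^sup>+\<omega>. ennreal (V \<omega>) * f (X (s + t) \<omega>) \<partial>W)"
    by (simp add: nn_integral_distr nn_integral_density)
  moreover have "(\<integral>\<^sup>+z. f z \<partial>?\<nu>) = (\<integral>\<^sup>+\<omega>. ennreal (V \<omega>) * (\<integral>\<^sup>+z. f z \<partial>K t (X s \<omega>)) \<partial>W)"
  proof -
    have m: "(\<lambda>x. \<integral>\<^sup>+z. f z \<partial>K t x) \<in> borel_measurable borel"
      by (rule measurable_compose[OF k' nn_integral_measurable_subprob_algebra]) simp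
    show ?thesis
      by (subst nn_integral_bind[OF f k''])
         (simp add: nn_integral_distr nn_integral_density m measurable_compose[OF Xs m])
  qed
  ultimately show ?thesis by simp
qed

end

section \<open>Increments of the Wiener process\<close>

text \<open>The phases 0 and \<open>- (pi / 2)\<close> give the real and the imaginary part.\<close>

lemma expectation_iexp_eqI:
  fixes Y :: "'a \<Rightarrow> real"
  assumes "prob_space W" and [measurable]: "Y \<in> borel_measurable W"
    and c: "\<And>b. (LINT \<omega>|W. cos (Y \<omega> + b)) = r * cos b"
  shows "(CLINT \<omega>|W. iexp (Y \<omega>)) = of_real r"
proof -
  interpret prob_space W by fact
  have i: "integrable W (\<lambda>\<omega>. iexp (Y \<omega>))" by (rule integrable_const_bound[where B = 1]) auto
  have s: "cos (Y \<omega> + (- (pi / 2))) = sin (Y \<omega>)" for \<omega> by (simp add: cos_diff)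
  show ?thesis
  proof (rule complex_eqI)
    show "Re (CLINT \<omega>|W. iexp (Y \<omega>)) = Re (of_real r)"
      using c[of 0] integral_Re[OF i] by (simp add: Re_exp)
    show "Im (CLINT \<omega>|W. iexp (Y \<omega>)) = Im (of_real r)"
      using c[of "- (pi / 2)"] integral_Im[OF i] unfolding s by (simp add: Im_exp)
  qed
qed

context
  fixes K :: "real \<Rightarrow> real ^ 'n::finite \<Rightarrow> (real ^ 'n) measure" and a :: real
    and W :: "'b measure" and X :: "real \<Rightarrow> 'b \<Rightarrow> real ^ 'n"
  assumes sg: "markov_semigroup K" and gen: "generated_by K C02 (\<lambda>\<phi> y. a * laplacian \<phi> y)" and a: "0 \<le> a"
    and X: "markov_process W X K"
begin

text \<open>Cosines change sign while the Markov rule is for nonnegative functions. Hence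
  \<open>1 + cos\<close> is used both as weight and as test function, and the contributions of the
  constants are subtracted afterwards.\<close>

lemma markov_cos_product:
  assumes s: "0 \<le> s" and t: "0 \<le> t" and A: "A \<in> borel_measurable (past W X s)" "A \<in> borel_measurable W"
  shows "(LINT \<omega>|W. cos (A \<omega>) * cos (\<xi> \<bullet> X (s + t) \<omega> + b)) =
    exp (- a * (\<xi> \<bullet> \<xi>) * t) * (LINT \<omega>|W. cos (A \<omega>) * cos (\<xi> \<bullet> X s \<omega> + b))"
proof -
  interpret prob_space W using X by (simp add: markov_process_def)
  have Xm[measurable]: "X u \<in> borel_measurable W" if "0 \<le> u" for u using X that by (simp add: markov_process_def)
  note [measurable] = A(2) Xm[OF s] Xm[of "s + t"]
  have Xst[measurable]: "X (s + t) \<in> borel_measurable W" using s t by (intro Xm) simp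
  let ?e = "exp (- a * (\<xi> \<bullet> \<xi>) * t)"
  have e1: "?e \<le> 1" using a t by simp
  have pos: "0 \<le> 1 + cos u" "0 \<le> 1 + ?e * cos u" for u :: real
  proof -
    show "0 \<le> 1 + cos u" using cos_ge_minus_one[of u] by linarith
    have "\<bar>?e * cos u\<bar> \<le> 1 * 1" unfolding abs_mult using e1 by (intro mult_mono) auto
    then show "0 \<le> 1 + ?e * cos u" by linarith
  qed
  have Kf: "(\<integral>\<^sup>+z. ennreal (1 + cos (\<xi> \<bullet> z + b)) \<partial>K t y) = ennreal (1 + ?e * cos (\<xi> \<bullet> y + b))" for y
  proof -
    interpret Ky: prob_space "K t y" by (rule semigroup_prob_space[OF sg gen a t])
    have i: "integrable (K t y) (\<lambda>z. cos (\<xi> \<bullet> z + b))"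
      by (rule semigroup_integral_bound[OF sg gen a t, where c = 1]) auto
    have "(\<integral>\<^sup>+z. ennreal (1 + cos (\<xi> \<bullet> z + b)) \<partial>K t y) = ennreal (LINT z|K t y. 1 + cos (\<xi> \<bullet> z + b))"
      by (rule nn_integral_eq_integral) (use i pos in auto)
    then show ?thesis using i semigroup_cos[OF sg gen a t] by (simp add: Ky.prob_space)
  qed
  have key: "(LINT \<omega>|W. V \<omega> * cos (\<xi> \<bullet> X (s + t) \<omega> + b)) = ?e * (LINT \<omega>|W. V \<omega> * cos (\<xi> \<bullet> X s \<omega> + b))"
    if V: "V \<in> borel_measurable (past W X s)" and Vm[measurable]: "V \<in> borel_measurable W"
      and V2: "\<And>\<omega>. 0 \<le> V \<omega> \<and> V \<omega> \<le> 2" for V :: "'b \<Rightarrow> real"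
  proof -
    have bd: "\<bar>V \<omega> * cos u\<bar> \<le> 2" for \<omega> u
    proof -
      have "\<bar>V \<omega>\<bar> * \<bar>cos u\<bar> \<le> 2 * 1" using V2[of \<omega>] by (intro mult_mono) auto
      then show ?thesis by (simp add: abs_mult)
    qed
    have iV: "integrable W V" by (rule integrable_const_bound[where B = 2]) (use V2 in auto)
    have i1: "integrable W (\<lambda>\<omega>. V \<omega> * cos (\<xi> \<bullet> X (s + t) \<omega> + b))"
      and i2: "integrable W (\<lambda>\<omega>. V \<omega> * cos (\<xi> \<bullet> X s \<omega> + b))"
      by (rule integrable_const_bound[where B = 2], use bd in simp, measurable)+
    have j1: "integrable W (\<lambda>\<omega>. V \<omega> * (1 + cos (\<xi> \<bullet> X (s + t) \<omega> + b)))"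
      and j2: "integrable W (\<lambda>\<omega>. V \<omega> * (1 + ?e * cos (\<xi> \<bullet> X s \<omega> + b)))"
      using iV i1 i2 by (simp_all add: distrib_left mult.left_commute[of "V _"])
    have "ennreal (LINT \<omega>|W. V \<omega> * (1 + cos (\<xi> \<bullet> X (s + t) \<omega> + b))) =
        (\<integral>\<^sup>+\<omega>. ennreal (V \<omega> * (1 + cos (\<xi> \<bullet> X (s + t) \<omega> + b))) \<partial>W)"
      by (rule nn_integral_eq_integral[OF j1, symmetric]) (use V2 pos in auto)
    also have "\<dots> = (\<integral>\<^sup>+\<omega>. ennreal (V \<omega>) * ennreal (1 + cos (\<xi> \<bullet> X (s + t) \<omega> + b)) \<partial>W)"
      using V2 pos by (simp add: ennreal_mult)
    also have "\<dots> = (\<integral>\<^sup>+\<omega>. ennreal (V \<omega>) * ennreal (1 + ?e * cos (\<xi> \<bullet> X s \<omega> + b)) \<partial>W)"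
      by (subst markov_process_nn_expectation[OF sg gen a X s t V V2]) (simp_all add: Kf)
    also have "\<dots> = (\<integral>\<^sup>+\<omega>. ennreal (V \<omega> * (1 + ?e * cos (\<xi> \<bullet> X s \<omega> + b))) \<partial>W)"
      using V2 pos by (simp add: ennreal_mult)
    also have "\<dots> = ennreal (LINT \<omega>|W. V \<omega> * (1 + ?e * cos (\<xi> \<bullet> X s \<omega> + b)))"
      by (rule nn_integral_eq_integral[OF j2]) (use V2 pos in auto)
    finally have "(LINT \<omega>|W. V \<omega> * (1 + cos (\<xi> \<bullet> X (s + t) \<omega> + b))) =
        (LINT \<omega>|W. V \<omega> * (1 + ?e * cos (\<xi> \<bullet> X s \<omega> + b)))"
      using V2 pos by (subst (asm) ennreal_inj) (auto intro!: integral_nonneg mult_nonneg_nonneg)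
    then show ?thesis using iV i1 i2 by (simp add: distrib_left mult.left_commute[of "V _"])
  qed
  have i: "integrable W (\<lambda>\<omega>. cos (A \<omega>) * cos (\<xi> \<bullet> X u \<omega> + b))" "integrable W (\<lambda>\<omega>. cos (\<xi> \<bullet> X u \<omega> + b))"
    if "0 \<le> u" for u
  proof -
    note [measurable] = Xm[OF that]
    show "integrable W (\<lambda>\<omega>. cos (A \<omega>) * cos (\<xi> \<bullet> X u \<omega> + b))"
      by (rule integrable_const_bound[where B = 1]) (auto simp: abs_mult intro!: mult_le_one)
    show "integrable W (\<lambda>\<omega>. cos (\<xi> \<bullet> X u \<omega> + b))"
      by (rule integrable_const_bound[where B = 1]) auto
  qed
  \<comment> \<open>The rule \<open>key\<close> is used with the weights
    \<open>1 + cos (A \<omega>)\<close> and 1; the difference is the claim.\<close>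
  have "(LINT \<omega>|W. (1 + cos (A \<omega>)) * cos (\<xi> \<bullet> X (s + t) \<omega> + b)) =
      ?e * (LINT \<omega>|W. (1 + cos (A \<omega>)) * cos (\<xi> \<bullet> X s \<omega> + b))"
    by (rule key) (use A(1) pos in auto)
  moreover have "(LINT \<omega>|W. 1 * cos (\<xi> \<bullet> X (s + t) \<omega> + b)) = ?e * (LINT \<omega>|W. 1 * cos (\<xi> \<bullet> X s \<omega> + b))"
    by (rule key) auto
  ultimately show ?thesis
    using i[OF s] i[of "s + t"] s t by (simp add: distrib_right distrib_left)
qed

text \<open>The addition formula splits the cosine into products, the sines being cosines shifted by
  \<open>- (pi / 2)\<close>.\<close>

lemma markov_cos_sum:
  assumes s: "0 \<le> s" and t: "0 \<le> t" and A: "A \<in> borel_measurable (past W X s)" "A \<in> borel_measurable W"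
  shows "(LINT \<omega>|W. cos (A \<omega> + \<xi> \<bullet> X (s + t) \<omega>)) =
    exp (- a * (\<xi> \<bullet> \<xi>) * t) * (LINT \<omega>|W. cos (A \<omega> + \<xi> \<bullet> X s \<omega>))"
proof -
  interpret prob_space W using X by (simp add: markov_process_def)
  have Xm[measurable]: "X u \<in> borel_measurable W" if "0 \<le> u" for u using X that by (simp add: markov_process_def)
  note [measurable] = A(2)
  have e: "cos (A \<omega> + \<xi> \<bullet> X u \<omega>) = cos (A \<omega>) * cos (\<xi> \<bullet> X u \<omega> + 0) - cos (A \<omega> + - (pi / 2)) * cos (\<xi> \<bullet> X u \<omega> + - (pi / 2))" for \<omega> u
    by (simp add: cos_add cos_diff)
  have i: "integrable W (\<lambda>\<omega>. cos (B \<omega>) * cos (\<xi> \<bullet> X u \<omega> + b))"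
    if "0 \<le> u" and [measurable]: "B \<in> borel_measurable W" for u B b
  proof -
    note [measurable] = Xm[OF that(1)]
    show ?thesis by (rule integrable_const_bound[where B = 1]) (auto simp: abs_mult intro!: mult_le_one)
  qed
  have A2: "(\<lambda>\<omega>. A \<omega> + - (pi / 2)) \<in> borel_measurable (past W X s)" "(\<lambda>\<omega>. A \<omega> + - (pi / 2)) \<in> borel_measurable W"
    by (intro borel_measurable_add borel_measurable_const A)+
  have st: "0 \<le> s + t" using s t by simp
  show ?thesis
    unfolding e Bochner_Integration.integral_diff[OF i[OF st A(2)] i[OF st A2(2)]]
      Bochner_Integration.integral_diff[OF i[OF s A(2)] i[OF s A2(2)]]
      markov_cos_product[OF s t A] markov_cos_product[OF s t A2] by (simp add: right_diff_distrib)
qed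

lemma past_measurable:
  assumes "0 \<le> u" "u \<le> s" shows "X u \<in> borel_measurable (past W X s)"
proof (rule measurableI)
  have g: "{X u -` A \<inter> space W | u A. 0 \<le> u \<and> u \<le> s \<and> A \<in> sets borel} \<subseteq> Pow (space W)" by auto
  fix A :: "(real ^ 'n) set" assume "A \<in> sets borel"
  then show "X u -` A \<inter> space (past W X s) \<in> sets (past W X s)"
    unfolding past_def using assms g by (auto simp: sets_measure_of[OF g] space_measure_of[OF g] intro!: sigma_sets.Basic)
qed simp

text \<open>Induction on N for cosines with a free phase: the last increment is integrated out by
  the Markov property at time \<open>h * real N\<close>.\<close>

lemma increments_iexp:
  assumes h: "0 \<le> h"
  shows "(CLINT \<omega>|W. iexp (\<Sum>j<N. \<eta> j \<bullet> (X (h * real (Suc j)) \<omega> - X (h * real j) \<omega>))) =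
    of_real (exp (- a * h * (\<Sum>j<N. \<eta> j \<bullet> \<eta> j)))"
proof (rule expectation_iexp_eqI)
  show ps: "prob_space W" using X by (simp add: markov_process_def)
  interpret prob_space W by fact
  have Xm[measurable]: "X u \<in> borel_measurable W" if "0 \<le> u" for u using X that by (simp add: markov_process_def)
  have hj[measurable]: "X (h * real j) \<in> borel_measurable W" for j using h by (intro Xm) simp
  have hj'[measurable]: "X (h * (1 + real j)) \<in> borel_measurable W" for j using h by (intro Xm) simp
  show "(\<lambda>\<omega>. \<Sum>j<N. \<eta> j \<bullet> (X (h * real (Suc j)) \<omega> - X (h * real j) \<omega>)) \<in> borel_measurable W"
    by measurable
  show "(LINT \<omega>|W. cos ((\<Sum>j<N. \<eta> j \<bullet> (X (h * real (Suc j)) \<omega> - X (h * real j) \<omega>)) + b)) =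
      exp (- a * h * (\<Sum>j<N. \<eta> j \<bullet> \<eta> j)) * cos b" for b
  proof (induction N)
    case 0 then show ?case by (simp add: prob_space)
  next
    case (Suc N)
    \<comment> \<open>Collects all that is known at time \<open>h * real N\<close>: the earlier
      increments, the phase and the subtracted part of the last increment.\<close>
    define A where "A \<omega> = (\<Sum>j<N. \<eta> j \<bullet> (X (h * real (Suc j)) \<omega> - X (h * real j) \<omega>)) + b - \<eta> N \<bullet> X (h * real N) \<omega>" for \<omega>
    have s: "0 \<le> h * real N" using h by simp
    have p: "X (h * real j) \<in> borel_measurable (past W X (h * real N))" if "j \<le> N" for j
      by (rule past_measurable) (use h that in \<open>auto intro: mult_left_mono\<close>)
    have A: "A \<in> borel_measurable (past W X (h * real N))" "A \<in> borel_measurable W"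
      unfolding A_def[abs_def]
      by (intro borel_measurable_diff borel_measurable_add borel_measurable_sum borel_measurable_inner
          borel_measurable_const p hj; simp)+
    have e: "h * real (Suc N) = h * real N + h" by (simp add: algebra_simps)
    have "(LINT \<omega>|W. cos ((\<Sum>j<Suc N. \<eta> j \<bullet> (X (h * real (Suc j)) \<omega> - X (h * real j) \<omega>)) + b)) =
        (LINT \<omega>|W. cos (A \<omega> + \<eta> N \<bullet> X (h * real N + h) \<omega>))"
      unfolding e[symmetric] by (simp add: A_def inner_diff_right algebra_simps del: of_nat_Suc)
    also have "\<dots> = exp (- a * (\<eta> N \<bullet> \<eta> N) * h) * (LINT \<omega>|W. cos (A \<omega> + \<eta> N \<bullet> X (h * real N) \<omega>))"
      by (rule markov_cos_sum[OF s h A])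
    also have "(LINT \<omega>|W. cos (A \<omega> + \<eta> N \<bullet> X (h * real N) \<omega>)) = exp (- a * h * (\<Sum>j<N. \<eta> j \<bullet> \<eta> j)) * cos b"
      using Suc.IH by (simp add: A_def)
    also have "exp (- a * (\<eta> N \<bullet> \<eta> N) * h) * (exp (- a * h * (\<Sum>j<N. \<eta> j \<bullet> \<eta> j)) * cos b) =
        exp (- a * h * (\<Sum>j<Suc N. \<eta> j \<bullet> \<eta> j)) * cos b"
      by (simp add: exp_add[symmetric] mult.assoc[symmetric]) (simp add: algebra_simps)
    finally show ?case .
  qed
qed

end

section \<open>Moments of a uniform direction\<close>

lemma integral_restrict_Ico_FTC:
  fixes f F :: "real \<Rightarrow> real"
  assumes "a \<le> b" and F: "\<And>x. (F has_real_derivative f x) (at x)" and f: "\<And>x. isCont f x"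
  shows "(LINT x|restrict_space lborel {a..<b}. f x) = F b - F a"
proof -
  have fm: "f \<in> borel_measurable borel"
    using f by (intro borel_measurable_continuous_onI) (simp add: continuous_on_eq_continuous_at)
  have "(LINT x|restrict_space lborel {a..<b}. f x) = (LINT x|lborel. indicator {a..<b} x *\<^sub>R f x)"
    by (rule integral_restrict_space) simp
  also have "\<dots> = (LINT x|lborel. f x * indicator {a..b} x)"
    by (rule integral_cong_AE) (use fm AE_lborel_singleton[of b] in \<open>auto simp: indicator_def elim!: eventually_mono\<close>)
  also have "\<dots> = F b - F a"
    by (rule integral_FTC_Icc_real[OF \<open>a \<le> b\<close>]) (use F f in auto)
  finally show ?thesis .
qed

lemma integrable_restrict_Ico:
  fixes f :: "real \<Rightarrow> real"
  assumes f: "continuous_on UNIV f"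
  shows "integrable (restrict_space lborel {a..<b}) f"
proof -
  have fm: "f \<in> borel_measurable borel" by (rule borel_measurable_continuous_onI[OF f])
  have "integrable lborel (\<lambda>x. indicator {a..b} x *\<^sub>R f x)"
    using borel_integrable_atLeastAtMost'[OF continuous_on_subset[OF f subset_UNIV]] by (simp add: set_integrable_def)
  then have "integrable lborel (\<lambda>x. indicator {a..<b} x *\<^sub>R f x)"
    by (rule Bochner_Integration.integrable_bound) (use fm in \<open>auto simp: indicator_def\<close>)
  then show ?thesis by (subst integrable_restrict_space) simp_all
qed

text \<open>Integral against one factor of the volume element. Angle i carries the exponent
  \<open>n - 1 - i\<close>; the last angle has exponent 0 and runs over a full period.\<close>

definition sin_weighted :: "real \<Rightarrow> nat \<Rightarrow> (real \<Rightarrow> real) \<Rightarrow> real" where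
  "sin_weighted b k f = (LINT x|restrict_space lborel {0..<b}. sin x ^ k * f x)"

lemma sin_weighted_cos: "sin_weighted pi k cos = 0"
proof -
  have "sin_weighted pi k cos = sin pi ^ Suc k / (Suc k) - sin 0 ^ Suc k / (Suc k)"
    unfolding sin_weighted_def
    by (rule integral_restrict_Ico_FTC) (auto intro!: derivative_eq_intros continuous_intros simp del: of_nat_Suc power_Suc)
  then show ?thesis by simp
qed

lemma sin_weighted_sin_cos: "sin_weighted pi k (\<lambda>x. sin x * cos x) = 0"
  using sin_weighted_cos[of "Suc k"] by (simp add: sin_weighted_def ac_simps)

lemma sin_weighted_1_eq: "sin_weighted b k (\<lambda>x. (cos x)\<^sup>2) + sin_weighted b k (\<lambda>x. (sin x)\<^sup>2) = sin_weighted b k (\<lambda>_. 1)"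
proof -
  have "sin_weighted b k (\<lambda>x. (cos x)\<^sup>2) + sin_weighted b k (\<lambda>x. (sin x)\<^sup>2) =
      (LINT x|restrict_space lborel {0..<b}. sin x ^ k * (cos x)\<^sup>2 + sin x ^ k * (sin x)\<^sup>2)"
    unfolding sin_weighted_def
    by (rule Bochner_Integration.integral_add[symmetric]) (intro integrable_restrict_Ico continuous_intros)+
  also have "\<dots> = sin_weighted b k (\<lambda>_. 1)"
    unfolding sin_weighted_def distrib_left[symmetric] by simp
  finally show ?thesis .
qed

text \<open>Integrating the derivative of \<open>sin\<^sup>k\<^sup>+\<^sup>1 cos\<close> over a half or full period.\<close>

lemma sin_weighted_parts:
  assumes "0 \<le> b" "sin b = 0"
  shows "(real k + 1) * sin_weighted b k (\<lambda>x. (cos x)\<^sup>2) = sin_weighted b k (\<lambda>x. (sin x)\<^sup>2)"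
proof -
  have "(real k + 1) * sin_weighted b k (\<lambda>x. (cos x)\<^sup>2) - sin_weighted b k (\<lambda>x. (sin x)\<^sup>2) =
      (LINT x|restrict_space lborel {0..<b}. (real k + 1) * (sin x ^ k * (cos x)\<^sup>2) - sin x ^ k * (sin x)\<^sup>2)"
    unfolding sin_weighted_def integral_mult_right_zero[symmetric]
    by (rule Bochner_Integration.integral_diff[symmetric]) (intro integrable_restrict_Ico continuous_intros)+
  also have "\<dots> = sin b ^ Suc k * cos b - sin 0 ^ Suc k * cos 0"
  proof (rule integral_restrict_Ico_FTC[OF assms(1)])
    show "((\<lambda>x. sin x ^ Suc k * cos x) has_real_derivative
        (real k + 1) * (sin x ^ k * (cos x)\<^sup>2) - sin x ^ k * (sin x)\<^sup>2) (at x)" for x :: real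
      by (rule DERIV_cong[OF DERIV_mult[OF DERIV_power_Suc[OF DERIV_sin] DERIV_cos]])
         (simp add: power2_eq_square algebra_simps)
  qed (intro continuous_intros)
  finally show ?thesis using assms(2) by simp
qed

text \<open>Solves the two linear equations given by \<open>cos^2 + sin^2 = 1\<close> and by
  integration by parts.\<close>

lemma sin_weighted_squares:
  assumes "0 \<le> b" "sin b = 0"
  shows "sin_weighted b k (\<lambda>x. (cos x)\<^sup>2) = sin_weighted b k (\<lambda>_. 1) / (k + 2)"
    and "sin_weighted b k (\<lambda>x. (sin x)\<^sup>2) = sin_weighted b k (\<lambda>_. 1) * (k + 1) / (k + 2)"
proof -
  let ?c = "sin_weighted b k (\<lambda>x. (cos x)\<^sup>2)" and ?s = "sin_weighted b k (\<lambda>x. (sin x)\<^sup>2)"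
  have "?c + (real k + 1) * ?c = sin_weighted b k (\<lambda>_. 1)"
    using sin_weighted_1_eq[of b k] sin_weighted_parts[OF assms, of k] by simp
  then show c: "?c = sin_weighted b k (\<lambda>_. 1) / (k + 2)"
    by (simp add: field_simps)
  show "?s = sin_weighted b k (\<lambda>_. 1) * (k + 1) / (k + 2)"
    unfolding sin_weighted_parts[OF assms, of k, symmetric] c by simp
qed

text \<open>Wallis recursion: raising the exponent n by 2 multiplies the integral by
  \<open>(n + 1) / (n + 2)\<close>, so exponents 0 and 1 decide.\<close>

lemma sin_weighted_pos: "0 < sin_weighted pi k (\<lambda>_. 1)"
proof (induction k rule: induct_nat_012)
  case 0
  have "sin_weighted pi 0 (\<lambda>_. 1) = pi - 0" unfolding sin_weighted_def
    by (rule integral_restrict_Ico_FTC) (auto intro!: derivative_eq_intros)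
  then show ?case by simp
next
  case 1
  have "sin_weighted pi 1 (\<lambda>_. 1) = - cos pi - (- cos 0)" unfolding sin_weighted_def
    by (rule integral_restrict_Ico_FTC) (auto intro!: derivative_eq_intros)
  then show ?case by simp
next
  case (ge2 n)
  have "sin_weighted pi (Suc (Suc n)) (\<lambda>_. 1) = sin_weighted pi n (\<lambda>x. (sin x)\<^sup>2)"
    by (simp add: sin_weighted_def power2_eq_square ac_simps)
  also have "\<dots> = sin_weighted pi n (\<lambda>_. 1) * (n + 1) / (n + 2)" by (rule sin_weighted_squares) auto
  finally show ?case using ge2 by simp
qed

lemma sin_weighted_period:
  "sin_weighted (2 * pi) 0 (\<lambda>_. 1) = 2 * pi" "sin_weighted (2 * pi) 0 sin = 0"
  "sin_weighted (2 * pi) 0 cos = 0" "sin_weighted (2 * pi) 0 (\<lambda>x. sin x * cos x) = 0"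
proof -
  have "sin_weighted (2 * pi) 0 (\<lambda>_. 1) = 2 * pi - 0" unfolding sin_weighted_def
    by (rule integral_restrict_Ico_FTC) (auto intro!: derivative_eq_intros)
  moreover have "sin_weighted (2 * pi) 0 sin = - cos (2 * pi) - (- cos 0)" unfolding sin_weighted_def
    by (rule integral_restrict_Ico_FTC) (auto intro!: derivative_eq_intros)
  moreover have "sin_weighted (2 * pi) 0 cos = sin (2 * pi) - sin 0" unfolding sin_weighted_def
    by (rule integral_restrict_Ico_FTC) (auto intro!: derivative_eq_intros)
  moreover have "sin_weighted (2 * pi) 0 (\<lambda>x. sin x * cos x) = (sin (2 * pi))\<^sup>2 / 2 - (sin 0)\<^sup>2 / 2" unfolding sin_weighted_def
    by (rule integral_restrict_Ico_FTC) (auto intro!: derivative_eq_intros continuous_intros)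
  ultimately show "sin_weighted (2 * pi) 0 (\<lambda>_. 1) = 2 * pi" "sin_weighted (2 * pi) 0 sin = 0"
    "sin_weighted (2 * pi) 0 cos = 0" "sin_weighted (2 * pi) 0 (\<lambda>x. sin x * cos x) = 0" by simp_all
qed

definition angle_end :: "nat \<Rightarrow> nat \<Rightarrow> real" where
  "angle_end n i = (if i \<le> n - 2 then pi else 2 * pi)"

text \<open>Factor contributed by angle j to coordinate m. Filling up with 1 beyond m turns every
  coordinate into a product over all angles, which integrates factor by factor.\<close>

definition angle_factor :: "nat \<Rightarrow> nat \<Rightarrow> real \<Rightarrow> real" where
  "angle_factor m j x = (if j < m then sin x else if j = m then cos x else 1)"

definition angle_mean :: "nat \<Rightarrow> nat \<Rightarrow> (real \<Rightarrow> real) \<Rightarrow> real" where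
  "angle_mean n i f = sin_weighted (angle_end n i) (n - 1 - i) f / sin_weighted (angle_end n i) (n - 1 - i) (\<lambda>_. 1)"

lemma angle_factor_continuous: "continuous_on UNIV (angle_factor m j)"
  by (cases "j < m"; cases "j = m"; auto simp: angle_factor_def[abs_def] intro!: continuous_intros)

lemma prod_split_at:
  fixes f :: "nat \<Rightarrow> real"
  assumes "m \<in> {1..N}"
  shows "(\<Prod>i\<in>{1..N}. f i) = (\<Prod>i\<in>{1..<m}. f i) * f m * (\<Prod>i\<in>{m<..N}. f i)"
proof -
  have "{1..N} = insert m ({1..<m} \<union> {m<..N})" using assms by auto
  then have "(\<Prod>i\<in>{1..N}. f i) = f m * (\<Prod>i\<in>{1..<m} \<union> {m<..N}. f i)"
    by (simp only: finite_UnI finite_atLeastLessThan finite_greaterThanAtMost prod.insert) simp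
  also have "(\<Prod>i\<in>{1..<m} \<union> {m<..N}. f i) = (\<Prod>i\<in>{1..<m}. f i) * (\<Prod>i\<in>{m<..N}. f i)"
    by (rule prod.union_disjoint) auto
  finally show ?thesis by (simp add: ac_simps)
qed

lemma angle_range_eq: "angle_range n i = {0..<angle_end n i}"
  by (simp add: angle_range_def angle_end_def)

section \<open>Integration over the product of the angles\<close>

context
  fixes n :: nat assumes n: "2 \<le> n"
begin

lemma angle_weight_pos: "i \<in> {1..n - 1} \<Longrightarrow> 0 < sin_weighted (angle_end n i) (n - 1 - i) (\<lambda>_. 1)"
  using n sin_weighted_pos[of "n - 1 - i"] sin_weighted_period(1)
  by (cases "i \<le> n - 2") (auto simp: angle_end_def)

text \<open>With exponent \<open>k = n - 1 - i\<close> the denominator \<open>k + 2\<close> becomes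
  \<open>n - i + 1\<close>. At the last angle the sine has mean 0 because the angle runs over a full
  period.\<close>

lemma angle_means:
  assumes i: "i \<in> {1..n - 1}"
  shows "angle_mean n i (\<lambda>_. 1) = 1" "angle_mean n i cos = 0" "angle_mean n i (\<lambda>x. sin x * cos x) = 0"
    "i = n - 1 \<Longrightarrow> angle_mean n i sin = 0"
    "angle_mean n i (\<lambda>x. (cos x)\<^sup>2) = 1 / (real n - real i + 1)"
    "angle_mean n i (\<lambda>x. (sin x)\<^sup>2) = (real n - real i) / (real n - real i + 1)"
proof -
  note p = angle_weight_pos[OF i]
  have b: "0 \<le> angle_end n i" "sin (angle_end n i) = 0" by (auto simp: angle_end_def)
  have k: "real (n - 1 - i) = real n - 1 - real i" using i n by auto
  show "angle_mean n i (\<lambda>_. 1) = 1" using p by (simp add: angle_mean_def)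
  show "angle_mean n i cos = 0"
    using i sin_weighted_cos sin_weighted_period by (auto simp: angle_mean_def angle_end_def)
  show "angle_mean n i (\<lambda>x. sin x * cos x) = 0"
    using i sin_weighted_sin_cos sin_weighted_period by (auto simp: angle_mean_def angle_end_def)
  show "i = n - 1 \<Longrightarrow> angle_mean n i sin = 0"
    using n i sin_weighted_period by (auto simp: angle_mean_def angle_end_def)
  show "angle_mean n i (\<lambda>x. (cos x)\<^sup>2) = 1 / (real n - real i + 1)"
    using p k unfolding angle_mean_def sin_weighted_squares[OF b] by simp
  show "angle_mean n i (\<lambda>x. (sin x)\<^sup>2) = (real n - real i) / (real n - real i + 1)"
    using p k unfolding angle_mean_def sin_weighted_squares[OF b] by simp
qed

lemma sigma_finite_angle_range: "sigma_finite_measure (restrict_space lborel (angle_range n i))"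
proof -
  interpret finite_measure "restrict_space lborel (angle_range n i)"
    by (intro finite_measureI) (simp add: angle_range_eq angle_end_def emeasure_restrict_space space_restrict_space)
  show ?thesis by unfold_locales
qed

interpretation ar: product_sigma_finite "\<lambda>i. restrict_space lborel (angle_range n i)"
  by (rule product_sigma_finite.intro) (rule sigma_finite_angle_range)

lemma angle_density_measurable:
  "(\<lambda>\<theta>. \<Prod>i = 1..n - 2. sin (\<theta> i) ^ (n - 1 - i)) \<in> borel_measurable (\<Pi>\<^sub>M i\<in>{1..n - 1}. restrict_space lborel (angle_range n i))"
proof (intro borel_measurable_prod borel_measurable_power)
  fix i assume i: "i \<in> {1..n - 2}"
  have "(\<lambda>x. sin x) \<in> borel_measurable (restrict_space lborel (angle_range n i))"
    by (intro measurable_restrict_space1) simp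
  then show "(\<lambda>\<theta>. sin (\<theta> i)) \<in> borel_measurable (\<Pi>\<^sub>M i\<in>{1..n - 1}. restrict_space lborel (angle_range n i))"
    by (rule measurable_compose[OF measurable_component_singleton, rotated]) (use i in auto)
qed

lemma angle_volume_integral:
  assumes f: "\<And>i. i \<in> {1..n - 1} \<Longrightarrow> continuous_on UNIV (f i)"
  shows "integrable (angle_volume n) (\<lambda>\<theta>. \<Prod>i\<in>{1..n - 1}. f i (\<theta> i))"
    and "(LINT \<theta>|angle_volume n. (\<Prod>i\<in>{1..n - 1}. f i (\<theta> i))) = (\<Prod>i\<in>{1..n - 1}. sin_weighted (angle_end n i) (n - 1 - i) (f i))"
proof -
  let ?P = "\<Pi>\<^sub>M i\<in>{1..n - 1}. restrict_space lborel (angle_range n i)"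
  have s: "{1..n - 1} = insert (n - 1) {1..n - 2}" using n by auto
  \<comment> \<open>At the last angle the exponent is 0, so the weight extends to a product over all
    angles.\<close>
  have w: "(\<Prod>i = 1..n - 2. sin (\<theta> i) ^ (n - 1 - i)) = (\<Prod>i\<in>{1..n - 1}. sin (\<theta> i) ^ (n - 1 - i))" for \<theta> :: "nat \<Rightarrow> real"
    using n unfolding s by (subst prod.insert) auto
  have m: "(\<lambda>\<theta>. \<Prod>i\<in>{1..n - 1}. f i (\<theta> i)) \<in> borel_measurable ?P"
  proof (intro borel_measurable_prod)
    fix i assume i: "i \<in> {1..n - 1}"
    have "f i \<in> borel_measurable (restrict_space lborel (angle_range n i))"
      using borel_measurable_continuous_onI[OF f[OF i]] by (intro measurable_restrict_space1) simp
    then show "(\<lambda>\<theta>. f i (\<theta> i)) \<in> borel_measurable ?P"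
      by (rule measurable_compose[OF measurable_component_singleton, rotated]) (use i in auto)
  qed
  have nn: "AE \<theta> in ?P. 0 \<le> (\<Prod>i = 1..n - 2. sin (\<theta> i) ^ (n - 1 - i))"
  proof (intro AE_I2 prod_nonneg ballI zero_le_power)
    fix \<theta> i assume \<theta>: "\<theta> \<in> space ?P" and i: "i \<in> {1..n - 2}"
    then have "\<theta> i \<in> angle_range n i" by (auto simp: space_PiM PiE_iff space_restrict_space)
    then show "0 \<le> sin (\<theta> i)" using i by (auto simp: angle_range_def intro!: sin_ge_zero)
  qed
  have int: "integrable (restrict_space lborel (angle_range n i)) (\<lambda>x. sin x ^ (n - 1 - i) * f i x)" if "i \<in> {1..n - 1}" for i
    unfolding angle_range_eq by (intro integrable_restrict_Ico continuous_intros f that)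
  have eq: "(\<lambda>\<theta>. (\<Prod>i = 1..n - 2. sin (\<theta> i) ^ (n - 1 - i)) * (\<Prod>i\<in>{1..n - 1}. f i (\<theta> i))) =
      (\<lambda>\<theta>. \<Prod>i\<in>{1..n - 1}. sin (\<theta> i) ^ (n - 1 - i) * f i (\<theta> i))"
    unfolding w prod.distrib ..
  show "integrable (angle_volume n) (\<lambda>\<theta>. \<Prod>i\<in>{1..n - 1}. f i (\<theta> i))"
    unfolding angle_volume_def
    by (subst integrable_real_density[OF angle_density_measurable nn m], subst eq, rule ar.product_integrable_prod[OF _ int]) auto
  have "(LINT \<theta>|angle_volume n. (\<Prod>i\<in>{1..n - 1}. f i (\<theta> i))) =
     (LINT \<theta>|?P. (\<Prod>i\<in>{1..n - 1}. sin (\<theta> i) ^ (n - 1 - i) * f i (\<theta> i)))"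
    unfolding angle_volume_def by (subst integral_real_density[OF angle_density_measurable nn m]) (simp only: eq)
  also have "\<dots> = (\<Prod>i\<in>{1..n - 1}. LINT x|restrict_space lborel (angle_range n i). sin x ^ (n - 1 - i) * f i x)"
    by (rule ar.product_integral_prod[OF _ int]) auto
  finally show "(LINT \<theta>|angle_volume n. (\<Prod>i\<in>{1..n - 1}. f i (\<theta> i))) = (\<Prod>i\<in>{1..n - 1}. sin_weighted (angle_end n i) (n - 1 - i) (f i))"
    by (simp add: sin_weighted_def angle_range_eq)
qed

lemma angle_volume_total:
  "emeasure (angle_volume n) (space (angle_volume n)) = ennreal (\<Prod>i\<in>{1..n - 1}. sin_weighted (angle_end n i) (n - 1 - i) (\<lambda>_. 1))"
proof -
  have i: "integrable (angle_volume n) (\<lambda>_. 1 :: real)" using angle_volume_integral(1)[of "\<lambda>_ _. 1"] by simp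
  have "emeasure (angle_volume n) (space (angle_volume n)) = (\<integral>\<^sup>+\<theta>. ennreal 1 \<partial>angle_volume n)" by simp
  also have "\<dots> = ennreal (LINT \<theta>|angle_volume n. 1)" by (rule nn_integral_eq_integral[OF i]) simp
  also have "(LINT \<theta>|angle_volume n. 1) = (\<Prod>i\<in>{1..n - 1}. sin_weighted (angle_end n i) (n - 1 - i) (\<lambda>_. 1))"
    using angle_volume_integral(2)[of "\<lambda>_ _. 1"] by simp
  finally show ?thesis .
qed

lemma sets_angle_law: "sets (angle_law n) = sets (\<Pi>\<^sub>M i\<in>{1..n - 1}. restrict_space lborel (angle_range n i))"
  by (simp add: angle_law_def angle_volume_def)

text \<open>A constant density in place of \<open>scale_measure\<close> makes the rules for
  integrals under densities applicable.\<close>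

lemma angle_law_eq_density:
  "angle_law n = density (angle_volume n) (\<lambda>_. ennreal (1 / (\<Prod>i\<in>{1..n - 1}. sin_weighted (angle_end n i) (n - 1 - i) (\<lambda>_. 1))))"
proof (rule measure_eqI)
  have p: "0 < (\<Prod>i\<in>{1..n - 1}. sin_weighted (angle_end n i) (n - 1 - i) (\<lambda>_. 1))"
    by (intro prod_pos ballI angle_weight_pos)
  fix A assume "A \<in> sets (angle_law n)"
  then show "emeasure (angle_law n) A = emeasure (density (angle_volume n) (\<lambda>_. ennreal (1 / (\<Prod>i\<in>{1..n - 1}. sin_weighted (angle_end n i) (n - 1 - i) (\<lambda>_. 1))))) A"
    unfolding angle_law_def angle_volume_total
    using p by (simp add: emeasure_density nn_integral_cmult ennreal_1[symmetric] divide_ennreal del: ennreal_1)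
qed (simp add: angle_law_def)

lemma prob_space_angle_law: "prob_space (angle_law n)"
proof
  have p: "0 < (\<Prod>i\<in>{1..n - 1}. sin_weighted (angle_end n i) (n - 1 - i) (\<lambda>_. 1))"
    by (intro prod_pos ballI angle_weight_pos)
  have inv: "1 / ennreal S * ennreal S = 1" if "0 < S" for S :: real
    using that divide_ennreal[of 1 S] by (simp add: ennreal_mult'[symmetric])
  show "emeasure (angle_law n) (space (angle_law n)) = 1"
    using p inv by (simp only: angle_law_def emeasure_scale_measure space_scale_measure angle_volume_total)
qed

lemma angle_law_integral:
  assumes f: "\<And>i. i \<in> {1..n - 1} \<Longrightarrow> continuous_on UNIV (f i)"
  shows "(LINT \<theta>|angle_law n. (\<Prod>i\<in>{1..n - 1}. f i (\<theta> i))) = (\<Prod>i\<in>{1..n - 1}. angle_mean n i (f i))"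
proof -
  have p: "0 < (\<Prod>i\<in>{1..n - 1}. sin_weighted (angle_end n i) (n - 1 - i) (\<lambda>_. 1))"
    by (intro prod_pos ballI angle_weight_pos)
  have "(LINT \<theta>|angle_law n. (\<Prod>i\<in>{1..n - 1}. f i (\<theta> i))) =
     (LINT \<theta>|angle_volume n. 1 / (\<Prod>i\<in>{1..n - 1}. sin_weighted (angle_end n i) (n - 1 - i) (\<lambda>_. 1)) * (\<Prod>i\<in>{1..n - 1}. f i (\<theta> i)))"
    unfolding angle_law_eq_density using p angle_volume_integral(1)[OF f]
    by (subst integral_real_density) auto
  also have "\<dots> = (\<Prod>i\<in>{1..n - 1}. angle_mean n i (f i))"
    using angle_volume_integral(2)[OF f] by (simp add: angle_mean_def prod_dividef)
  finally show ?thesis .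
qed

text \<open>One factor of the product has mean 0: the cosine of angle m, or for \<open>m = n\<close>
  the sine of the last angle.\<close>

lemma prod_angle_factor_mean:
  assumes m: "m \<in> {1..n}"
  shows "(LINT \<theta>|angle_law n. (\<Prod>i\<in>{1..n - 1}. angle_factor m i (\<theta> i))) = 0"
proof -
  have "(\<Prod>i\<in>{1..n - 1}. angle_mean n i (angle_factor m i)) = 0"
  proof (rule prod_zero)
    show "\<exists>a\<in>{1..n - 1}. angle_mean n a (angle_factor m a) = 0"
    proof (cases "m = n")
      case True
      have "angle_factor m (n - 1) = sin" using True n by (auto simp: angle_factor_def)
      then show ?thesis using angle_means(4)[of "n - 1"] n by (intro bexI[of _ "n - 1"]) auto
    next
      case False
      have "angle_factor m m = cos" by (auto simp: angle_factor_def)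
      then show ?thesis using angle_means(2)[of m] m False by (intro bexI[of _ m]) auto
    qed
  qed simp
  then show ?thesis by (subst angle_law_integral[OF angle_factor_continuous])
qed

text \<open>For different coordinates the angle numbered by the smaller one contributes
  \<open>sin x * cos x\<close>, of mean 0. On the diagonal the squared sines give a telescoping
  product of \<open>(n - i) / (n - i + 1)\<close>, and the squared cosine, if there is one,
  completes it to \<open>1 / n\<close>.\<close>

lemma prod_angle_factor_covariance:
  assumes m: "m \<in> {1..n}" and l: "l \<in> {1..n}"
  shows "(LINT \<theta>|angle_law n. (\<Prod>i\<in>{1..n - 1}. angle_factor m i (\<theta> i)) * (\<Prod>i\<in>{1..n - 1}. angle_factor l i (\<theta> i))) =
    (if m = l then 1 / n else 0)"
proof -
  have I: "(LINT \<theta>|angle_law n. (\<Prod>i\<in>{1..n - 1}. angle_factor m i (\<theta> i)) * (\<Prod>i\<in>{1..n - 1}. angle_factor l i (\<theta> i))) =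
    (\<Prod>i\<in>{1..n - 1}. angle_mean n i (\<lambda>x. angle_factor m i x * angle_factor l i x))"
    unfolding prod.distrib[symmetric]
    by (rule angle_law_integral) (intro continuous_on_mult angle_factor_continuous)
  have lt: "(\<Prod>i\<in>{1..n - 1}. angle_mean n i (\<lambda>x. angle_factor m i x * angle_factor l i x)) = 0"
    if "m < l" "m \<in> {1..n}" "l \<in> {1..n}" for m l
  proof (rule prod_zero)
    have "(\<lambda>x. angle_factor m m x * angle_factor l m x) = (\<lambda>x. sin x * cos x)"
      using that by (auto simp: angle_factor_def)
    then show "\<exists>a\<in>{1..n - 1}. angle_mean n a (\<lambda>x. angle_factor m a x * angle_factor l a x) = 0"
      using that angle_means(3)[of m] by (intro bexI[of _ m]) auto
  qed simp
  show ?thesis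
  proof (cases "m = l")
    case False
    then consider "m < l" | "l < m" by linarith
    then show ?thesis using lt[of m l] lt[of l m] m l False unfolding I by cases (auto simp: mult.commute)
  next
    case True
    have tel: "k \<le> n \<Longrightarrow> (\<Prod>i\<in>{1..<Suc k}. (real n - real i) / (real n - real i + 1)) = (real n - real k) / real n" for k
    proof (induction k)
      case (Suc k)
      have nk: "real n - real k > 0" using Suc.prems by simp
      have "(\<Prod>i\<in>{1..<Suc (Suc k)}. (real n - real i) / (real n - real i + 1)) =
          (\<Prod>i\<in>{1..<Suc k}. (real n - real i) / (real n - real i + 1)) * ((real n - real (Suc k)) / (real n - real (Suc k) + 1))"
        by (rule prod.atLeastLessThan_Suc) simp
      also have "\<dots> = (real n - real k) / real n * ((real n - real (Suc k)) / (real n - real k))"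
        using Suc by simp
      also have "\<dots> = (real n - real (Suc k)) / real n" using nk by simp
      finally show ?case .
    qed (use n in simp)
    have s: "angle_mean n i (\<lambda>x. angle_factor m i x * angle_factor m i x) =
       (if i < m then (real n - real i) / (real n - real i + 1) else if i = m then 1 / (real n - real i + 1) else 1)"
      if "i \<in> {1..n - 1}" for i
      using angle_means[OF that] by (auto simp: angle_factor_def power2_eq_square[symmetric])
    have pre: "(\<Prod>i\<in>{1..<m}. (real n - real i) / (real n - real i + 1)) = (real n - real m + 1) / real n"
    proof -
      obtain k where "m = Suc k" using m by (cases m) auto
      then show ?thesis using tel[of k] m by simp
    qed
    have "(\<Prod>i\<in>{1..n - 1}. angle_mean n i (\<lambda>x. angle_factor m i x * angle_factor m i x)) =
      (\<Prod>i\<in>{1..n - 1}. if i < m then (real n - real i) / (real n - real i + 1) else if i = m then 1 / (real n - real i + 1) else 1)"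
      by (rule prod.cong[OF refl s])
    also have "\<dots> = 1 / n"
    proof (cases "m = n")
      case True
      have "{1..n - 1} = {1..<m}" using True n by auto
      then show ?thesis using pre True by simp
    next
      case False
      then have m': "m \<in> {1..n - 1}" using m by auto
      have "(\<Prod>i\<in>{1..n - 1}. if i < m then (real n - real i) / (real n - real i + 1) else if i = m then 1 / (real n - real i + 1) else 1) =
        (\<Prod>i\<in>{1..<m}. (real n - real i) / (real n - real i + 1)) * (1 / (real n - real m + 1))"
        unfolding prod_split_at[OF m'] by simp
      also have "\<dots> = 1 / n" using pre m by (simp add: field_simps)
      finally show ?thesis .
    qed
    finally show ?thesis unfolding I using True by simp
  qed
qed

end

section \<open>Moments of the direction vector\<close>

lemma coord_number_bounds: "coord_number (i :: 'n::{finite,linorder}) \<in> {1..CARD('n)}"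
proof -
  have "0 < card {j. j \<le> i}" by (subst card_gt_0_iff) auto
  then show ?thesis by (auto simp: coord_number_def intro!: card_mono)
qed

lemma inj_coord_number: "inj (coord_number :: 'n::{finite,linorder} \<Rightarrow> nat)"
proof (rule linorder_injI)
  fix i j :: 'n assume "i < j"
  then have "{k. k \<le> i} \<subset> {k. k \<le> j}" by (auto simp: psubset_eq intro: order_trans dest!: equalityD2 subsetD[of "{k. k \<le> j}" _ j])
  then have "card {k. k \<le> i} < card {k. k \<le> j}" by (intro psubset_card_mono) auto
  then show "coord_number i \<noteq> coord_number j" by (simp add: coord_number_def)
qed

text \<open>The last coordinate consists of sines only; this agrees with
  \<open>angle_factor\<close>, where no angle index reaches \<open>m = n\<close>.\<close>

lemma direction_eq_prod:
  "(direction \<theta> :: real ^ 'n::{finite,linorder}) $ i = (\<Prod>j\<in>{1..CARD('n) - 1}. angle_factor (coord_number i) j (\<theta> j))"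
proof -
  let ?m = "coord_number i"
  have m: "?m \<in> {1..CARD('n)}" by (rule coord_number_bounds)
  show ?thesis
  proof (cases "?m < CARD('n)")
    case True
    then have m': "?m \<in> {1..CARD('n) - 1}" using m by auto
    show ?thesis unfolding prod_split_at[OF m'] using True by (simp add: direction_def angle_factor_def)
  next
    case False
    then have "{1..CARD('n) - 1} = {1..<?m}" using m by auto
    then show ?thesis using False by (simp add: direction_def angle_factor_def)
  qed
qed

lemma direction_component_bound: "\<bar>(direction \<theta> :: real ^ 'n::{finite,linorder}) $ i\<bar> \<le> 1"
  unfolding direction_eq_prod abs_prod
  by (intro prod_le_1 conjI) (auto simp: angle_factor_def)

lemma direction_norm_bound: "norm (direction \<theta> :: real ^ 'n::{finite,linorder}) \<le> CARD('n)"
proof -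
  let ?d = "direction \<theta> :: real ^ 'n::{finite,linorder}"
  have "norm ?d \<le> (\<Sum>i\<in>UNIV. \<bar>?d $ i\<bar>)" by (rule norm_le_l1_cart)
  also have "\<dots> \<le> (\<Sum>i\<in>(UNIV :: 'n set). 1)" by (intro sum_mono direction_component_bound)
  finally show ?thesis by simp
qed

lemma direction_measurable:
  assumes "2 \<le> CARD('n::{finite,linorder})"
  shows "(direction :: _ \<Rightarrow> real ^ 'n::{finite,linorder}) \<in> borel_measurable (angle_law CARD('n::{finite,linorder}))"
proof -
  have "(\<lambda>\<theta>. \<Prod>j\<in>{1..CARD('n) - 1}. angle_factor m j (\<theta> j)) \<in> borel_measurable (angle_law CARD('n))" for m
    unfolding measurable_cong_sets[OF sets_angle_law[OF assms] refl]
  proof (intro borel_measurable_prod)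
    fix j assume j: "j \<in> {1..CARD('n) - 1}"
    have "angle_factor m j \<in> borel_measurable (restrict_space lborel (angle_range CARD('n) j))"
      using borel_measurable_continuous_onI[OF angle_factor_continuous[of m j]] by (intro measurable_restrict_space1) simp
    then show "(\<lambda>\<theta>. angle_factor m j (\<theta> j)) \<in> borel_measurable (\<Pi>\<^sub>M i\<in>{1..CARD('n) - 1}. restrict_space lborel (angle_range CARD('n) i))"
      by (rule measurable_compose[OF measurable_component_singleton, rotated]) (use j in auto)
  qed
  then have "(\<lambda>\<theta>. (direction \<theta> :: real ^ 'n::{finite,linorder}) $ i) \<in> borel_measurable (angle_law CARD('n))" for i
    unfolding direction_eq_prod .
  then show ?thesis by (subst borel_measurable_euclidean_space) (auto simp: Basis_vec_def inner_axis)
qed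

lemma direction_mean:
  assumes "2 \<le> CARD('n::{finite,linorder})"
  shows "(LINT \<theta>|angle_law CARD('n::{finite,linorder}). (direction \<theta> :: real ^ 'n::{finite,linorder}) $ i) = 0"
  unfolding direction_eq_prod by (rule prod_angle_factor_mean[OF assms coord_number_bounds])

lemma direction_covariance:
  assumes "2 \<le> CARD('n::{finite,linorder})"
  shows "(LINT \<theta>|angle_law CARD('n::{finite,linorder}). (direction \<theta> :: real ^ 'n::{finite,linorder}) $ i * (direction \<theta> :: real ^ 'n::{finite,linorder}) $ j) = (if i = j then 1 / CARD('n::{finite,linorder}) else 0)"
  unfolding direction_eq_prod
  using prod_angle_factor_covariance[OF assms coord_number_bounds coord_number_bounds, of i j]
    by (simp add: inj_coord_number[THEN inj_eq])

section \<open>Sums of independent centred variables\<close>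

lemma abs_power_le_fourth:
  fixes x :: real
  assumes "k \<le> 4" shows "\<bar>x ^ k\<bar> \<le> 1 + x ^ 4"
proof (cases "\<bar>x\<bar> \<le> 1")
  case True
  then have "\<bar>x\<bar> ^ k \<le> 1" by (simp add: power_le_one)
  moreover have "0 \<le> x ^ 4" by simp
  ultimately show ?thesis unfolding power_abs by linarith
next
  case False
  then have "\<bar>x\<bar> ^ k \<le> \<bar>x\<bar> ^ 4" using assms by (intro power_increasing) auto
  then show ?thesis by (simp add: power_abs)
qed

lemma fourth_power_add_le: "(x + y) ^ 4 \<le> 8 * (x ^ 4 + y ^ 4)" for x y :: real
proof -
  have sq: "(a + b)\<^sup>2 \<le> 2 * (a\<^sup>2 + b\<^sup>2)" for a b :: real
    using zero_le_power2[of "a - b"] by (simp add: power2_diff power2_sum)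
  have "(x + y) ^ 4 = ((x + y)\<^sup>2)\<^sup>2" by (simp flip: power_mult)
  also have "\<dots> \<le> (2 * (x\<^sup>2 + y\<^sup>2))\<^sup>2" by (intro power_mono sq) simp
  also have "\<dots> = 4 * (x\<^sup>2 + y\<^sup>2)\<^sup>2" by (simp only: power_mult_distrib) simp
  also have "\<dots> \<le> 4 * (2 * ((x\<^sup>2)\<^sup>2 + (y\<^sup>2)\<^sup>2))" by (intro mult_left_mono sq) simp
  also have "\<dots> = 8 * (x ^ 4 + y ^ 4)" by (simp flip: power_mult)
  finally show ?thesis .
qed

text \<open>Tangent-line inequality for the convex function \<open>x^4\<close>; the difference is
  \<open>y^2\<close> times a sum of squares. In the maximal inequality the term linear in y has mean
  0.\<close>

lemma fourth_power_add_ge: "x ^ 4 + 4 * (x ^ 3 * y) \<le> (x + y) ^ 4" for x y :: real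
proof -
  have "(x + y) ^ 4 - (x ^ 4 + 4 * (x ^ 3 * y)) = y\<^sup>2 * ((2 * x + y)\<^sup>2 + 2 * x\<^sup>2)"
    by (simp add: power2_eq_square power3_eq_cube power4_eq_xxxx algebra_simps)
  moreover have "0 \<le> y\<^sup>2 * ((2 * x + y)\<^sup>2 + 2 * x\<^sup>2)" by (intro mult_nonneg_nonneg add_nonneg_nonneg) auto
  ultimately show ?thesis by linarith
qed

context prob_space
begin

lemma integrable_power_le_fourth:
  fixes X :: "'a \<Rightarrow> real"
  assumes [measurable]: "X \<in> borel_measurable M" and "integrable M (\<lambda>\<omega>. X \<omega> ^ 4)" "k \<le> 4"
  shows "integrable M (\<lambda>\<omega>. X \<omega> ^ k)"
proof (rule Bochner_Integration.integrable_bound[where f = "\<lambda>\<omega>. 1 + X \<omega> ^ 4"])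
  show "AE \<omega> in M. norm (X \<omega> ^ k) \<le> norm (1 + X \<omega> ^ 4)"
    using abs_power_le_fourth[OF assms(3)] by (auto intro!: AE_I2)
qed (use assms in auto)

text \<open>The first factor is an arbitrary function of a whole group of variables, so it may
  contain the indicator of an event determined by them.\<close>

lemma indep_vars_expectation_product:
  fixes D :: "nat \<Rightarrow> 'a \<Rightarrow> real" and f :: "(nat \<Rightarrow> real) \<Rightarrow> real" and g :: "real \<Rightarrow> real"
  assumes ind: "indep_vars (\<lambda>_. borel) D UNIV" and j: "j \<notin> A"
    and f: "f \<in> borel_measurable (PiM A (\<lambda>_. borel))" and g: "g \<in> borel_measurable borel"
    and i: "integrable M (\<lambda>\<omega>. f (\<lambda>i\<in>A. D i \<omega>))" "integrable M (\<lambda>\<omega>. g (D j \<omega>))"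
  shows "integrable M (\<lambda>\<omega>. f (\<lambda>i\<in>A. D i \<omega>) * g (D j \<omega>))"
    and "expectation (\<lambda>\<omega>. f (\<lambda>i\<in>A. D i \<omega>) * g (D j \<omega>)) = expectation (\<lambda>\<omega>. f (\<lambda>i\<in>A. D i \<omega>)) * expectation (\<lambda>\<omega>. g (D j \<omega>))"
proof -
  have "indep_var (PiM A (\<lambda>_. borel)) (\<lambda>\<omega>. \<lambda>i\<in>A. D i \<omega>) (PiM {j} (\<lambda>_. borel)) (\<lambda>\<omega>. \<lambda>i\<in>{j}. D i \<omega>)"
    by (rule indep_var_restrict[OF ind]) (use j in auto)
  then have "indep_var borel (f \<circ> (\<lambda>\<omega>. \<lambda>i\<in>A. D i \<omega>)) borel ((\<lambda>x. g (x j)) \<circ> (\<lambda>\<omega>. \<lambda>i\<in>{j}. D i \<omega>))"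
    by (rule indep_var_compose[OF _ f]) (intro measurable_compose[OF _ g] measurable_component_singleton, simp)
  then have iv: "indep_var borel (\<lambda>\<omega>. f (\<lambda>i\<in>A. D i \<omega>)) borel (\<lambda>\<omega>. g (D j \<omega>))"
    by (simp add: comp_def)
  show "integrable M (\<lambda>\<omega>. f (\<lambda>i\<in>A. D i \<omega>) * g (D j \<omega>))" by (rule indep_var_integrable[OF iv i])
  show "expectation (\<lambda>\<omega>. f (\<lambda>i\<in>A. D i \<omega>) * g (D j \<omega>)) = expectation (\<lambda>\<omega>. f (\<lambda>i\<in>A. D i \<omega>)) * expectation (\<lambda>\<omega>. g (D j \<omega>))"
    by (rule indep_var_lebesgue_integral[OF iv i])
qed

section \<open>Moments and a maximal inequality for partial sums\<close>

context
  fixes D :: "nat \<Rightarrow> 'a \<Rightarrow> real" and u v :: real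
  assumes ind: "indep_vars (\<lambda>_. borel) D UNIV" and i4: "\<And>k. integrable M (\<lambda>\<omega>. D k \<omega> ^ 4)"
    and m1: "\<And>k. expectation (D k) = 0" and m2: "\<And>k. expectation (\<lambda>\<omega>. (D k \<omega>)\<^sup>2) \<le> v"
    and m4: "\<And>k. expectation (\<lambda>\<omega>. D k \<omega> ^ 4) \<le> u"
begin

lemma indep_rv: "D k \<in> borel_measurable M"
  using ind by (auto simp: indep_vars_def2)

lemma partial_sum_rv: "(\<lambda>\<omega>. \<Sum>i\<in>A. D i \<omega>) \<in> borel_measurable M"
  by (intro borel_measurable_sum indep_rv)

lemma summand_power_integrable: "k \<le> 4 \<Longrightarrow> integrable M (\<lambda>\<omega>. D j \<omega> ^ k)"
  by (rule integrable_power_le_fourth[OF indep_rv i4])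

lemma partial_sum_fourth_integrable: "integrable M (\<lambda>\<omega>. (\<Sum>i\<in>{p..<p + N}. D i \<omega>) ^ 4)"
proof (induction N)
  case (Suc N)
  show ?case
  proof (rule Bochner_Integration.integrable_bound[where f = "\<lambda>\<omega>. 8 * ((\<Sum>i\<in>{p..<p + N}. D i \<omega>) ^ 4 + D (p + N) \<omega> ^ 4)"])
    show "AE \<omega> in M. norm ((\<Sum>i\<in>{p..<p + Suc N}. D i \<omega>) ^ 4) \<le> norm (8 * ((\<Sum>i\<in>{p..<p + N}. D i \<omega>) ^ 4 + D (p + N) \<omega> ^ 4))"
      using fourth_power_add_le[of "\<Sum>i\<in>{p..<p + N}. D i _" "D (p + N) _"] by (intro AE_I2) (simp add: abs_of_nonneg)
    show "(\<lambda>\<omega>. (\<Sum>i\<in>{p..<p + Suc N}. D i \<omega>) ^ 4) \<in> borel_measurable M"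
      by (rule borel_measurable_power[OF partial_sum_rv])
  qed (use Suc i4 in simp)
qed simp

lemma partial_sum_power_integrable: "k \<le> 4 \<Longrightarrow> integrable M (\<lambda>\<omega>. (\<Sum>i\<in>{p..<p + N}. D i \<omega>) ^ k)"
  by (rule integrable_power_le_fourth[OF partial_sum_rv partial_sum_fourth_integrable])

lemma partial_sum_product:
  assumes "a \<le> 4" "b \<le> 4"
  shows "integrable M (\<lambda>\<omega>. (\<Sum>i\<in>{p..<p + N}. D i \<omega>) ^ a * D (p + N) \<omega> ^ b)"
    and "expectation (\<lambda>\<omega>. (\<Sum>i\<in>{p..<p + N}. D i \<omega>) ^ a * D (p + N) \<omega> ^ b) =
      expectation (\<lambda>\<omega>. (\<Sum>i\<in>{p..<p + N}. D i \<omega>) ^ a) * expectation (\<lambda>\<omega>. D (p + N) \<omega> ^ b)"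
proof -
  have f: "(\<lambda>x. (\<Sum>i\<in>{p..<p + N}. x i) ^ a) \<in> borel_measurable (PiM {p..<p + N} (\<lambda>_. borel :: real measure))"
    by measurable
  note * = indep_vars_expectation_product[OF ind _ f, of "p + N" "\<lambda>x. x ^ b", simplified]
  show "integrable M (\<lambda>\<omega>. (\<Sum>i\<in>{p..<p + N}. D i \<omega>) ^ a * D (p + N) \<omega> ^ b)"
    "expectation (\<lambda>\<omega>. (\<Sum>i\<in>{p..<p + N}. D i \<omega>) ^ a * D (p + N) \<omega> ^ b) =
      expectation (\<lambda>\<omega>. (\<Sum>i\<in>{p..<p + N}. D i \<omega>) ^ a) * expectation (\<lambda>\<omega>. D (p + N) \<omega> ^ b)"
    using *[OF partial_sum_power_integrable[OF assms(1)] summand_power_integrable[OF assms(2)]] by simp_all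
qed

lemma partial_sum_mean: "expectation (\<lambda>\<omega>. \<Sum>i\<in>{p..<p + N}. D i \<omega>) = 0"
  using summand_power_integrable[of 1] m1 by (subst Bochner_Integration.integral_sum) auto

lemma v_nonneg: "0 \<le> v"
  by (rule order_trans[OF _ m2[of 0]]) (auto intro: integral_nonneg)

lemma partial_sum_second_moment: "expectation (\<lambda>\<omega>. (\<Sum>i\<in>{p..<p + N}. D i \<omega>)\<^sup>2) \<le> N * v"
proof (induction N)
  case (Suc N)
  let ?R = "\<lambda>\<omega>. \<Sum>i\<in>{p..<p + N}. D i \<omega>" and ?D = "D (p + N)"
  have "expectation (\<lambda>\<omega>. (\<Sum>i\<in>{p..<p + Suc N}. D i \<omega>)\<^sup>2) =
      expectation (\<lambda>\<omega>. ?R \<omega> ^ 2 + 2 * (?R \<omega> ^ 1 * ?D \<omega> ^ 1) + ?D \<omega> ^ 2)"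
    by (simp add: power2_sum ac_simps)
  also have "\<dots> = expectation (\<lambda>\<omega>. ?R \<omega> ^ 2) + 2 * expectation (\<lambda>\<omega>. ?R \<omega> ^ 1 * ?D \<omega> ^ 1) + expectation (\<lambda>\<omega>. ?D \<omega> ^ 2)"
    using partial_sum_power_integrable[of 2 p N] summand_power_integrable[of 2 "p + N"] partial_sum_product(1)[of 1 1 p N] by simp
  also have "expectation (\<lambda>\<omega>. ?R \<omega> ^ 1 * ?D \<omega> ^ 1) = 0"
    by (subst partial_sum_product(2)) (simp_all add: m1)
  finally show ?case using Suc m2[of "p + N"] by (simp add: algebra_simps)
qed simp

text \<open>With R the old sum and D the new summand, the terms in \<open>R^3 D\<close> and
  \<open>R D^3\<close> vanish since both are centred. What remains grows by at most
  \<open>u + 6 N v^2\<close> per step, and \<open>6 N\<close> is at most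
  \<open>3 ((N + 1)^2 - N^2)\<close>.\<close>

lemma partial_sum_fourth_moment: "expectation (\<lambda>\<omega>. (\<Sum>i\<in>{p..<p + N}. D i \<omega>) ^ 4) \<le> N * u + 3 * (real N * v)\<^sup>2"
proof (induction N)
  case (Suc N)
  let ?R = "\<lambda>\<omega>. \<Sum>i\<in>{p..<p + N}. D i \<omega>" and ?D = "D (p + N)"
  have "expectation (\<lambda>\<omega>. (\<Sum>i\<in>{p..<p + Suc N}. D i \<omega>) ^ 4) =
      expectation (\<lambda>\<omega>. ?R \<omega> ^ 4 + 4 * (?R \<omega> ^ 3 * ?D \<omega> ^ 1) + 6 * (?R \<omega> ^ 2 * ?D \<omega> ^ 2) + 4 * (?R \<omega> ^ 1 * ?D \<omega> ^ 3) + ?D \<omega> ^ 4)"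
    by (simp add: power2_eq_square power3_eq_cube power4_eq_xxxx algebra_simps)
  also have "\<dots> = expectation (\<lambda>\<omega>. ?R \<omega> ^ 4) + 4 * expectation (\<lambda>\<omega>. ?R \<omega> ^ 3 * ?D \<omega> ^ 1) +
      6 * expectation (\<lambda>\<omega>. ?R \<omega> ^ 2 * ?D \<omega> ^ 2) + 4 * expectation (\<lambda>\<omega>. ?R \<omega> ^ 1 * ?D \<omega> ^ 3) + expectation (\<lambda>\<omega>. ?D \<omega> ^ 4)"
    using partial_sum_power_integrable[of 4 p N] summand_power_integrable[of 4 "p + N"] partial_sum_product(1)[of 3 1 p N]
      partial_sum_product(1)[of 2 2 p N] partial_sum_product(1)[of 1 3 p N] by simp
  also have "expectation (\<lambda>\<omega>. ?R \<omega> ^ 3 * ?D \<omega> ^ 1) = 0"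
    by (subst partial_sum_product(2)) (simp_all add: m1)
  also have "expectation (\<lambda>\<omega>. ?R \<omega> ^ 1 * ?D \<omega> ^ 3) = 0"
    by (subst partial_sum_product(2)) (simp_all add: partial_sum_mean)
  also have "expectation (\<lambda>\<omega>. ?R \<omega> ^ 2 * ?D \<omega> ^ 2) \<le> (N * v) * v"
    unfolding partial_sum_product(2)[of 2 2, simplified]
    by (intro mult_mono partial_sum_second_moment m2 v_nonneg mult_nonneg_nonneg integral_nonneg, auto simp: v_nonneg)
  finally show ?case using Suc m4[of "p + N"] v_nonneg
    by (simp add: power2_eq_square algebra_simps) (smt (verit) mult_nonneg_nonneg of_nat_0_le_iff)
qed simp

text \<open>With \<open>A\<close> the event that the bound has been exceeded by time \<open>N\<close>, convexity of the fourth power and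
  independence give \<open>E 1\<^sub>A R\<^sub>N\<^sup>4 \<le> E 1\<^sub>A R\<^sub>N\<^sub>+\<^sub>1\<^sup>4\<close>, so no stopping time is needed.\<close>

lemma partial_sum_maximal:
  assumes d: "0 < d"
  shows "d ^ 4 * prob {\<omega> \<in> space M. \<exists>k\<le>N. d \<le> \<bar>\<Sum>i\<in>{p..<p + k}. D i \<omega>\<bar>} \<le>
    expectation (\<lambda>\<omega>. (\<Sum>i\<in>{p..<p + N}. D i \<omega>) ^ 4)"
proof -
  define R where "R k \<omega> = (\<Sum>i\<in>{p..<p + k}. D i \<omega>)" for k \<omega>
  define A where "A N = {\<omega> \<in> space M. \<exists>k\<le>N. d \<le> \<bar>R k \<omega>\<bar>}" for N
  have Rm[measurable]: "R k \<in> borel_measurable M" for k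
    unfolding R_def[abs_def] by (rule partial_sum_rv)
  have R4: "integrable M (\<lambda>\<omega>. R k \<omega> ^ 4)" for k unfolding R_def by (rule partial_sum_fourth_integrable)
  have R3: "integrable M (\<lambda>\<omega>. R k \<omega> ^ 3)" for k unfolding R_def by (rule partial_sum_power_integrable) simp
  have Am[measurable]: "A k \<in> sets M" for k unfolding A_def by measurable
  have I: "integrable M (\<lambda>\<omega>. indicator (A j) \<omega> * R k \<omega> ^ 4)" for j k
    by (rule integrable_real_mult_indicator[OF Am R4, unfolded mult.commute[of _ "indicator _ _"]])
  have main: "d ^ 4 * prob (A N) \<le> expectation (\<lambda>\<omega>. indicator (A N) \<omega> * R N \<omega> ^ 4)"
  proof (induction N)
    case 0
    have "A 0 = {}" using d by (auto simp: A_def R_def)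
    then show ?case by simp
  next
    case (Suc N)
    let ?D = "D (p + N)"
    have step: "R (Suc N) \<omega> = R N \<omega> + ?D \<omega>" for \<omega> by (simp add: R_def)
    \<comment> \<open>A function of the variables before \<open>p + N\<close> alone, hence
      independent of \<open>D (p + N)\<close>; it represents the indicator of \<open>A N\<close>
      times \<open>R N \<omega> ^ 3\<close>.\<close>
    define f where "f x = indicator {x. \<exists>k\<le>N. d \<le> \<bar>\<Sum>i\<in>{p..<p + k}. x i\<bar>} x * (\<Sum>i\<in>{p..<p + N}. x i) ^ 3" for x :: "nat \<Rightarrow> real"
    have f: "f \<in> borel_measurable (PiM {p..<p + N} (\<lambda>_. borel))"
    proof -
      have *: "(\<lambda>x. \<Sum>i\<in>{p..<p + k}. x i) \<in> borel_measurable (PiM {p..<p + N} (\<lambda>_. borel :: real measure))" if "k \<le> N" for k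
        using that by (intro borel_measurable_sum measurable_component_singleton) auto
      have "Measurable.pred (PiM {p..<p + N} (\<lambda>_. borel :: real measure)) (\<lambda>x. \<exists>k\<in>{..N}. d \<le> \<bar>\<Sum>i\<in>{p..<p + k}. x i\<bar>)"
        using * by (intro pred_intros_finite(4) borel_measurable_le) auto
      then have "Measurable.pred (PiM {p..<p + N} (\<lambda>_. borel :: real measure)) (\<lambda>x. \<exists>k\<le>N. d \<le> \<bar>\<Sum>i\<in>{p..<p + k}. x i\<bar>)"
        by (simp add: Bex_def)
      then show ?thesis
        unfolding f_def[abs_def] using *[of N]
        by (intro borel_measurable_times borel_measurable_power borel_measurable_indicator') (auto simp: pred_def)
    qed
    have fe: "f (\<lambda>i\<in>{p..<p + N}. D i \<omega>) = indicator (A N) \<omega> * R N \<omega> ^ 3" if "\<omega> \<in> space M" for \<omega>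
    proof -
      have "(\<Sum>i\<in>{p..<p + k}. (\<lambda>i\<in>{p..<p + N}. D i \<omega>) i) = R k \<omega>" if "k \<le> N" for k
        unfolding R_def using that by (intro sum.cong) auto
      then show ?thesis using that unfolding f_def A_def by (auto simp: indicator_def)
    qed
    have I3: "integrable M (\<lambda>\<omega>. indicator (A N) \<omega> * R N \<omega> ^ 3)"
      by (rule integrable_real_mult_indicator[OF Am R3, unfolded mult.commute[of _ "indicator _ _"]])
    have I3f: "integrable M (\<lambda>\<omega>. f (\<lambda>i\<in>{p..<p + N}. D i \<omega>))"
      using I3 by (simp add: fe cong: Bochner_Integration.integrable_cong)
    have cross: "integrable M (\<lambda>\<omega>. indicator (A N) \<omega> * R N \<omega> ^ 3 * ?D \<omega>)"
      "expectation (\<lambda>\<omega>. indicator (A N) \<omega> * R N \<omega> ^ 3 * ?D \<omega>) = 0"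
      using indep_vars_expectation_product[OF ind _ f, of "p + N" "\<lambda>x. x"] I3f summand_power_integrable[of 1 "p + N"] m1
      by (simp_all add: fe cong: Bochner_Integration.integrable_cong Bochner_Integration.integral_cong)
    have sub: "A N \<subseteq> A (Suc N)" unfolding A_def using le_SucI by blast
    \<comment> \<open>The event gains only outcomes at which level d is reached at
      \<open>Suc N\<close>, and there the fourth power of the sum is at least
      \<open>d ^ 4\<close>.\<close>
    have "d ^ 4 * prob (A (Suc N)) = d ^ 4 * prob (A N) + d ^ 4 * prob (A (Suc N) - A N)"
      using sub by (subst finite_measure_Diff) (auto simp: algebra_simps)
    also have "d ^ 4 * prob (A (Suc N) - A N) = expectation (\<lambda>\<omega>. d ^ 4 * indicator (A (Suc N) - A N) \<omega>)"
      by (simp add: emeasure_eq_measure)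
    also have "\<dots> \<le> expectation (\<lambda>\<omega>. indicator (A (Suc N)) \<omega> * R (Suc N) \<omega> ^ 4 - indicator (A N) \<omega> * R (Suc N) \<omega> ^ 4)"
    proof (rule integral_mono)
      show "integrable M (\<lambda>\<omega>. d ^ 4 * indicator (A (Suc N) - A N) \<omega>)"
        by (intro integrable_mult_right integrable_real_indicator) (auto simp: emeasure_eq_measure)
      fix \<omega>
      show "d ^ 4 * indicator (A (Suc N) - A N) \<omega> \<le> indicator (A (Suc N)) \<omega> * R (Suc N) \<omega> ^ 4 - indicator (A N) \<omega> * R (Suc N) \<omega> ^ 4"
      proof (cases "\<omega> \<in> A (Suc N) - A N")
        case True
        then have "d \<le> \<bar>R (Suc N) \<omega>\<bar>" by (auto simp: A_def le_Suc_eq)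
        then have "d ^ 4 \<le> \<bar>R (Suc N) \<omega>\<bar> ^ 4" using d by (intro power_mono) auto
        then show ?thesis using True by (simp add: power_abs)
      next
        case False
        then show ?thesis using sub by (auto simp: indicator_def)
      qed
    qed (intro Bochner_Integration.integrable_diff I)
    also have "\<dots> = expectation (\<lambda>\<omega>. indicator (A (Suc N)) \<omega> * R (Suc N) \<omega> ^ 4) - expectation (\<lambda>\<omega>. indicator (A N) \<omega> * R (Suc N) \<omega> ^ 4)"
      by (intro Bochner_Integration.integral_diff I)
    finally have 1: "d ^ 4 * prob (A (Suc N)) \<le> d ^ 4 * prob (A N) + (expectation (\<lambda>\<omega>. indicator (A (Suc N)) \<omega> * R (Suc N) \<omega> ^ 4) -
      expectation (\<lambda>\<omega>. indicator (A N) \<omega> * R (Suc N) \<omega> ^ 4))" by simp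
    \<comment> \<open>The added cross term has mean 0 by independence; with it the tangent-line
      inequality applies pointwise.\<close>
    have "expectation (\<lambda>\<omega>. indicator (A N) \<omega> * R N \<omega> ^ 4) =
       expectation (\<lambda>\<omega>. indicator (A N) \<omega> * R N \<omega> ^ 4 + 4 * (indicator (A N) \<omega> * R N \<omega> ^ 3 * ?D \<omega>))"
      using cross I by simp
    also have "\<dots> \<le> expectation (\<lambda>\<omega>. indicator (A N) \<omega> * R (Suc N) \<omega> ^ 4)"
    proof (rule integral_mono)
      fix \<omega>
      show "indicator (A N) \<omega> * R N \<omega> ^ 4 + 4 * (indicator (A N) \<omega> * R N \<omega> ^ 3 * ?D \<omega>) \<le> indicator (A N) \<omega> * R (Suc N) \<omega> ^ 4"
        using fourth_power_add_ge[of "R N \<omega>" "?D \<omega>"] by (auto simp: indicator_def step)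
    qed (intro Bochner_Integration.integrable_add integrable_mult_right I cross)+
    finally show ?case using 1 Suc by linarith
  qed
  also have "\<dots> \<le> expectation (\<lambda>\<omega>. R N \<omega> ^ 4)"
    by (rule integral_mono[OF I R4]) (auto simp: indicator_def)
  finally show ?thesis unfolding A_def R_def .
qed

lemma partial_sum_tail:
  assumes d: "0 < d"
  shows "prob {\<omega> \<in> space M. \<exists>k\<le>N. d \<le> \<bar>\<Sum>i\<in>{p..<p + k}. D i \<omega>\<bar>} \<le> (N * u + 3 * (real N * v)\<^sup>2) / d ^ 4"
  using order_trans[OF partial_sum_maximal[OF d] partial_sum_fourth_moment] d
  by (simp add: pos_le_divide_eq mult.commute)

end

text \<open>The Taylor expansion to second order costs the third absolute moment, and replacing
  \<open>1 - s / 2\<close> by the exponential costs \<open>s^2\<close>.\<close>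

lemma centered_iexp_approx:
  fixes Y :: "'a \<Rightarrow> real"
  assumes Y[measurable]: "Y \<in> borel_measurable M" and i: "integrable M (\<lambda>\<omega>. Y \<omega> ^ 4)"
    and m1: "expectation Y = 0" and m2: "expectation (\<lambda>\<omega>. (Y \<omega>)\<^sup>2) = s" and m3: "expectation (\<lambda>\<omega>. \<bar>Y \<omega>\<bar> ^ 3) \<le> \<rho>"
  shows "cmod ((CLINT \<omega>|M. iexp (Y \<omega>)) - of_real (exp (- s / 2))) \<le> \<rho> + s\<^sup>2"
proof -
  have i1: "integrable M Y" and i2: "integrable M (\<lambda>\<omega>. (Y \<omega>)\<^sup>2)" and i3: "integrable M (\<lambda>\<omega>. Y \<omega> ^ 3)"
    using integrable_power_le_fourth[OF Y i, of 1] integrable_power_le_fourth[OF Y i, of 2] integrable_power_le_fourth[OF Y i, of 3] by simp_all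
  have i3': "integrable M (\<lambda>\<omega>. \<bar>Y \<omega>\<bar> ^ 3)" using integrable_abs[OF i3] by (simp add: power_abs)
  have s: "0 \<le> s" using m2 by (auto intro: integral_nonneg)
  let ?q = "\<lambda>\<omega>. 1 + \<i> * of_real (Y \<omega>) - of_real ((Y \<omega>)\<^sup>2 / 2)"
  have ie: "integrable M (\<lambda>\<omega>. iexp (Y \<omega>))" by (rule integrable_const_bound[where B = 1]) auto
  have iq: "integrable M ?q"
    by (intro Bochner_Integration.integrable_diff Bochner_Integration.integrable_add integrable_mult_right
        integrable_of_real integrable_divide_zero i1 i2) auto
  have eq: "(CLINT \<omega>|M. ?q \<omega>) = of_real (1 - s / 2)"
    using i1 i2 m1 m2 by (simp add: prob_space integrable_of_real integral_complex_of_real flip: of_real_divide of_real_power)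
  have b: "cmod (iexp (Y \<omega>) - ?q \<omega>) \<le> \<bar>Y \<omega>\<bar> ^ 3" for \<omega>
  proof -
    have "(\<Sum>k\<le>2. (\<i> * of_real (Y \<omega>)) ^ k / fact k) = ?q \<omega>"
      by (simp add: numeral_2_eq_2 power2_eq_square complex_eq_iff)
    then have "cmod (iexp (Y \<omega>) - ?q \<omega>) \<le> \<bar>Y \<omega>\<bar> ^ 3 / 6"
      using iexp_approx1[of "Y \<omega>" 2] by (simp add: fact_numeral)
    moreover have "0 \<le> \<bar>Y \<omega>\<bar> ^ 3" by simp
    ultimately show ?thesis by linarith
  qed
  have "cmod ((CLINT \<omega>|M. iexp (Y \<omega>)) - of_real (1 - s / 2)) = cmod (CLINT \<omega>|M. iexp (Y \<omega>) - ?q \<omega>)"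
    using ie iq by (simp only: eq Bochner_Integration.integral_diff)
  also have "\<dots> \<le> expectation (\<lambda>\<omega>. cmod (iexp (Y \<omega>) - ?q \<omega>))" by (rule integral_norm_bound)
  also have "\<dots> \<le> expectation (\<lambda>\<omega>. \<bar>Y \<omega>\<bar> ^ 3)"
    by (rule integral_mono) (use ie iq i3' b in auto)
  also have "\<dots> \<le> \<rho>" by (rule m3)
  finally have 1: "cmod ((CLINT \<omega>|M. iexp (Y \<omega>)) - of_real (1 - s / 2)) \<le> \<rho>" .
  \<comment> \<open>Both bounds come from \<open>1 + u \<le> exp u\<close>, at
    \<open>u = - s / 2\<close> and, through the reciprocal, at \<open>u = s / 2\<close>.\<close>
  have "\<bar>1 - s / 2 - exp (- s / 2)\<bar> \<le> s\<^sup>2"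
  proof -
    have "1 - s / 2 \<le> exp (- s / 2)" using exp_ge_add_one_self[of "- s / 2"] by simp
    moreover have "exp (- s / 2) \<le> 1 / (1 + s / 2)"
      using exp_ge_add_one_self[of "s / 2"] s by (simp add: exp_minus divide_simps)
    moreover have "1 / (1 + s / 2) \<le> 1 - s / 2 + s\<^sup>2"
    proof -
      have "(1 - s / 2 + s\<^sup>2) * (1 + s / 2) = 1 + (3 / 4) * s\<^sup>2 + s ^ 3 / 2"
        by (simp add: power2_eq_square power3_eq_cube algebra_simps)
      then show ?thesis using s by (simp add: divide_le_eq)
    qed
    ultimately show ?thesis by simp
  qed
  then have 2: "cmod (of_real (1 - s / 2) - of_real (exp (- s / 2))) \<le> s\<^sup>2"
    by (simp only: of_real_diff[symmetric] norm_of_real)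
  show ?thesis using norm_triangle_ineq[of "(CLINT \<omega>|M. iexp (Y \<omega>)) - of_real (1 - s / 2)" "of_real (1 - s / 2) - of_real (exp (- s / 2))"] 1 2
    by simp
qed

text \<open>Independence gives a product, and for factors of modulus at most 1 the difference of two
  products is at most the sum of the differences. The moments may depend on k because the test
  vector will change from block to block.\<close>

lemma indep_sum_iexp_approx:
  fixes Y :: "nat \<Rightarrow> 'a \<Rightarrow> real"
  assumes ind: "indep_vars (\<lambda>_. borel) Y UNIV" and i4: "\<And>k. integrable M (\<lambda>\<omega>. Y k \<omega> ^ 4)"
    and m1: "\<And>k. expectation (Y k) = 0" and m2: "\<And>k. expectation (\<lambda>\<omega>. (Y k \<omega>)\<^sup>2) = s k"
    and m3: "\<And>k. expectation (\<lambda>\<omega>. \<bar>Y k \<omega>\<bar> ^ 3) \<le> \<rho> k"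
  shows "cmod ((CLINT \<omega>|M. iexp (\<Sum>k<N. Y k \<omega>)) - of_real (exp (- (\<Sum>k<N. s k) / 2))) \<le> (\<Sum>k<N. \<rho> k + (s k)\<^sup>2)"
proof (cases "N = 0")
  case True then show ?thesis by (simp add: prob_space)
next
  case False
  have rv[measurable]: "Y k \<in> borel_measurable M" for k using ind by (auto simp: indep_vars_def2)
  have s: "0 \<le> s k" for k unfolding m2[symmetric] by (auto intro: integral_nonneg)
  have "(CLINT \<omega>|M. iexp (\<Sum>k<N. Y k \<omega>)) = (CLINT \<omega>|M. (\<Prod>k<N. iexp (Y k \<omega>)))"
    by (simp add: exp_sum sum_distrib_left)
  also have "\<dots> = (\<Prod>k<N. CLINT \<omega>|M. iexp (Y k \<omega>))"
  proof (rule indep_vars_lebesgue_integral)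
    have "indep_vars (\<lambda>_. borel) (\<lambda>k. (\<lambda>x. iexp x) \<circ> Y k) {..<N}"
      by (rule indep_vars_compose[OF indep_vars_subset[OF ind]]) auto
    then show "indep_vars (\<lambda>_. borel) (\<lambda>k \<omega>. iexp (Y k \<omega>)) {..<N}" by (simp add: comp_def)
    show "integrable M (\<lambda>\<omega>. iexp (Y k \<omega>))" for k by (rule integrable_const_bound[where B = 1]) auto
  qed simp
  finally have 1: "(CLINT \<omega>|M. iexp (\<Sum>k<N. Y k \<omega>)) = (\<Prod>k<N. CLINT \<omega>|M. iexp (Y k \<omega>))" .
  have 2: "of_real (exp (- (\<Sum>k<N. s k) / 2)) = (\<Prod>k<N. complex_of_real (exp (- s k / 2)))"
    by (simp add: exp_sum[symmetric] sum_negf sum_divide_distrib flip: of_real_prod)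
  show ?thesis
    unfolding 1 2
  proof (rule order_trans[OF norm_prod_diff sum_mono])
    fix k
    have "cmod (CLINT \<omega>|M. iexp (Y k \<omega>)) \<le> expectation (\<lambda>\<omega>. cmod (iexp (Y k \<omega>)))" by (rule integral_norm_bound)
    then show "cmod (CLINT \<omega>|M. iexp (Y k \<omega>)) \<le> 1" by (simp add: prob_space)
    show "cmod (of_real (exp (- s k / 2))) \<le> 1" using s[of k] by simp
    show "cmod ((CLINT \<omega>|M. iexp (Y k \<omega>)) - of_real (exp (- s k / 2))) \<le> \<rho> k + (s k)\<^sup>2"
      by (rule centered_iexp_approx[OF rv i4 m1 m2 m3])
  qed
qed

end

section \<open>Paths with jumps of the velocity\<close>

text \<open>Serves to drop the index 0, at which the initial direction has an arbitrary law.\<close>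

lemma (in prob_space) indep_vars_Suc:
  assumes "indep_vars M' X UNIV"
  shows "indep_vars (\<lambda>k. M' (Suc k)) (\<lambda>k. X (Suc k)) UNIV"
proof -
  have rv: "random_variable (M' i) (X i)" for i using assms by (simp add: indep_vars_def2)
  have ind: "indep_sets (\<lambda>i. {X i -` A \<inter> space M | A. A \<in> sets (M' i)}) UNIV"
    using assms by (simp add: indep_vars_def2)
  have "indep_sets (\<lambda>i. {X (Suc i) -` A \<inter> space M | A. A \<in> sets (M' (Suc i))}) UNIV"
  proof (rule indep_setsI)
    fix i show "{X (Suc i) -` A \<inter> space M | A. A \<in> sets (M' (Suc i))} \<subseteq> events"
      using rv by (auto intro: measurable_sets)
  next
    fix A J assume J: "J \<noteq> {}" "finite J" and A: "\<forall>j\<in>J. A j \<in> {X (Suc j) -` A \<inter> space M | A. A \<in> sets (M' (Suc j))}"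
    have "prob (\<Inter>j\<in>Suc ` J. A (j - 1)) = (\<Prod>j\<in>Suc ` J. prob (A (j - 1)))"
      by (rule indep_setsD[OF ind]) (use J A in auto)
    then show "prob (\<Inter>j\<in>J. A j) = (\<Prod>j\<in>J. prob (A j))"
      by (simp add: prod.reindex)
  qed
  then show ?thesis using rv by (simp add: indep_vars_def2)
qed

text \<open>At a time in \<open>[j / m, (j + 1) / m]\<close> the jump index lies between \<open>b (j - 1)\<close> and \<open>b (j + 2)\<close>, so
  the path differs from the vertex \<open>j\<close> by the oscillation over three blocks and the first step.\<close>

lemma path_near_polygon:
  fixes X :: "real \<Rightarrow> 'b::real_normed_vector" and S :: "nat \<Rightarrow> real" and b :: "nat \<Rightarrow> nat"
  assumes m: "0 < m" and S0: "S 0 = 0" and S: "\<And>k. S k < S (Suc k)"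
    and seg: "\<And>k t. S k \<le> t \<Longrightarrow> t \<le> S (Suc k) \<Longrightarrow> norm (X t - X (S k)) \<le> norm (X (S (Suc k)) - X (S k))"
    and b: "mono b" "b 0 = 0"
    and time: "\<And>j. j \<le> m * (K + 3) \<Longrightarrow> \<bar>S (Suc (b j)) - real j / m\<bar> < 1 / m"
    and osc: "\<And>j k. j < m * (K + 3) \<Longrightarrow> b j \<le> k \<Longrightarrow> k \<le> b (Suc j) \<Longrightarrow> norm (X (S (Suc k)) - X (S (Suc (b j)))) \<le> \<delta>"
    and start: "norm (X (S 1) - X 0) \<le> \<delta>" and t: "t \<in> {0..<real K}"
  shows "dist (X t) (polygon m (m * K) (\<lambda>j. X 0 + (X (S (Suc (b j))) - X (S 1))) t) \<le> 14 * \<delta>"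
proof -
  let ?y = "\<lambda>j. X 0 + (X (S (Suc (b j))) - X (S 1))"
  have \<delta>: "0 \<le> \<delta>" using start norm_ge_zero order_trans by blast
  have Smono: "strict_mono S" using S by (rule strict_monoI_Suc)
  \<comment> \<open>The vertices up to \<open>j + 2\<close> must be covered by \<open>time\<close>
    and \<open>osc\<close>. Raising the horizon from K to \<open>K + 3\<close> leaves room for three
    further mesh points, whatever m is.\<close>
  have K3: "j + 3 \<le> m * (K + 3)" if "j < m * K" for j
  proof -
    have "m * (K + 3) = m * K + 3 * m" by (simp add: algebra_simps)
    then show ?thesis using that m by linarith
  qed
  \<comment> \<open>The 7 is 4 + 2 + 1: the segment containing the time has both ends within 2
    \<delta> of a reference point, so its length is at most 4 \<delta>; 2 \<delta> lead from its
    left end to that point, and \<delta> is for the first step.\<close>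
  have "dist (X t) (polygon m (m * K) ?y t) \<le> 2 * (7 * \<delta>)"
  proof (rule polygon_near_path[OF m _ _ t])
    fix j assume j: "j < m * K"
    have "norm (X (S (Suc (b (Suc j)))) - X (S (Suc (b j)))) \<le> \<delta>"
      by (rule osc) (use K3[OF j] monoD[OF b(1)] in auto)
    then show "dist (?y (Suc j)) (?y j) \<le> 7 * \<delta>" using \<delta> by (simp add: dist_norm)
  next
    fix j s assume j: "j < m * K" and s: "real j / m \<le> s" "s \<le> (real j + 1) / m"
    have s0: "0 \<le> s" using s(1) by (rule order_trans[rotated]) simp
    have "S (Suc (b (j + 2))) > real (j + 2) / m - 1 / m"
      using time[of "j + 2"] K3[OF j] by linarith
    also have "real (j + 2) / m - 1 / m = (real j + 1) / m" by (simp add: diff_divide_distrib[symmetric])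
    finally have up: "s < S (Suc (b (j + 2)))" using s(2) by linarith
    \<comment> \<open>Index of the holding interval that contains s.\<close>
    define k where "k = (LEAST k. s < S (Suc k))"
    have k1: "s < S (Suc k)" unfolding k_def by (rule LeastI[of "\<lambda>k. s < S (Suc k)", OF up])
    have k2: "S k \<le> s"
    proof (cases k)
      case 0 then show ?thesis using S0 s0 by simp
    next
      case (Suc i)
      then have "\<not> s < S (Suc i)" unfolding k_def by (metis lessI not_less_Least)
      then show ?thesis using Suc by simp
    qed
    have kb: "k \<le> b (j + 2)"
    proof -
      have "S k < S (Suc (b (j + 2)))" using k2 up by linarith
      then show ?thesis using Smono by (simp add: strict_mono_less)
    qed
    have seg': "norm (X s - X (S k)) \<le> norm (X (S (Suc k)) - X (S k))"
      by (rule seg) (use k1 k2 in auto)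
    show "dist (X s) (?y j) \<le> 7 * \<delta>"
    \<comment> \<open>Vertex 0 has no preceding block. Here the reference point is the position at
      the first jump, which may even come after s.\<close>
    proof (cases "j = 0")
      case True
      have r: "norm (X (S (Suc i)) - X (S 1)) \<le> 2 * \<delta>" if "i \<le> b 2" for i
      proof (cases "i \<le> b 1")
        case True
        then show ?thesis using osc[of 0 i] b(2) m \<delta> by simp
      next
        case False
        have "norm (X (S (Suc (b 1))) - X (S 1)) \<le> \<delta>" using osc[of 0 "b 1"] b(2) m by simp
        moreover have "norm (X (S (Suc i)) - X (S (Suc (b 1)))) \<le> \<delta>"
          by (rule osc) (use False that K3[OF j] in \<open>auto simp: numeral_2_eq_2\<close>)
        ultimately show ?thesis using norm_triangle_ineq[of "X (S (Suc i)) - X (S (Suc (b 1)))" "X (S (Suc (b 1))) - X (S 1)"] by simp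
      qed
      have y: "?y j = X 0" using True b(2) by simp
      show ?thesis
      proof (cases k)
        case 0
        then show ?thesis using seg' S0 start \<delta> unfolding y by (simp add: dist_norm)
      next
        case (Suc i)
        have "norm (X (S k) - X (S 1)) \<le> 2 * \<delta>" "norm (X (S (Suc k)) - X (S 1)) \<le> 2 * \<delta>"
          using r[of i] r[of k] kb Suc True by (auto simp: numeral_2_eq_2)
        then have "norm (X s - X 0) \<le> (2 * \<delta> + 2 * \<delta>) + 2 * \<delta> + \<delta>"
          using seg' start norm_triangle_ineq4[of "X (S (Suc k)) - X (S 1)" "X (S k) - X (S 1)"]
            norm_triangle_ineq[of "X s - X (S k)" "X (S k) - X (S 1)"] norm_triangle_ineq[of "X s - X (S 1)" "X (S 1) - X 0"]
          by simp
        then show ?thesis unfolding y by (simp add: dist_norm)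
      qed
    next
      case False
      then obtain i where i: "j = Suc i" by (cases j) auto
      have "S (Suc (b i)) < real i / m + 1 / m" using time[of i] K3[OF j] i by linarith
      also have "real i / m + 1 / m = real j / m" using i by (simp add: add_divide_distrib)
      finally have "S (Suc (b i)) < S (Suc k)" using s(1) k1 by linarith
      then have ki: "b i < k" using Smono by (simp add: strict_mono_less)
      have r: "norm (X (S (Suc p)) - X (S (Suc (b j)))) \<le> 2 * \<delta>" if "b i \<le> p" "p \<le> b (j + 2)" for p
      proof -
        consider "p \<le> b j" | "b j \<le> p" "p \<le> b (Suc j)" | "b (Suc j) \<le> p" by linarith
        then show ?thesis
        proof cases
          case 1
          have "norm (X (S (Suc p)) - X (S (Suc (b i)))) \<le> \<delta>" "norm (X (S (Suc (b j))) - X (S (Suc (b i)))) \<le> \<delta>"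
            by (rule osc; use 1 that(1) K3[OF j] i monoD[OF b(1), of i j] in auto)+
          then show ?thesis using norm_triangle_ineq4[of "X (S (Suc p)) - X (S (Suc (b i)))" "X (S (Suc (b j))) - X (S (Suc (b i)))"] by simp
        next
          case 2
          then have "norm (X (S (Suc p)) - X (S (Suc (b j)))) \<le> \<delta>" by (intro osc) (use K3[OF j] in auto)
          then show ?thesis using \<delta> by simp
        next
          case 3
          have "norm (X (S (Suc p)) - X (S (Suc (b (Suc j))))) \<le> \<delta>"
            by (rule osc) (use 3 that(2) K3[OF j] in auto)
          moreover have "norm (X (S (Suc (b (Suc j)))) - X (S (Suc (b j)))) \<le> \<delta>"
            by (rule osc) (use K3[OF j] monoD[OF b(1), of j "Suc j"] in auto)
          ultimately show ?thesis using norm_triangle_ineq[of "X (S (Suc p)) - X (S (Suc (b (Suc j))))" "X (S (Suc (b (Suc j)))) - X (S (Suc (b j)))"] by simp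
        qed
      qed
      obtain q where q: "k = Suc q" using ki by (cases k) auto
      have "norm (X (S k) - X (S (Suc (b j)))) \<le> 2 * \<delta>" "norm (X (S (Suc k)) - X (S (Suc (b j)))) \<le> 2 * \<delta>"
        using r[of q] r[of k] q ki kb by auto
      then have "norm (X s - X (S (Suc (b j)))) \<le> (2 * \<delta> + 2 * \<delta>) + 2 * \<delta>"
        using seg' norm_triangle_ineq4[of "X (S (Suc k)) - X (S (Suc (b j)))" "X (S k) - X (S (Suc (b j)))"]
          norm_triangle_ineq[of "X s - X (S k)" "X (S k) - X (S (Suc (b j)))"]
        by simp
      moreover have "X s - ?y j = (X s - X (S (Suc (b j)))) + (X (S 1) - X 0)" by simp
      then have "dist (X s) (?y j) \<le> norm (X s - X (S (Suc (b j)))) + norm (X (S 1) - X 0)"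
        unfolding dist_norm by (metis norm_triangle_ineq)
      ultimately show ?thesis using start by linarith
    qed
  qed
  then show ?thesis by simp
qed

text \<open>Positive holding times make the jump times strictly increasing, so the jumps up to t are
  those of index 1 to k. The interval is closed on the left: at a jump time the new value is already
  taken.\<close>

lemma jump_count_eq:
  assumes T: "\<And>k. 0 < T k" and t: "(\<Sum>i<k. T i) \<le> t" "t < (\<Sum>i<Suc k. T i)"
  shows "jump_count T t = k"
proof -
  have S: "strict_mono (\<lambda>k. \<Sum>i<k. T i)" by (rule strict_monoI_Suc) (simp add: T)
  have "{j. 1 \<le> j \<and> (\<Sum>i<j. T i) \<le> t} = {1..k}"
  proof safe
    fix j assume j: "1 \<le> j" "(\<Sum>i<j. T i) \<le> t"
    then have "(\<Sum>i<j. T i) < (\<Sum>i<Suc k. T i)" using t by linarith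
    then show "j \<in> {1..k}" using strict_mono_less[OF S, of j "Suc k"] j by simp
  next
    fix j assume "j \<in> {1..k}"
    then have "(\<Sum>i<j. T i) \<le> (\<Sum>i<k. T i)" using strict_mono_less_eq[OF S, of j k] by simp
    then show "(\<Sum>i<j. T i) \<le> t" using t by linarith
  qed auto
  then show ?thesis by (simp add: jump_count_def)
qed

lemma jump_count_measurable:
  assumes [measurable]: "\<And>k. T k \<in> borel_measurable M" "f \<in> borel_measurable M"
  shows "(\<lambda>x. jump_count (\<lambda>k. T k x) (f x)) \<in> M \<rightarrow>\<^sub>M count_space UNIV"
  unfolding jump_count_def by measurable

locale switching = prob_space M for M :: "'a measure" +
  fixes n :: nat and l :: real and Z :: "nat \<Rightarrow> 'a \<Rightarrow> nat \<Rightarrow> real" and T :: "nat \<Rightarrow> 'a \<Rightarrow> real"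
  assumes l: "0 < l"
    and Z_indep: "indep_vars (\<lambda>_. angle_law n) Z UNIV"
    and T_indep: "indep_vars (\<lambda>_. borel) T UNIV"
    and ZT_indep: "indep_set
          (sets (vimage_algebra (space M) (\<lambda>\<omega> k. Z k \<omega>) (\<Pi>\<^sub>M k\<in>UNIV. angle_law n)))
          (sets (vimage_algebra (space M) (\<lambda>\<omega> k. T k \<omega>) (\<Pi>\<^sub>M k\<in>UNIV. borel)))"
    and Z_law: "\<And>k. 1 \<le> k \<Longrightarrow> distr M (angle_law n) (Z k) = angle_law n"
    and T_law: "\<And>k. distributed M lborel (T k) (exponential_density l)"
begin

lemma Z_rv[measurable]: "Z k \<in> M \<rightarrow>\<^sub>M angle_law n"
  using Z_indep by (simp add: indep_vars_def2)

lemma T_rv[measurable]: "T k \<in> borel_measurable M"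
  using T_indep by (simp add: indep_vars_def2)

text \<open>Joins three independence hypotheses: the one between the two sequences and the one
  within each of them.\<close>

lemma Z_T_event_product:
  assumes "finite J" "\<And>j. j \<in> J \<Longrightarrow> A j \<in> sets (angle_law n)" "\<And>j. j \<in> J \<Longrightarrow> B j \<in> sets borel" "J \<noteq> {}"
  shows "prob (\<Inter>j\<in>J. (Z j -` A j \<inter> space M) \<inter> (T j -` B j \<inter> space M)) =
    (\<Prod>j\<in>J. prob (Z j -` A j \<inter> space M) * prob (T j -` B j \<inter> space M))"
proof -
  have Zs: "(\<Inter>j\<in>J. Z j -` A j \<inter> space M) \<in> sets (vimage_algebra (space M) (\<lambda>\<omega> k. Z k \<omega>) (\<Pi>\<^sub>M k\<in>UNIV. angle_law n))"
  proof -
    let ?P = "\<Pi>\<^sub>M k\<in>(UNIV :: nat set). angle_law n"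
    have "{f \<in> space ?P. \<forall>j\<in>J. f j \<in> A j} \<in> sets ?P"
      by (rule sets.sets_Collect_finite_All') (use assms in \<open>auto intro!: measurable_sets_Collect[OF measurable_component_singleton]\<close>)
    then have "(\<lambda>\<omega> k. Z k \<omega>) -` {f \<in> space ?P. \<forall>j\<in>J. f j \<in> A j} \<inter> space M \<in> sets (vimage_algebra (space M) (\<lambda>\<omega> k. Z k \<omega>) ?P)"
      by (rule in_vimage_algebra)
    also have "(\<lambda>\<omega> k. Z k \<omega>) -` {f \<in> space ?P. \<forall>j\<in>J. f j \<in> A j} \<inter> space M = (\<Inter>j\<in>J. Z j -` A j \<inter> space M)"
      using assms(4) measurable_space[OF Z_rv] by (auto simp: space_PiM)
    finally show ?thesis .
  qed
  have Ts: "(\<Inter>j\<in>J. T j -` B j \<inter> space M) \<in> sets (vimage_algebra (space M) (\<lambda>\<omega> k. T k \<omega>) (\<Pi>\<^sub>M k\<in>UNIV. borel))"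
  proof -
    let ?P = "\<Pi>\<^sub>M k\<in>(UNIV :: nat set). borel :: real measure"
    have "{f \<in> space ?P. \<forall>j\<in>J. f j \<in> B j} \<in> sets ?P"
      by (rule sets.sets_Collect_finite_All') (use assms in \<open>auto intro!: measurable_sets_Collect[OF measurable_component_singleton]\<close>)
    then have "(\<lambda>\<omega> k. T k \<omega>) -` {f \<in> space ?P. \<forall>j\<in>J. f j \<in> B j} \<inter> space M \<in> sets (vimage_algebra (space M) (\<lambda>\<omega> k. T k \<omega>) ?P)"
      by (rule in_vimage_algebra)
    also have "(\<lambda>\<omega> k. T k \<omega>) -` {f \<in> space ?P. \<forall>j\<in>J. f j \<in> B j} \<inter> space M = (\<Inter>j\<in>J. T j -` B j \<inter> space M)"
      using assms(4) by (auto simp: space_PiM)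
    finally show ?thesis .
  qed
  have "(\<Inter>j\<in>J. (Z j -` A j \<inter> space M) \<inter> (T j -` B j \<inter> space M)) =
      (\<Inter>j\<in>J. Z j -` A j \<inter> space M) \<inter> (\<Inter>j\<in>J. T j -` B j \<inter> space M)" by auto
  then have "prob (\<Inter>j\<in>J. (Z j -` A j \<inter> space M) \<inter> (T j -` B j \<inter> space M)) =
      prob (\<Inter>j\<in>J. Z j -` A j \<inter> space M) * prob (\<Inter>j\<in>J. T j -` B j \<inter> space M)"
    using indep_setD[OF ZT_indep Zs Ts] by simp
  also have "prob (\<Inter>j\<in>J. Z j -` A j \<inter> space M) = (\<Prod>j\<in>J. prob (Z j -` A j \<inter> space M))"
    using Z_indep unfolding indep_vars_def2
    by (intro indep_setsD[where I = UNIV and F = "\<lambda>i. {Z i -` A \<inter> space M |A. A \<in> sets (angle_law n)}"]) (use assms in auto)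
  also have "prob (\<Inter>j\<in>J. T j -` B j \<inter> space M) = (\<Prod>j\<in>J. prob (T j -` B j \<inter> space M))"
    using T_indep unfolding indep_vars_def2
    by (intro indep_setsD[where I = UNIV and F = "\<lambda>i. {T i -` A \<inter> space M |A. A \<in> sets borel}"]) (use assms in auto)
  finally show ?thesis by (simp add: prod.distrib)
qed

text \<open>Rectangles are stable under intersection and generate the product sigma-algebra, so
  independence on rectangles extends to the pairs.\<close>

lemma pair_indep: "indep_vars (\<lambda>_. angle_law n \<Otimes>\<^sub>M borel) (\<lambda>k \<omega>. (Z k \<omega>, T k \<omega>)) UNIV"
proof -
  define G where "G k = {(Z k -` A \<inter> space M) \<inter> (T k -` B \<inter> space M) | A B. A \<in> sets (angle_law n) \<and> B \<in> sets borel}" for k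
  have G: "indep_sets G UNIV"
  proof (rule indep_setsI)
    show "G k \<subseteq> events" for k unfolding G_def by (auto intro!: sets.Int measurable_sets)
    fix E J assume J: "J \<noteq> {}" "finite J" and E: "\<forall>j\<in>J. E j \<in> G j"
    then have "\<exists>A B. \<forall>j\<in>J. E j = (Z j -` A j \<inter> space M) \<inter> (T j -` B j \<inter> space M) \<and> A j \<in> sets (angle_law n) \<and> B j \<in> sets borel"
      unfolding G_def mem_Collect_eq by (simp add: bchoice_iff choice_iff)
    then obtain A B where AB: "\<And>j. j \<in> J \<Longrightarrow> E j = (Z j -` A j \<inter> space M) \<inter> (T j -` B j \<inter> space M)"
      "\<And>j. j \<in> J \<Longrightarrow> A j \<in> sets (angle_law n)" "\<And>j. j \<in> J \<Longrightarrow> B j \<in> sets borel" by auto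
    have one: "prob (E j) = prob (Z j -` A j \<inter> space M) * prob (T j -` B j \<inter> space M)" if "j \<in> J" for j
      using Z_T_event_product[of "{j}" A B] AB that by simp
    have "prob (\<Inter>j\<in>J. E j) = prob (\<Inter>j\<in>J. (Z j -` A j \<inter> space M) \<inter> (T j -` B j \<inter> space M))"
      using AB(1) by simp
    also have "\<dots> = (\<Prod>j\<in>J. prob (E j))"
      using Z_T_event_product[OF J(2) AB(2,3) J(1)] one by simp
    finally show "prob (\<Inter>j\<in>J. E j) = (\<Prod>j\<in>J. prob (E j))" .
  qed
  have st: "Int_stable (G k)" for k
    unfolding Int_stable_def
  proof (intro ballI)
    fix a b assume "a \<in> G k" "b \<in> G k"
    then obtain A B A' B' where "a = (Z k -` A \<inter> space M) \<inter> (T k -` B \<inter> space M)" "A \<in> sets (angle_law n)" "B \<in> sets borel"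
      "b = (Z k -` A' \<inter> space M) \<inter> (T k -` B' \<inter> space M)" "A' \<in> sets (angle_law n)" "B' \<in> sets borel"
      unfolding G_def by blast
    then show "a \<inter> b \<in> G k" unfolding G_def
      by (intro CollectI exI[of _ "A \<inter> A'"] exI[of _ "B \<inter> B'"]) auto
  qed
  have "indep_sets (\<lambda>k. {(\<lambda>\<omega>. (Z k \<omega>, T k \<omega>)) -` A \<inter> space M | A. A \<in> sets (angle_law n \<Otimes>\<^sub>M borel)}) UNIV"
  proof (rule indep_sets_mono_sets[OF indep_sets_sigma[OF G st]])
    fix k
    have "{(\<lambda>\<omega>. (Z k \<omega>, T k \<omega>)) -` A \<inter> space M | A. A \<in> sets (angle_law n \<Otimes>\<^sub>M borel)} =
      sigma_sets (space M) {(\<lambda>\<omega>. (Z k \<omega>, T k \<omega>)) -` A \<inter> space M | A. A \<in> {a \<times> b | a b. a \<in> sets (angle_law n) \<and> b \<in> sets (borel :: real measure)}}"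
      unfolding sets_pair_measure
      by (rule sigma_sets_vimage_commute) (use measurable_space[OF Z_rv] in auto)
    also have "{(\<lambda>\<omega>. (Z k \<omega>, T k \<omega>)) -` A \<inter> space M | A. A \<in> {a \<times> b | a b. a \<in> sets (angle_law n) \<and> b \<in> sets (borel :: real measure)}} \<subseteq> G k"
      unfolding G_def by fastforce
    then have "sigma_sets (space M) {(\<lambda>\<omega>. (Z k \<omega>, T k \<omega>)) -` A \<inter> space M | A. A \<in> {a \<times> b | a b. a \<in> sets (angle_law n) \<and> b \<in> sets (borel :: real measure)}}
        \<subseteq> sigma_sets (space M) (G k)" by (rule sigma_sets_mono')
    finally show "{(\<lambda>\<omega>. (Z k \<omega>, T k \<omega>)) -` A \<inter> space M | A. A \<in> sets (angle_law n \<Otimes>\<^sub>M borel)} \<subseteq> sigma_sets (space M) (G k)" .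
  qed
  then show ?thesis unfolding indep_vars_def2 by auto
qed

text \<open>Index 0 is excluded because \<open>Z 0\<close> need not have the law
  \<open>angle_law n\<close>.\<close>

lemma Z_T_expectation_product:
  fixes f :: "(nat \<Rightarrow> real) \<Rightarrow> real" and g :: "real \<Rightarrow> real"
  assumes k: "1 \<le> k" and f: "f \<in> borel_measurable (angle_law n)" "\<And>x. \<bar>f x\<bar> \<le> B"
    and g: "g \<in> borel_measurable borel" "integrable M (\<lambda>\<omega>. g (T k \<omega>))"
  shows "integrable M (\<lambda>\<omega>. f (Z k \<omega>) * g (T k \<omega>))"
    and "expectation (\<lambda>\<omega>. f (Z k \<omega>) * g (T k \<omega>)) = (LINT \<theta>|angle_law n. f \<theta>) * expectation (\<lambda>\<omega>. g (T k \<omega>))"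
proof -
  have fZ: "(\<lambda>\<omega>. f (Z k \<omega>)) \<in> borel_measurable M" and gT: "(\<lambda>\<omega>. g (T k \<omega>)) \<in> borel_measurable M"
    using measurable_compose[OF Z_rv f(1)] measurable_compose[OF T_rv g(1)] by auto
  have iv: "indep_var borel (\<lambda>\<omega>. f (Z k \<omega>)) borel (\<lambda>\<omega>. g (T k \<omega>))"
    unfolding indep_var_def indep_vars_def2
  proof (intro conjI ballI)
    show "random_variable (case_bool borel borel i) (case_bool (\<lambda>\<omega>. f (Z k \<omega>)) (\<lambda>\<omega>. g (T k \<omega>)) i)" for i
      using fZ gT by (cases i) auto
    have "indep_set {(\<lambda>\<omega>. f (Z k \<omega>)) -` A \<inter> space M |A. A \<in> sets borel} {(\<lambda>\<omega>. g (T k \<omega>)) -` A \<inter> space M |A. A \<in> sets borel}"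
    proof (rule indep_setI)
      fix a b assume "a \<in> {(\<lambda>\<omega>. f (Z k \<omega>)) -` A \<inter> space M |A. A \<in> sets borel}" "b \<in> {(\<lambda>\<omega>. g (T k \<omega>)) -` A \<inter> space M |A. A \<in> sets borel}"
      then obtain A B where A: "A \<in> sets borel" "a = (\<lambda>\<omega>. f (Z k \<omega>)) -` A \<inter> space M"
        and B: "B \<in> sets borel" "b = (\<lambda>\<omega>. g (T k \<omega>)) -` B \<inter> space M" by auto
      have a: "a = Z k -` (f -` A \<inter> space (angle_law n)) \<inter> space M"
        using A measurable_space[OF Z_rv] by auto
      have b: "b = T k -` (g -` B) \<inter> space M" using B by auto
      have "f -` A \<inter> space (angle_law n) \<in> sets (angle_law n)" "g -` B \<in> sets borel"
        using measurable_sets[OF f(1) A(1)] measurable_sets[OF g(1) B(1)] by auto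
      then show "prob (a \<inter> b) = prob a * prob b"
        using Z_T_event_product[of "{k}" "\<lambda>_. f -` A \<inter> space (angle_law n)" "\<lambda>_. g -` B"] unfolding a b by simp
    qed (use fZ gT in \<open>auto intro: measurable_sets\<close>)
    then show "indep_sets (\<lambda>i. {case_bool (\<lambda>\<omega>. f (Z k \<omega>)) (\<lambda>\<omega>. g (T k \<omega>)) i -` A \<inter> space M |A. A \<in> sets (case_bool borel borel i)}) UNIV"
      unfolding indep_set_def by (rule indep_sets_mono_sets) (auto split: bool.splits)
  qed
  have fi: "integrable M (\<lambda>\<omega>. f (Z k \<omega>))"
    by (rule integrable_const_bound[where B = B]) (use f measurable_compose[OF Z_rv f(1)] in auto)
  show "integrable M (\<lambda>\<omega>. f (Z k \<omega>) * g (T k \<omega>))" by (rule indep_var_integrable[OF iv fi g(2)])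
  have "(LINT \<theta>|angle_law n. f \<theta>) = (LINT \<theta>|distr M (angle_law n) (Z k). f \<theta>)" by (simp add: Z_law[OF k])
  also have "\<dots> = expectation (\<lambda>\<omega>. f (Z k \<omega>))" by (rule integral_distr[OF Z_rv f(1)])
  finally show "expectation (\<lambda>\<omega>. f (Z k \<omega>) * g (T k \<omega>)) = (LINT \<theta>|angle_law n. f \<theta>) * expectation (\<lambda>\<omega>. g (T k \<omega>))"
    using indep_var_lebesgue_integral[OF iv fi g(2)] by simp
qed

text \<open>An exponential variable is an Erlang variable with shape index 0.\<close>

lemma T_moment: "integrable M (\<lambda>\<omega>. T k \<omega> ^ i)" "expectation (\<lambda>\<omega>. T k \<omega> ^ i) = fact i / l ^ i"
  using erlang_ith_moment_integrable[OF l T_law] erlang_ith_moment[OF l T_law] by simp_all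

lemma T_pos: "AE \<omega> in M. \<forall>k. 0 < T k \<omega>"
proof (rule AE_all_countable[THEN iffD2, rule_format])
  fix k
  have "prob {\<omega> \<in> space M. 0 < T k \<omega>} = 1"
    using exponential_distributedD_gt[OF T_law order_refl l, of k] by simp
  then show "AE \<omega> in M. 0 < T k \<omega>"
    by (subst prob_Collect_eq_1[symmetric]) auto
qed

end

section \<open>Moments and path structure of the random evolution\<close>

locale evolution = switching M "CARD('n::{finite,linorder})" "1 / \<epsilon>\<^sup>2" Z T
  for M :: "'a measure" and \<epsilon> :: real and Z :: "nat \<Rightarrow> 'a \<Rightarrow> nat \<Rightarrow> real" and T :: "nat \<Rightarrow> 'a \<Rightarrow> real" +
  fixes x :: "real ^ 'n::{finite,linorder}" and c :: real
  assumes \<epsilon>: "0 < \<epsilon>" and n2: "2 \<le> CARD('n)"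
begin

definition speed :: "'a \<Rightarrow> real \<Rightarrow> (real, 'n) vec" where
  "speed \<omega> \<tau> = direction (Z (jump_count (\<lambda>k. T k \<omega>) \<tau>) \<omega>)"

definition position :: "real \<Rightarrow> 'a \<Rightarrow> (real, 'n) vec" where
  "position t \<omega> = x + (c / \<epsilon>) *\<^sub>R (LINT \<tau>:{0..t}|lborel. speed \<omega> \<tau>)"

definition jump_time :: "nat \<Rightarrow> 'a \<Rightarrow> real" where
  "jump_time k \<omega> = (\<Sum>i<k. T i \<omega>)"

definition displacement :: "nat \<Rightarrow> 'a \<Rightarrow> (real, 'n) vec" where
  "displacement k \<omega> = (c / \<epsilon> * T k \<omega>) *\<^sub>R direction (Z k \<omega>)"

text \<open>The initial direction \<open>Z 0\<close> has an arbitrary law, so the walk starts with the step of index \<open>1\<close>.\<close>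

definition increment :: "nat \<Rightarrow> 'a \<Rightarrow> (real, 'n) vec" where
  "increment k \<omega> = displacement (Suc k) \<omega>"

text \<open>Decomposes over the countably many values of the jump count. Joint measurability in time
  and chance is what makes the time integral a random variable.\<close>

lemma speed_measurable: "(\<lambda>(\<omega>, \<tau>). speed \<omega> \<tau>) \<in> borel_measurable (M \<Otimes>\<^sub>M lborel)"
proof -
  have d: "(\<lambda>p. direction (Z k (fst p)) :: (real, 'n) vec) \<in> borel_measurable (M \<Otimes>\<^sub>M lborel)" for k
    by (rule measurable_compose[OF measurable_compose[OF measurable_fst Z_rv] direction_measurable[OF n2]])
  have "(\<lambda>p. jump_count (\<lambda>k. T k (fst p)) (snd p)) \<in> M \<Otimes>\<^sub>M lborel \<rightarrow>\<^sub>M count_space UNIV"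
    by (rule jump_count_measurable[of "\<lambda>k p. T k (fst p)"]) auto
  from measurable_compose_countable[OF d this] show ?thesis
    by (simp add: speed_def split_beta')
qed

lemma speed_bound: "norm (speed \<omega> \<tau>) \<le> CARD('n)"
  unfolding speed_def by (rule direction_norm_bound)

lemma speed_integrable:
  assumes "\<omega> \<in> space M" and A: "A \<in> sets borel" "bounded A"
  shows "set_integrable lborel A (speed \<omega>)"
  unfolding set_integrable_def
proof (rule Bochner_Integration.integrable_bound[where f = "\<lambda>\<tau>. real CARD('n) * indicator A \<tau> :: real"])
  show "integrable lborel (\<lambda>\<tau>. real CARD('n) * indicator A \<tau> :: real)"
    using A emeasure_bounded_finite[OF A(2)] by (intro integrable_mult_right integrable_real_indicator) (auto simp: top.not_eq_extremum)
  have "speed \<omega> \<in> borel_measurable lborel"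
    using measurable_Pair2[OF speed_measurable assms(1)] by simp
  then show "(\<lambda>\<tau>. indicat_real A \<tau> *\<^sub>R speed \<omega> \<tau>) \<in> borel_measurable lborel" using A by simp
  show "AE \<tau> in lborel. norm (indicat_real A \<tau> *\<^sub>R speed \<omega> \<tau>) \<le> norm (real CARD('n) * indicator A \<tau> :: real)"
    using speed_bound by (auto simp: indicator_def)
qed

lemma position_measurable: "position t \<in> borel_measurable M"
proof -
  have "(\<lambda>\<omega>. LINT \<tau>|lborel. indicat_real {0..t} \<tau> *\<^sub>R speed \<omega> \<tau>) \<in> borel_measurable M"
    using speed_measurable by (intro lborel.borel_measurable_lebesgue_integral) (simp add: split_beta')
  then show ?thesis unfolding position_def[abs_def] set_lebesgue_integral_def by simp
qed

lemma position_diff: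
  assumes "\<omega> \<in> space M" "0 \<le> s" "s \<le> t"
  shows "position t \<omega> - position s \<omega> = (c / \<epsilon>) *\<^sub>R (LINT \<tau>:{s<..t}|lborel. speed \<omega> \<tau>)"
proof -
  have u: "{0..t} = {0..s} \<union> {s<..t}" using assms by auto
  have "(LINT \<tau>:{0..t}|lborel. speed \<omega> \<tau>) = (LINT \<tau>:{0..s}|lborel. speed \<omega> \<tau>) + (LINT \<tau>:{s<..t}|lborel. speed \<omega> \<tau>)"
    unfolding u by (rule set_integral_Un) (auto intro!: speed_integrable assms)
  then show ?thesis by (simp add: position_def scaleR_add_right)
qed

text \<open>The constant grows like \<open>1 / \<epsilon>\<close>, so this yields continuity of each
  path but no control uniform in \<epsilon>.\<close>

lemma position_lipschitz:
  assumes "\<omega> \<in> space M" "0 \<le> s" "s \<le> t"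
  shows "norm (position t \<omega> - position s \<omega>) \<le> \<bar>c / \<epsilon>\<bar> * (real CARD('n) * (t - s))"
proof -
  have "norm (LINT \<tau>:{s<..t}|lborel. speed \<omega> \<tau>) \<le> (LINT \<tau>|lborel. norm (indicat_real {s<..t} \<tau> *\<^sub>R speed \<omega> \<tau>))"
    unfolding set_lebesgue_integral_def by (rule integral_norm_bound)
  also have "\<dots> \<le> (LINT \<tau>|lborel. real CARD('n) * indicat_real {s<..t} \<tau>)"
  proof (rule integral_mono)
    show "integrable lborel (\<lambda>\<tau>. norm (indicat_real {s<..t} \<tau> *\<^sub>R speed \<omega> \<tau>))"
      using speed_integrable[OF assms(1), of "{s<..t}"] by (intro integrable_norm) (simp add: set_integrable_def)
    show "norm (indicat_real {s<..t} \<tau> *\<^sub>R speed \<omega> \<tau>) \<le> real CARD('n) * indicat_real {s<..t} \<tau>" for \<tau>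
      using speed_bound by (auto simp: indicator_def)
  qed (use assms in simp)
  also have "\<dots> = real CARD('n) * (t - s)" using assms by simp
  finally show ?thesis unfolding position_diff[OF assms] norm_scaleR by (intro mult_left_mono) auto
qed

lemma path_of_position: "\<omega> \<in> space M \<Longrightarrow> path_of position \<omega> \<in> cont_paths"
proof -
  assume w: "\<omega> \<in> space M"
  let ?L = "\<bar>c / \<epsilon>\<bar> * CARD('n)"
  have "lipschitz_on ?L {0..} (\<lambda>t. position t \<omega>)"
  proof (rule lipschitz_onI)
    fix s t :: real assume st: "s \<in> {0..}" "t \<in> {0..}"
    show "dist (position s \<omega>) (position t \<omega>) \<le> ?L * dist s t"
    proof (cases "s \<le> t")
      case True then show ?thesis using position_lipschitz[OF w _ True] st by (simp add: dist_norm norm_minus_commute mult.assoc abs_minus_commute)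
    next
      case False then show ?thesis using position_lipschitz[OF w _ less_imp_le[OF False[unfolded not_le]]] st by (simp add: dist_norm mult.assoc)
    qed
  qed simp
  then have "continuous_on {0..} (\<lambda>t. position t \<omega>)" by (rule lipschitz_on_continuous_on)
  then have "continuous_on {0..} (path_of position \<omega>)"
    unfolding path_of_def by (subst continuous_on_cong[OF refl]) auto
  then show ?thesis by (simp add: cont_paths_def path_of_def)
qed

section \<open>Positions at the jump times\<close>

context
  fixes \<omega> assumes \<omega>: "\<omega> \<in> space M" and pos: "\<And>k. 0 < T k \<omega>"
begin

lemma jump_time_nonneg: "0 \<le> jump_time k \<omega>"
  unfolding jump_time_def by (intro sum_nonneg) (simp add: less_imp_le pos)

lemma position_segment:
  assumes t: "jump_time k \<omega> \<le> t" "t \<le> jump_time (Suc k) \<omega>"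
  shows "position t \<omega> - position (jump_time k \<omega>) \<omega> = (c / \<epsilon> * (t - jump_time k \<omega>)) *\<^sub>R direction (Z k \<omega>)"
proof -
  have "(LINT \<tau>:{jump_time k \<omega><..t}|lborel. speed \<omega> \<tau>) = (LINT \<tau>:{jump_time k \<omega><..t}|lborel. direction (Z k \<omega>))"
    unfolding set_lebesgue_integral_def
  proof (rule integral_cong_AE)
    show "(\<lambda>\<tau>. indicat_real {jump_time k \<omega><..t} \<tau> *\<^sub>R speed \<omega> \<tau>) \<in> borel_measurable lborel"
      using speed_integrable[OF \<omega>, of "{jump_time k \<omega><..t}"] by (simp add: set_integrable_def)
    show "AE \<tau> in lborel. indicat_real {jump_time k \<omega><..t} \<tau> *\<^sub>R speed \<omega> \<tau> = indicat_real {jump_time k \<omega><..t} \<tau> *\<^sub>R direction (Z k \<omega>)"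
      \<comment> \<open>The right end is left out because t may be the next jump time, where the
        direction has already changed.\<close>
      using AE_lborel_singleton[of t]
    proof eventually_elim
      case (elim \<tau>)
      show ?case
      proof (cases "\<tau> \<in> {jump_time k \<omega><..t}")
        case True
        then have "jump_count (\<lambda>k. T k \<omega>) \<tau> = k"
          by (intro jump_count_eq pos) (use elim t in \<open>auto simp: jump_time_def\<close>)
        then show ?thesis by (simp add: speed_def)
      qed simp
    qed
  qed simp
  also have "\<dots> = (t - jump_time k \<omega>) *\<^sub>R direction (Z k \<omega>)"
    using t by (simp add: set_lebesgue_integral_def)
  finally show ?thesis using position_diff[OF \<omega> jump_time_nonneg t(1)] by simp
qed

lemma position_jump: "position (jump_time (Suc k) \<omega>) \<omega> - position (jump_time k \<omega>) \<omega> = displacement k \<omega>"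
proof -
  have "jump_time k \<omega> \<le> jump_time (Suc k) \<omega>" "jump_time (Suc k) \<omega> - jump_time k \<omega> = T k \<omega>" using pos[of k] by (auto simp: jump_time_def)
  then show ?thesis using position_segment[of k "jump_time (Suc k) \<omega>"] by (simp add: displacement_def)
qed

text \<open>Between two jumps the motion is straight and uniform, so the distance from the start of
  the segment is largest at its end.\<close>

lemma position_segment_norm:
  assumes t: "jump_time k \<omega> \<le> t" "t \<le> jump_time (Suc k) \<omega>"
  shows "norm (position t \<omega> - position (jump_time k \<omega>) \<omega>) \<le> norm (position (jump_time (Suc k) \<omega>) \<omega> - position (jump_time k \<omega>) \<omega>)"
  unfolding position_segment[OF t] position_segment[OF order_trans[OF t] order_refl] norm_scaleR
  by (intro mult_right_mono) (use t in \<open>auto simp: abs_mult intro!: mult_left_mono divide_right_mono\<close>)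

lemma position_at_jumps: "position (jump_time (Suc k) \<omega>) \<omega> - position (jump_time 1 \<omega>) \<omega> = (\<Sum>i<k. increment i \<omega>)"
proof (induction k)
  case (Suc k)
  have "position (jump_time (Suc (Suc k)) \<omega>) \<omega> - position (jump_time 1 \<omega>) \<omega> = (position (jump_time (Suc (Suc k)) \<omega>) \<omega> - position (jump_time (Suc k) \<omega>) \<omega>) + (position (jump_time (Suc k) \<omega>) \<omega> - position (jump_time 1 \<omega>) \<omega>)" by simp
  then show ?case unfolding Suc position_jump by (simp add: increment_def)
qed simp

end

lemma position_0: "position 0 \<omega> = x"
proof -
  have "(LINT \<tau>:{0..0}|lborel. speed \<omega> \<tau>) = 0"
    unfolding set_lebesgue_integral_def
  proof (rule integral_eq_zero_AE)
    show "AE \<tau> in lborel. indicat_real {0..0} \<tau> *\<^sub>R speed \<omega> \<tau> = 0"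
      using AE_lborel_singleton[of 0] by eventually_elim (simp add: indicator_def)
  qed
  then show ?thesis by (simp add: position_def)
qed

section \<open>Moments of the steps of the walk\<close>

lemma displacement_measurable[measurable]: "displacement k \<in> borel_measurable M"
  unfolding displacement_def[abs_def]
  using measurable_compose[OF Z_rv direction_measurable[OF n2]] by measurable

lemma increment_measurable[measurable]: "increment k \<in> borel_measurable M"
  unfolding increment_def[abs_def] by measurable

text \<open>The test vector may vary with k, so that one linear combination can weight different
  blocks differently.\<close>

lemma inner_increment_indep: "indep_vars (\<lambda>_. borel) (\<lambda>k \<omega>. \<eta> k \<bullet> increment k \<omega>) UNIV"
proof -
  have "indep_vars (\<lambda>_. borel) (\<lambda>k. (\<lambda>(z, t). \<eta> k \<bullet> ((c / \<epsilon> * t) *\<^sub>R direction z)) \<circ> (\<lambda>\<omega>. (Z (Suc k) \<omega>, T (Suc k) \<omega>))) UNIV"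
  proof (rule indep_vars_compose[OF indep_vars_Suc[OF pair_indep]])
    fix k
    have "(\<lambda>p. direction (fst p) :: (real, 'n) vec) \<in> borel_measurable (angle_law CARD('n) \<Otimes>\<^sub>M borel)"
      by (rule measurable_compose[OF measurable_fst direction_measurable[OF n2]])
    then show "(\<lambda>(z, t). \<eta> k \<bullet> ((c / \<epsilon> * t) *\<^sub>R (direction z :: (real, 'n) vec))) \<in> borel_measurable (angle_law CARD('n) \<Otimes>\<^sub>M borel)"
      unfolding split_beta' by measurable
  qed
  then show ?thesis by (simp add: comp_def increment_def displacement_def)
qed

lemma inner_direction_bound: "\<bar>\<eta> \<bullet> (direction \<theta> :: (real, 'n) vec)\<bar> \<le> norm \<eta> * CARD('n)"
  using Cauchy_Schwarz_ineq2[of \<eta> "direction \<theta>"] mult_left_mono[OF direction_norm_bound[of \<theta>, where 'n = 'n] norm_ge_zero[of \<eta>]]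
  by linarith

lemma inner_direction_measurable: "(\<lambda>\<theta>. \<eta> \<bullet> (direction \<theta> :: (real, 'n) vec)) \<in> borel_measurable (angle_law CARD('n))"
  using direction_measurable[OF n2] by simp

lemma inner_increment_eq: "\<eta> \<bullet> increment k \<omega> = (c / \<epsilon>) * ((\<eta> \<bullet> direction (Z (Suc k) \<omega>)) * T (Suc k) \<omega>)"
  by (simp add: increment_def displacement_def)

text \<open>The velocity contributes \<open>(c / \<epsilon>) ^ p\<close> and the holding time
  \<open>fact p * \<epsilon> ^ (2 * p)\<close>, so the p-th moment is of order
  \<open>\<epsilon> ^ p\<close>.\<close>

lemma inner_increment_power:
  "integrable M (\<lambda>\<omega>. (\<eta> \<bullet> increment k \<omega>) ^ p)"
  "expectation (\<lambda>\<omega>. (\<eta> \<bullet> increment k \<omega>) ^ p) = (c / \<epsilon>) ^ p * ((LINT \<theta>|angle_law CARD('n). (\<eta> \<bullet> (direction \<theta> :: (real, 'n) vec)) ^ p) * (fact p * \<epsilon> ^ (2 * p)))"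
proof -
  have f: "(\<lambda>\<theta>. (\<eta> \<bullet> (direction \<theta> :: (real, 'n) vec)) ^ p) \<in> borel_measurable (angle_law CARD('n))"
    by (intro borel_measurable_power inner_direction_measurable)
  have b: "\<bar>(\<eta> \<bullet> (direction \<theta> :: (real, 'n) vec)) ^ p\<bar> \<le> (norm \<eta> * CARD('n)) ^ p" for \<theta>
    unfolding power_abs by (intro power_mono inner_direction_bound) simp
  have e: "(\<eta> \<bullet> increment k \<omega>) ^ p = (c / \<epsilon>) ^ p * ((\<eta> \<bullet> direction (Z (Suc k) \<omega>)) ^ p * T (Suc k) \<omega> ^ p)" for \<omega>
    unfolding inner_increment_eq power_mult_distrib ..
  note * = Z_T_expectation_product[of "Suc k", OF _ f b, of "\<lambda>t. t ^ p", OF _ _ T_moment(1)]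
  show "integrable M (\<lambda>\<omega>. (\<eta> \<bullet> increment k \<omega>) ^ p)" unfolding e by (intro integrable_mult_right *(1)) auto
  have "expectation (\<lambda>\<omega>. (\<eta> \<bullet> direction (Z (Suc k) \<omega>)) ^ p * T (Suc k) \<omega> ^ p) =
      (LINT \<theta>|angle_law CARD('n). (\<eta> \<bullet> (direction \<theta> :: (real, 'n) vec)) ^ p) * (fact p / (1 / \<epsilon>\<^sup>2) ^ p)"
    by (subst *(2)) (simp_all add: T_moment(2))
  then show "expectation (\<lambda>\<omega>. (\<eta> \<bullet> increment k \<omega>) ^ p) = (c / \<epsilon>) ^ p * ((LINT \<theta>|angle_law CARD('n). (\<eta> \<bullet> (direction \<theta> :: (real, 'n) vec)) ^ p) * (fact p * \<epsilon> ^ (2 * p)))"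
    unfolding e by (simp add: power_divide power_mult)
qed

lemma direction_component_integrable:
  "integrable (angle_law CARD('n)) (\<lambda>\<theta>. (direction \<theta> :: (real, 'n) vec) $ i)"
  "integrable (angle_law CARD('n)) (\<lambda>\<theta>. (direction \<theta> :: (real, 'n) vec) $ i * (direction \<theta> :: (real, 'n) vec) $ j)"
proof -
  interpret A: prob_space "angle_law CARD('n)" by (rule prob_space_angle_law[OF n2])
  have m: "(\<lambda>\<theta>. (direction \<theta> :: (real, 'n) vec) $ i) \<in> borel_measurable (angle_law CARD('n))" for i
    using inner_direction_measurable[of "axis i 1"] by (simp add: inner_axis')
  show "integrable (angle_law CARD('n)) (\<lambda>\<theta>. (direction \<theta> :: (real, 'n) vec) $ i)"
    by (rule A.integrable_const_bound[where B = 1, OF _ m]) (simp add: direction_component_bound)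
  show "integrable (angle_law CARD('n)) (\<lambda>\<theta>. (direction \<theta> :: (real, 'n) vec) $ i * (direction \<theta> :: (real, 'n) vec) $ j)"
    by (rule A.integrable_const_bound[where B = 1, OF _ borel_measurable_times[OF m m]])
       (auto simp: abs_mult intro!: mult_le_one direction_component_bound)
qed

lemma inner_increment_mean: "expectation (\<lambda>\<omega>. \<eta> \<bullet> increment k \<omega>) = 0"
proof -
  have "(LINT \<theta>|angle_law CARD('n). \<eta> \<bullet> (direction \<theta> :: (real, 'n) vec)) = 0"
    by (simp add: inner_vec_def direction_component_integrable direction_mean[OF n2])
  then show ?thesis using inner_increment_power(2)[of \<eta> k 1] by simp
qed

text \<open>The 2 is the \<open>fact 2\<close> of the holding time, and \<open>1 / n\<close> is the
  second moment of a direction component.\<close>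

lemma inner_increment_second_moment: "expectation (\<lambda>\<omega>. (\<eta> \<bullet> increment k \<omega>)\<^sup>2) = 2 * c\<^sup>2 * \<epsilon>\<^sup>2 / CARD('n) * (\<eta> \<bullet> \<eta>)"
proof -
  have "(LINT \<theta>|angle_law CARD('n). (\<eta> \<bullet> (direction \<theta> :: (real, 'n) vec))\<^sup>2) =
      (LINT \<theta>|angle_law CARD('n). (\<Sum>i\<in>UNIV. \<Sum>j\<in>UNIV. (\<eta> $ i * \<eta> $ j) * ((direction \<theta> :: (real, 'n) vec) $ i * (direction \<theta> :: (real, 'n) vec) $ j)))"
    by (simp add: inner_vec_def power2_eq_square sum_product ac_simps)
  also have "\<dots> = (\<Sum>i\<in>UNIV. \<Sum>j\<in>UNIV. (\<eta> $ i * \<eta> $ j) * (if i = j then 1 / CARD('n) else 0))"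
    by (simp add: direction_component_integrable direction_covariance[OF n2])
  also have "\<dots> = (\<eta> \<bullet> \<eta>) / CARD('n)"
    by (simp add: if_distrib[of "\<lambda>z. _ * z"] sum.delta inner_vec_def sum_divide_distrib cong: if_cong)
  finally have e: "(LINT \<theta>|angle_law CARD('n). (\<eta> \<bullet> (direction \<theta> :: (real, 'n) vec))\<^sup>2) = (\<eta> \<bullet> \<eta>) / CARD('n)" .
  show ?thesis
    unfolding inner_increment_power(2) e using \<epsilon> by (simp add: power_divide power2_eq_square power4_eq_xxxx field_simps)
qed

text \<open>The direction is bounded crudely; the third moment \<open>6 * \<epsilon> ^ 6\<close> of
  the holding time against \<open>1 / \<epsilon> ^ 3\<close> from the velocity gives the order
  \<open>\<epsilon> ^ 3\<close>.\<close>

lemma inner_increment_third_moment: "expectation (\<lambda>\<omega>. \<bar>\<eta> \<bullet> increment k \<omega>\<bar> ^ 3) \<le> 6 * (\<bar>c\<bar> * (norm \<eta> * CARD('n))) ^ 3 * \<epsilon> ^ 3"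
proof -
  let ?b = "(\<bar>c\<bar> / \<epsilon> * (norm \<eta> * CARD('n))) ^ 3"
  have "expectation (\<lambda>\<omega>. \<bar>\<eta> \<bullet> increment k \<omega>\<bar> ^ 3) \<le> expectation (\<lambda>\<omega>. ?b * T (Suc k) \<omega> ^ 3)"
  proof (rule integral_mono_AE)
    show "integrable M (\<lambda>\<omega>. \<bar>\<eta> \<bullet> increment k \<omega>\<bar> ^ 3)"
      using integrable_abs[OF inner_increment_power(1)[of \<eta> k 3]] by (simp add: power_abs)
    show "AE \<omega> in M. \<bar>\<eta> \<bullet> increment k \<omega>\<bar> ^ 3 \<le> ?b * T (Suc k) \<omega> ^ 3"
      using T_pos
    proof eventually_elim
      case (elim \<omega>)
      have t: "0 < T (Suc k) \<omega>" using elim by simp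
      have "\<bar>\<eta> \<bullet> increment k \<omega>\<bar> = (\<bar>c\<bar> / \<epsilon>) * (\<bar>\<eta> \<bullet> direction (Z (Suc k) \<omega>)\<bar> * T (Suc k) \<omega>)"
        unfolding inner_increment_eq using \<epsilon> t by (simp add: abs_mult)
      also have "\<dots> \<le> (\<bar>c\<bar> / \<epsilon>) * ((norm \<eta> * CARD('n)) * T (Suc k) \<omega>)"
        using \<epsilon> t by (intro mult_left_mono mult_right_mono inner_direction_bound) auto
      finally have "\<bar>\<eta> \<bullet> increment k \<omega>\<bar> ^ 3 \<le> ((\<bar>c\<bar> / \<epsilon>) * ((norm \<eta> * CARD('n)) * T (Suc k) \<omega>)) ^ 3"
        by (intro power_mono) auto
      also have "\<dots> = ?b * T (Suc k) \<omega> ^ 3" by (simp only: power_mult_distrib mult.assoc)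
      finally show ?case .
    qed
  qed (intro integrable_mult_right T_moment)
  also have "\<dots> = ?b * (6 * \<epsilon> ^ 6)"
    using T_moment(2)[of "Suc k" 3] by (simp add: fact_numeral power_divide flip: power_mult)
  also have "\<dots> = 6 * (\<bar>c\<bar> * (norm \<eta> * CARD('n))) ^ 3 * \<epsilon> ^ 3"
    using \<epsilon> by (simp add: power_divide power_mult_distrib field_simps flip: power_add)
  finally show ?thesis .
qed

lemma component_increment_fourth_moment: "expectation (\<lambda>\<omega>. (axis i 1 \<bullet> increment k \<omega>) ^ 4) \<le> 24 * c ^ 4 * \<epsilon> ^ 4"
proof -
  interpret A: prob_space "angle_law CARD('n)" by (rule prob_space_angle_law[OF n2])
  have "(LINT \<theta>|angle_law CARD('n). (axis i 1 \<bullet> (direction \<theta> :: (real, 'n) vec)) ^ 4) \<le> (LINT \<theta>|angle_law CARD('n). 1)"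
  proof (rule integral_mono')
    fix \<theta>
    have "\<bar>(direction \<theta> :: (real, 'n) vec) $ i\<bar> ^ 4 \<le> 1" by (intro power_le_one direction_component_bound) auto
    then show "(axis i 1 \<bullet> (direction \<theta> :: (real, 'n) vec)) ^ 4 \<le> 1" by (simp add: inner_axis' power_abs)
  qed auto
  then have le: "(LINT \<theta>|angle_law CARD('n). (axis i 1 \<bullet> (direction \<theta> :: (real, 'n) vec)) ^ 4) \<le> 1" by (simp add: A.prob_space)
  have "expectation (\<lambda>\<omega>. (axis i 1 \<bullet> increment k \<omega>) ^ 4) \<le> (c / \<epsilon>) ^ 4 * (1 * (fact 4 * \<epsilon> ^ (2 * 4)))"
    unfolding inner_increment_power(2) using \<epsilon> by (intro mult_left_mono mult_right_mono le) auto
  also have "\<dots> = 24 * c ^ 4 * \<epsilon> ^ 4"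
    using \<epsilon> by (simp add: fact_numeral power_divide field_simps flip: power_add)
  finally show ?thesis .
qed

section \<open>Tail estimates for blocks, jump times and the first step\<close>

lemma oscillation_tail:
  assumes d: "0 < d"
  shows "prob {\<omega> \<in> space M. \<exists>k\<le>N. d \<le> \<bar>\<Sum>q\<in>{p..<p + k}. axis i 1 \<bullet> increment q \<omega>\<bar>} \<le>
    (real N * (24 * c ^ 4 * \<epsilon> ^ 4) + 3 * (real N * (2 * c\<^sup>2 * \<epsilon>\<^sup>2 / CARD('n)))\<^sup>2) / d ^ 4"
proof (rule partial_sum_tail[OF inner_increment_indep[of "\<lambda>_. axis i 1"] inner_increment_power(1) inner_increment_mean _ component_increment_fourth_moment d])
  show "expectation (\<lambda>\<omega>. (axis i 1 \<bullet> increment k \<omega>)\<^sup>2) \<le> 2 * c\<^sup>2 * \<epsilon>\<^sup>2 / CARD('n)" for k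
    unfolding inner_increment_second_moment by (simp add: inner_axis_axis)
qed

text \<open>The centred holding times have variance \<open>2 \<epsilon>^4 - \<epsilon>^4\<close>.
  Their fourth moments are computed in order to enter the context of the partial sum lemmas.\<close>

lemma jump_time_tail:
  assumes d: "0 < d"
  shows "prob {\<omega> \<in> space M. d \<le> \<bar>jump_time N \<omega> - N * \<epsilon>\<^sup>2\<bar>} \<le> N * \<epsilon> ^ 4 / d\<^sup>2"
proof -
  let ?Y = "\<lambda>k \<omega>. T k \<omega> - \<epsilon>\<^sup>2"
  have i1: "integrable M (T k)" and e1: "expectation (T k) = \<epsilon>\<^sup>2" for k
    using T_moment[of k 1] by simp_all
  have i2: "integrable M (\<lambda>\<omega>. (T k \<omega>)\<^sup>2)" and e2: "expectation (\<lambda>\<omega>. (T k \<omega>)\<^sup>2) = 2 * \<epsilon> ^ 4" for k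
    using T_moment[of k 2] by (simp_all add: power2_eq_square power4_eq_xxxx)
  have ind: "indep_vars (\<lambda>_. borel) ?Y UNIV"
    using indep_vars_compose[OF T_indep, of "\<lambda>_ t. t - \<epsilon>\<^sup>2" "\<lambda>_. borel"] by (simp add: comp_def)
  have b4: "?Y k \<omega> ^ 4 \<le> 8 * (T k \<omega> ^ 4 + (- (\<epsilon>\<^sup>2)) ^ 4)" for k \<omega>
    using fourth_power_add_le[of "T k \<omega>" "- (\<epsilon>\<^sup>2)"] by simp
  have ib: "integrable M (\<lambda>\<omega>. 8 * (T k \<omega> ^ 4 + (- (\<epsilon>\<^sup>2)) ^ 4))" for k
    using T_moment(1)[of k 4] by simp
  have i4: "integrable M (\<lambda>\<omega>. ?Y k \<omega> ^ 4)" for k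
    by (rule Bochner_Integration.integrable_bound[OF ib[of k]]) (use b4[of k] in \<open>auto intro!: AE_I2 order_trans[OF _ abs_ge_self]\<close>)
  have m4: "expectation (\<lambda>\<omega>. ?Y k \<omega> ^ 4) \<le> 8 * (24 * \<epsilon> ^ 8 + \<epsilon> ^ 8)" for k
  proof -
    have "expectation (\<lambda>\<omega>. ?Y k \<omega> ^ 4) \<le> expectation (\<lambda>\<omega>. 8 * (T k \<omega> ^ 4 + (- (\<epsilon>\<^sup>2)) ^ 4))"
      by (rule integral_mono[OF i4 ib b4])
    also have "\<dots> = 8 * (24 * \<epsilon> ^ 8 + \<epsilon> ^ 8)"
      using T_moment[of k 4] by (simp add: prob_space fact_numeral power_divide flip: power_mult)
    finally show ?thesis .
  qed
  have m1: "expectation (?Y k) = 0" for k using i1 e1 by (simp add: prob_space)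
  have m2: "expectation (\<lambda>\<omega>. (?Y k \<omega>)\<^sup>2) \<le> \<epsilon> ^ 4" for k
  proof -
    have "expectation (\<lambda>\<omega>. (?Y k \<omega>)\<^sup>2) = expectation (\<lambda>\<omega>. (T k \<omega>)\<^sup>2 - 2 * \<epsilon>\<^sup>2 * T k \<omega> + \<epsilon> ^ 4)"
      by (intro Bochner_Integration.integral_cong refl) (simp add: power2_diff flip: power_mult)
    also have "\<dots> = 2 * \<epsilon> ^ 4 - 2 * \<epsilon>\<^sup>2 * \<epsilon>\<^sup>2 + \<epsilon> ^ 4" using i1 i2 by (simp add: e1 e2 prob_space)
    also have "\<dots> = \<epsilon> ^ 4" by (simp flip: power_add)
    finally show ?thesis by simp
  qed
  note sm = partial_sum_second_moment[OF ind i4 m1 m2 m4, of 0 N, simplified]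
  have "prob {\<omega> \<in> space M. d \<le> \<bar>(\<Sum>i\<in>{0..<N}. ?Y i \<omega>) - expectation (\<lambda>\<omega>. \<Sum>i\<in>{0..<N}. ?Y i \<omega>)\<bar>} \<le>
      variance (\<lambda>\<omega>. \<Sum>i\<in>{0..<N}. ?Y i \<omega>) / d\<^sup>2"
  proof (rule Chebyshev_inequality[OF _ _ d])
    show "integrable M (\<lambda>\<omega>. (\<Sum>i\<in>{0..<N}. ?Y i \<omega>)\<^sup>2)"
      using partial_sum_power_integrable[OF ind i4 m1 m2 m4, of 2 0 N] by simp
  qed simp
  moreover have "expectation (\<lambda>\<omega>. \<Sum>i\<in>{0..<N}. ?Y i \<omega>) = 0"
    using partial_sum_mean[OF ind i4 m1 m2 m4, of 0 N] by simp
  ultimately have "prob {\<omega> \<in> space M. d \<le> \<bar>\<Sum>i\<in>{0..<N}. ?Y i \<omega>\<bar>} \<le> expectation (\<lambda>\<omega>. (\<Sum>i\<in>{0..<N}. ?Y i \<omega>)\<^sup>2) / d\<^sup>2"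
    by simp
  also have "\<dots> \<le> N * \<epsilon> ^ 4 / d\<^sup>2" using sm d by (intro divide_right_mono) auto
  finally show ?thesis
    by (simp add: jump_time_def sum_subtractf lessThan_atLeast0)
qed

text \<open>The law of \<open>Z 0\<close> is arbitrary, so the estimate rests on the bound for
  directions and on the mean \<open>\<epsilon>^2\<close> of the holding time; after division by
  \<epsilon> a factor \<epsilon> remains.\<close>

lemma first_jump_tail:
  assumes d: "0 < d"
  shows "prob {\<omega> \<in> space M. d < norm (displacement 0 \<omega>)} \<le> \<bar>c\<bar> * CARD('n) * \<epsilon> / d"
proof -
  have i1: "integrable M (T 0)" and e1: "expectation (T 0) = \<epsilon>\<^sup>2" using T_moment[of 0 1] by simp_all
  have b: "AE \<omega> in M. norm (displacement 0 \<omega>) \<le> \<bar>c\<bar> / \<epsilon> * CARD('n) * T 0 \<omega>"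
    using T_pos
  proof eventually_elim
    case (elim \<omega>)
    have "norm (displacement 0 \<omega>) = \<bar>c\<bar> / \<epsilon> * T 0 \<omega> * norm (direction (Z 0 \<omega>) :: (real, 'n) vec)"
      using \<epsilon> elim by (simp add: displacement_def abs_mult less_imp_le)
    also have "\<dots> \<le> \<bar>c\<bar> / \<epsilon> * T 0 \<omega> * CARD('n)"
      using \<epsilon> elim by (intro mult_left_mono direction_norm_bound) (auto simp: less_imp_le)
    finally show ?case by (simp add: ac_simps)
  qed
  have "d * prob {\<omega> \<in> space M. d < norm (displacement 0 \<omega>)} = expectation (\<lambda>\<omega>. d * indicator {\<omega> \<in> space M. d < norm (displacement 0 \<omega>)} \<omega>)"
    by (simp add: emeasure_eq_measure)
  also have "\<dots> \<le> expectation (\<lambda>\<omega>. \<bar>c\<bar> / \<epsilon> * CARD('n) * T 0 \<omega>)"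
  proof (rule integral_mono_AE)
    show "AE \<omega> in M. d * indicator {\<omega> \<in> space M. d < norm (displacement 0 \<omega>)} \<omega> \<le> \<bar>c\<bar> / \<epsilon> * CARD('n) * T 0 \<omega>"
      using b T_pos by eventually_elim (auto simp: indicator_def intro: order_trans[OF norm_ge_zero])
  qed (use i1 in \<open>auto simp: emeasure_eq_measure\<close>)
  also have "\<dots> = \<bar>c\<bar> * CARD('n) * \<epsilon>" using e1 \<epsilon> by (simp add: power2_eq_square)
  finally show ?thesis using d by (simp add: pos_le_divide_eq mult.commute)
qed

end

section \<open>Polygonal approximation of the random evolution\<close>

lemma polygon_cong: "(\<And>j. j \<le> M \<Longrightarrow> y j = z j) \<Longrightarrow> polygon m M y = polygon m M z"
  unfolding polygon_def by (intro restrict_ext arg_cong2[of _ _ _ _ "(+)"] sum.cong) auto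

text \<open>The three summands come from Chebyshev's inequality for the jump times, from the maximal
  inequality in every block and coordinate, and from Markov's inequality for the first step.\<close>

definition bad_bound :: "real \<Rightarrow> real \<Rightarrow> nat \<Rightarrow> nat \<Rightarrow> real \<Rightarrow> real \<Rightarrow> real" where
  "bad_bound n c m K \<delta> \<epsilon> =
     (real (m * (K + 3)) + 1) * (((real K + 3) * \<epsilon>\<^sup>2 + \<epsilon> ^ 4) / (1 / (2 * real m))\<^sup>2) +
     real (m * (K + 3)) * (n * ((24 * c ^ 4 * (\<epsilon>\<^sup>2 / m + \<epsilon> ^ 4) + 3 * (2 * c\<^sup>2 / n * (1 / m + \<epsilon>\<^sup>2))\<^sup>2) / (\<delta> / n) ^ 4)) +
     \<bar>c\<bar> * n * \<epsilon> / \<delta>"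

text \<open>At 0 only the squared variance of the blocks survives: \<open>m * (K + 3)\<close> blocks
  times n coordinates times \<open>12 * c^4 / (n * m)^2 * (n / \<delta>)^4\<close>. The square of m
  in the denominator leaves a factor \<open>1 / m\<close>.\<close>

lemma bad_bound_tendsto:
  assumes "0 < n" "0 < m" "0 < \<delta>"
  shows "((\<lambda>\<epsilon>. bad_bound n c m K \<delta> \<epsilon>) \<longlongrightarrow> (12 * c ^ 4 * n ^ 3 * (real K + 3) / \<delta> ^ 4) / m) (at_right 0)"
proof -
  have "((\<lambda>\<epsilon>. bad_bound n c m K \<delta> \<epsilon>) \<longlongrightarrow> bad_bound n c m K \<delta> 0) (at_right 0)"
    unfolding bad_bound_def using assms by (intro tendsto_intros) auto
  also have "bad_bound n c m K \<delta> 0 = (12 * c ^ 4 * n ^ 3 * (real K + 3) / \<delta> ^ 4) / m"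
    using assms unfolding bad_bound_def
    by (simp add: power_divide power_mult_distrib) (simp add: field_simps power2_eq_square power3_eq_cube power4_eq_xxxx)
  finally show ?thesis .
qed

context evolution
begin

text \<open>A step lasts \<open>\<epsilon>^2\<close> on average, so this is the typical number of
  steps up to time \<open>j / m\<close>, rounded down. Being deterministic, it keeps the differences
  of vertices sums of independent variables.\<close>

definition blk :: "nat \<Rightarrow> nat \<Rightarrow> nat" where
  "blk m j = nat \<lfloor>real j / (real m * \<epsilon>\<^sup>2)\<rfloor>"

definition vertex :: "nat \<Rightarrow> nat \<Rightarrow> 'a \<Rightarrow> (real, 'n) vec" where
  "vertex m j \<omega> = x + (\<Sum>i<blk m j. increment i \<omega>)"

lemma blk_0: "blk m 0 = 0" by (simp add: blk_def)

lemma blk_bounds: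
  assumes "0 < m"
  shows "real (blk m j) * \<epsilon>\<^sup>2 \<le> real j / m" "real j / m \<le> real (Suc (blk m j)) * \<epsilon>\<^sup>2"
proof -
  have p: "0 < real m * \<epsilon>\<^sup>2" using assms \<epsilon> by simp
  have f: "real (blk m j) = of_int \<lfloor>real j / (real m * \<epsilon>\<^sup>2)\<rfloor>"
    using p unfolding blk_def by (intro of_nat_nat) (simp add: less_imp_le)
  have "real (blk m j) \<le> real j / (real m * \<epsilon>\<^sup>2)" "real j / (real m * \<epsilon>\<^sup>2) \<le> real (Suc (blk m j))"
    using of_int_floor_le[of "real j / (real m * \<epsilon>\<^sup>2)"] real_of_int_floor_add_one_ge[of "real j / (real m * \<epsilon>\<^sup>2)"] unfolding f of_nat_Suc by linarith+
  then have "real (blk m j) * (real m * \<epsilon>\<^sup>2) \<le> real j" "real j \<le> real (Suc (blk m j)) * (real m * \<epsilon>\<^sup>2)"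
    using p by (simp_all only: pos_le_divide_eq pos_divide_le_eq)
  then show "real (blk m j) * \<epsilon>\<^sup>2 \<le> real j / m" "real j / m \<le> real (Suc (blk m j)) * \<epsilon>\<^sup>2"
    using assms by (simp_all add: pos_le_divide_eq pos_divide_le_eq ac_simps del: of_nat_Suc)
qed

lemma mono_blk: "mono (blk m)"
  unfolding blk_def by (intro monoI nat_mono floor_mono divide_right_mono) auto

lemma blk_diff_bound:
  assumes "0 < m"
  shows "real (blk m (Suc j) - blk m j) * \<epsilon>\<^sup>2 \<le> 1 / m + \<epsilon>\<^sup>2"
proof -
  have "blk m j \<le> blk m (Suc j)" by (rule monoD[OF mono_blk]) simp
  then have "real (blk m (Suc j) - blk m j) * \<epsilon>\<^sup>2 = real (blk m (Suc j)) * \<epsilon>\<^sup>2 - (real (Suc (blk m j)) * \<epsilon>\<^sup>2 - \<epsilon>\<^sup>2)"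
    by (simp add: of_nat_diff algebra_simps)
  also have "\<dots> \<le> real (Suc j) / m - (real j / m - \<epsilon>\<^sup>2)"
    using blk_bounds[OF assms, of j] blk_bounds[OF assms, of "Suc j"] by linarith
  also have "\<dots> = 1 / m + \<epsilon>\<^sup>2" by (simp add: add_divide_distrib)
  finally show ?thesis .
qed

text \<open>The jump index is \<open>Suc (blk m j)\<close> because the walk omits step 0. A timing
  tolerance of half a mesh leaves the other half for the rounding in \<open>blk\<close>, and
  \<open>\<delta> / CARD('n)\<close> per coordinate sums to \<delta> in norm.\<close>

definition bad :: "nat \<Rightarrow> nat \<Rightarrow> real \<Rightarrow> 'a set" where
  "bad m K \<delta> = (\<Union>j\<le>m * (K + 3). {\<omega> \<in> space M. 1 / (2 * real m) \<le> \<bar>jump_time (Suc (blk m j)) \<omega> - real (Suc (blk m j)) * \<epsilon>\<^sup>2\<bar>}) \<union>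
     (\<Union>j<m * (K + 3). \<Union>i\<in>UNIV. {\<omega> \<in> space M. \<exists>k\<le>blk m (Suc j) - blk m j.
        \<delta> / CARD('n) \<le> \<bar>\<Sum>q\<in>{blk m j..<blk m j + k}. axis i 1 \<bullet> increment q \<omega>\<bar>}) \<union>
     {\<omega> \<in> space M. \<delta> < norm (displacement 0 \<omega>)}"

lemma jump_time_measurable[measurable]: "jump_time k \<in> borel_measurable M"
  unfolding jump_time_def[abs_def] by measurable

lemma bad_measurable: "bad m K \<delta> \<in> sets M"
  unfolding bad_def by (intro sets.Un sets.finite_UN) measurable

lemma prob_bad:
  assumes m: "0 < m" and \<delta>: "0 < \<delta>"
  shows "prob (bad m K \<delta>) \<le> bad_bound CARD('n) c m K \<delta> \<epsilon>"
proof -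
  let ?J = "m * (K + 3)" and ?n = "real CARD('n)"
  define E1 where "E1 j = {\<omega> \<in> space M. 1 / (2 * real m) \<le> \<bar>jump_time (Suc (blk m j)) \<omega> - real (Suc (blk m j)) * \<epsilon>\<^sup>2\<bar>}" for j
  define E2 where "E2 j i = {\<omega> \<in> space M. \<exists>k\<le>blk m (Suc j) - blk m j.
        \<delta> / CARD('n) \<le> \<bar>\<Sum>q\<in>{blk m j..<blk m j + k}. axis i 1 \<bullet> increment q \<omega>\<bar>}" for j and i :: 'n
  have m1: "E1 j \<in> sets M" for j unfolding E1_def by measurable
  have m2: "E2 j i \<in> sets M" for j i unfolding E2_def by measurable
  have 1: "prob (E1 j) \<le> ((real K + 3) * \<epsilon>\<^sup>2 + \<epsilon> ^ 4) / (1 / (2 * real m))\<^sup>2" if "j \<le> ?J" for j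
  proof -
    have "real j / m \<le> real K + 3"
    proof -
      have "real j \<le> real ?J" using that by (rule of_nat_mono)
      then show ?thesis using m by (simp add: pos_divide_le_eq ac_simps)
    qed
    then have "real (blk m j) * \<epsilon>\<^sup>2 \<le> real K + 3" using blk_bounds(1)[OF m, of j] by linarith
    then have "(real (blk m j) * \<epsilon>\<^sup>2) * \<epsilon>\<^sup>2 \<le> (real K + 3) * \<epsilon>\<^sup>2" by (intro mult_right_mono) auto
    then have "real (Suc (blk m j)) * \<epsilon> ^ 4 \<le> (real K + 3) * \<epsilon>\<^sup>2 + \<epsilon> ^ 4"
      by (simp add: power2_eq_square power4_eq_xxxx algebra_simps)
    then have "real (Suc (blk m j)) * \<epsilon> ^ 4 / (1 / (2 * real m))\<^sup>2 \<le> ((real K + 3) * \<epsilon>\<^sup>2 + \<epsilon> ^ 4) / (1 / (2 * real m))\<^sup>2"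
      by (rule divide_right_mono) simp
    moreover have "prob (E1 j) \<le> real (Suc (blk m j)) * \<epsilon> ^ 4 / (1 / (2 * real m))\<^sup>2"
      unfolding E1_def by (rule jump_time_tail) (use m in simp)
    ultimately show ?thesis by linarith
  qed
  have 2: "prob (E2 j i) \<le> (24 * c ^ 4 * (\<epsilon>\<^sup>2 / m + \<epsilon> ^ 4) + 3 * (2 * c\<^sup>2 / ?n * (1 / m + \<epsilon>\<^sup>2))\<^sup>2) / (\<delta> / ?n) ^ 4" for j i
  proof -
    let ?N = "blk m (Suc j) - blk m j"
    note N = blk_diff_bound[OF m, of j]
    have "real ?N * (24 * c ^ 4 * \<epsilon> ^ 4) = 24 * c ^ 4 * ((real ?N * \<epsilon>\<^sup>2) * \<epsilon>\<^sup>2)"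
      by (simp add: power2_eq_square power4_eq_xxxx)
    also have "\<dots> \<le> 24 * c ^ 4 * ((1 / m + \<epsilon>\<^sup>2) * \<epsilon>\<^sup>2)" by (intro mult_left_mono mult_right_mono N) auto
    also have "(1 / m + \<epsilon>\<^sup>2) * \<epsilon>\<^sup>2 = \<epsilon>\<^sup>2 / m + \<epsilon> ^ 4" by (simp add: power2_eq_square power4_eq_xxxx algebra_simps)
    finally have a: "real ?N * (24 * c ^ 4 * \<epsilon> ^ 4) \<le> 24 * c ^ 4 * (\<epsilon>\<^sup>2 / m + \<epsilon> ^ 4)" .
    have "real ?N * (2 * c\<^sup>2 * \<epsilon>\<^sup>2 / ?n) = 2 * c\<^sup>2 / ?n * (real ?N * \<epsilon>\<^sup>2)" by simp
    also have "\<dots> \<le> 2 * c\<^sup>2 / ?n * (1 / m + \<epsilon>\<^sup>2)" by (intro mult_left_mono N) auto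
    finally have "(real ?N * (2 * c\<^sup>2 * \<epsilon>\<^sup>2 / ?n))\<^sup>2 \<le> (2 * c\<^sup>2 / ?n * (1 / m + \<epsilon>\<^sup>2))\<^sup>2" by (intro power_mono) auto
    then have b: "real ?N * (24 * c ^ 4 * \<epsilon> ^ 4) + 3 * (real ?N * (2 * c\<^sup>2 * \<epsilon>\<^sup>2 / ?n))\<^sup>2 \<le>
        24 * c ^ 4 * (\<epsilon>\<^sup>2 / m + \<epsilon> ^ 4) + 3 * (2 * c\<^sup>2 / ?n * (1 / m + \<epsilon>\<^sup>2))\<^sup>2" using a by linarith
    have "prob (E2 j i) \<le> (real ?N * (24 * c ^ 4 * \<epsilon> ^ 4) + 3 * (real ?N * (2 * c\<^sup>2 * \<epsilon>\<^sup>2 / ?n))\<^sup>2) / (\<delta> / ?n) ^ 4"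
      unfolding E2_def by (rule oscillation_tail) (use \<delta> in simp)
    also have "\<dots> \<le> (24 * c ^ 4 * (\<epsilon>\<^sup>2 / m + \<epsilon> ^ 4) + 3 * (2 * c\<^sup>2 / ?n * (1 / m + \<epsilon>\<^sup>2))\<^sup>2) / (\<delta> / ?n) ^ 4"
      by (rule divide_right_mono[OF b]) simp
    finally show ?thesis .
  qed
  have "prob (\<Union>j\<le>?J. E1 j) \<le> (\<Sum>j\<le>?J. prob (E1 j))"
    by (rule finite_measure_subadditive_finite) (use m1 in auto)
  also have "\<dots> \<le> (\<Sum>j\<le>?J. ((real K + 3) * \<epsilon>\<^sup>2 + \<epsilon> ^ 4) / (1 / (2 * real m))\<^sup>2)"
    by (intro sum_mono 1) simp
  finally have u1: "prob (\<Union>j\<le>?J. E1 j) \<le> (real ?J + 1) * (((real K + 3) * \<epsilon>\<^sup>2 + \<epsilon> ^ 4) / (1 / (2 * real m))\<^sup>2)"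
    by (simp add: add.commute del: of_nat_mult)
  have "prob (\<Union>j<?J. \<Union>i\<in>UNIV. E2 j i) \<le> (\<Sum>j<?J. prob (\<Union>i\<in>UNIV. E2 j i))"
    by (rule finite_measure_subadditive_finite) (use m2 in auto)
  also have "\<dots> \<le> (\<Sum>j<?J. \<Sum>i\<in>UNIV. prob (E2 j i))"
    by (intro sum_mono finite_measure_subadditive_finite) (use m2 in auto)
  also have "\<dots> \<le> (\<Sum>j<?J. \<Sum>i\<in>(UNIV :: 'n set). (24 * c ^ 4 * (\<epsilon>\<^sup>2 / m + \<epsilon> ^ 4) + 3 * (2 * c\<^sup>2 / ?n * (1 / m + \<epsilon>\<^sup>2))\<^sup>2) / (\<delta> / ?n) ^ 4)"
    by (intro sum_mono 2)
  finally have u2: "prob (\<Union>j<?J. \<Union>i\<in>UNIV. E2 j i) \<le> real ?J * (?n * ((24 * c ^ 4 * (\<epsilon>\<^sup>2 / m + \<epsilon> ^ 4) + 3 * (2 * c\<^sup>2 / ?n * (1 / m + \<epsilon>\<^sup>2))\<^sup>2) / (\<delta> / ?n) ^ 4))"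
    by (simp del: of_nat_mult)
  have s1: "(\<Union>j\<le>?J. E1 j) \<in> sets M" and s2: "(\<Union>j<?J. \<Union>i\<in>UNIV. E2 j i) \<in> sets M"
    using m1 m2 by (auto intro!: sets.finite_UN)
  have s3: "{\<omega> \<in> space M. \<delta> < norm (displacement 0 \<omega>)} \<in> sets M" by measurable
  have "prob (bad m K \<delta>) \<le> prob (\<Union>j\<le>?J. E1 j) + prob (\<Union>j<?J. \<Union>i\<in>UNIV. E2 j i) + prob {\<omega> \<in> space M. \<delta> < norm (displacement 0 \<omega>)}"
    unfolding bad_def E1_def[symmetric] E2_def[symmetric]
    using measure_Un_le[OF sets.Un[OF s1 s2] s3] measure_Un_le[OF s1 s2] by linarith
  then show ?thesis
    unfolding bad_bound_def using u1 u2 first_jump_tail[OF \<delta>] by linarith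
qed

lemma near_polygon:
  assumes m: "0 < m" and small: "\<epsilon>\<^sup>2 \<le> 1 / (2 * real m)"
    and \<omega>: "\<omega> \<in> space M" and pos: "\<And>k. 0 < T k \<omega>" and good: "\<omega> \<notin> bad m K \<delta>" and t: "t \<in> {0..<real K}"
  shows "dist (position t \<omega>) (polygon m (m * K) (\<lambda>j. vertex m j \<omega>) t) \<le> 14 * \<delta>"
proof -
  let ?X = "\<lambda>t. position t \<omega>" and ?S = "\<lambda>k. jump_time k \<omega>"
  have XS: "?X (?S (Suc k)) - ?X (?S 1) = (\<Sum>i<k. increment i \<omega>)" for k by (rule position_at_jumps[OF \<omega> pos])
  have v: "vertex m j \<omega> = ?X 0 + (?X (?S (Suc (blk m j))) - ?X (?S 1))" for j
    unfolding XS by (simp add: vertex_def position_0)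
  show ?thesis
    unfolding v
  proof (rule path_near_polygon[OF m _ _ _ mono_blk blk_0 _ _ _ t])
    show "?S 0 = 0" "?S k < ?S (Suc k)" for k using pos[of k] by (auto simp: jump_time_def)
    show "norm (?X s - ?X (?S k)) \<le> norm (?X (?S (Suc k)) - ?X (?S k))" if "?S k \<le> s" "s \<le> ?S (Suc k)" for k s
      by (rule position_segment_norm[OF \<omega> pos that])
    \<comment> \<open>Half of the tolerance comes from the good event. The other half comes from
      \<open>small\<close>: \<open>j / m\<close> lies between \<open>blk m j\<close> and
      \<open>Suc (blk m j)\<close> mean holding times.\<close>
    show "\<bar>?S (Suc (blk m j)) - real j / m\<bar> < 1 / m" if "j \<le> m * (K + 3)" for j
    proof -
      have 1: "\<bar>?S (Suc (blk m j)) - real (Suc (blk m j)) * \<epsilon>\<^sup>2\<bar> < 1 / (2 * real m)"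
        using good that \<omega> by (auto simp: bad_def not_le)
      have e: "real (Suc (blk m j)) * \<epsilon>\<^sup>2 = real (blk m j) * \<epsilon>\<^sup>2 + \<epsilon>\<^sup>2" by (simp add: algebra_simps)
      have "1 / (2 * real m) + 1 / (2 * real m) = 1 / m" by simp
      then show ?thesis using 1 blk_bounds[OF m, of j] small unfolding e by linarith
    qed
    show "norm (?X (?S (Suc k)) - ?X (?S (Suc (blk m j)))) \<le> \<delta>"
      if j: "j < m * (K + 3)" and k: "blk m j \<le> k" "k \<le> blk m (Suc j)" for j k
    proof -
      have eq: "?X (?S (Suc k)) - ?X (?S (Suc (blk m j))) = (\<Sum>q\<in>{blk m j..<k}. increment q \<omega>)"
      proof -
        have "{..<k} = {..<blk m j} \<union> {blk m j..<k}" using k by auto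
        then have "(\<Sum>i<k. increment i \<omega>) = (\<Sum>i<blk m j. increment i \<omega>) + (\<Sum>q\<in>{blk m j..<k}. increment q \<omega>)"
          by (simp add: sum.union_disjoint ivl_disj_int)
        then show ?thesis using XS[of k] XS[of "blk m j"] by (simp add: algebra_simps)
      qed
      have c: "\<bar>(\<Sum>q\<in>{blk m j..<k}. increment q \<omega>) $ i\<bar> \<le> \<delta> / CARD('n)" for i
      proof -
        have "\<not> (\<exists>k\<le>blk m (Suc j) - blk m j. \<delta> / CARD('n) \<le> \<bar>\<Sum>q\<in>{blk m j..<blk m j + k}. axis i 1 \<bullet> increment q \<omega>\<bar>)"
          using good j \<omega> unfolding bad_def by blast
        then have "\<bar>\<Sum>q\<in>{blk m j..<blk m j + (k - blk m j)}. axis i 1 \<bullet> increment q \<omega>\<bar> < \<delta> / CARD('n)"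
          using k diff_le_mono[OF k(2), of "blk m j"] by (meson not_le)
        then show ?thesis using k by (simp add: inner_axis')
      qed
      have "norm (\<Sum>q\<in>{blk m j..<k}. increment q \<omega>) \<le> (\<Sum>i\<in>UNIV. \<bar>(\<Sum>q\<in>{blk m j..<k}. increment q \<omega>) $ i\<bar>)" by (rule norm_le_l1_cart)
      also have "\<dots> \<le> (\<Sum>i\<in>(UNIV :: 'n set). \<delta> / CARD('n))" by (intro sum_mono c)
      finally show ?thesis unfolding eq by simp
    qed
    show "norm (?X (?S 1) - ?X 0) \<le> \<delta>"
      using position_jump[OF \<omega> pos, of 0] good \<omega> by (auto simp: bad_def jump_time_def not_less)
  qed
qed

text \<open>Off the bad event the Lipschitz bound applies, and on it the difference is at most
  \<open>B\<close>. The horizon \<open>Suc K\<close> covers the closed interval [0, K].\<close>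

lemma polygon_functional_error:
  assumes m: "0 < m" and \<delta>: "0 < \<delta>" and small: "\<epsilon>\<^sup>2 \<le> 1 / (2 * real m)"
    and H: "path_lipschitz (real K) L H" and B: "\<And>f. f \<in> cont_paths \<Longrightarrow> 0 \<le> H f \<and> H f \<le> B"
  shows "\<bar>expectation (\<lambda>\<omega>. H (path_of position \<omega>)) - expectation (\<lambda>\<omega>. H (polygon m (m * Suc K) (\<lambda>j. vertex m j \<omega>)))\<bar>
    \<le> \<bar>L\<bar> * (14 * \<delta>) + B * bad_bound CARD('n) c m (Suc K) \<delta> \<epsilon>"
proof -
  let ?P = "\<lambda>\<omega>. polygon m (m * Suc K) (\<lambda>j. vertex m j \<omega>)"
  have B0: "0 \<le> B" using B[OF polygon_in_cont_paths[of 0 0 "\<lambda>_. 0"]] by linarith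
  have vm: "vertex m j \<in> borel_measurable M" for j unfolding vertex_def[abs_def] by measurable
  have m1: "(\<lambda>\<omega>. H (path_of position \<omega>)) \<in> borel_measurable M"
    by (rule path_lipschitz_measurable[OF H position_measurable path_of_position])
  have m2: "(\<lambda>\<omega>. H (?P \<omega>)) \<in> borel_measurable M" by (rule polygon_measurable[OF H vm])
  have i1: "integrable M (\<lambda>\<omega>. H (path_of position \<omega>))"
    by (rule integrable_const_bound[OF _ m1, where B = B]) (use B[OF path_of_position] in auto)
  have i2: "integrable M (\<lambda>\<omega>. H (?P \<omega>))"
    by (rule integrable_const_bound[OF _ m2, where B = B]) (use B[OF polygon_in_cont_paths] in auto)
  have "\<bar>expectation (\<lambda>\<omega>. H (path_of position \<omega>)) - expectation (\<lambda>\<omega>. H (?P \<omega>))\<bar> = \<bar>expectation (\<lambda>\<omega>. H (path_of position \<omega>) - H (?P \<omega>))\<bar>"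
    using i1 i2 by simp
  also have "\<dots> \<le> expectation (\<lambda>\<omega>. \<bar>H (path_of position \<omega>) - H (?P \<omega>)\<bar>)" by (rule integral_abs_bound)
  also have "\<dots> \<le> expectation (\<lambda>\<omega>. \<bar>L\<bar> * (14 * \<delta>) + B * indicator (bad m (Suc K) \<delta>) \<omega>)"
  proof (rule integral_mono_AE)
    show "integrable M (\<lambda>\<omega>. \<bar>H (path_of position \<omega>) - H (?P \<omega>)\<bar>)" using i1 i2 by simp
    show "integrable M (\<lambda>\<omega>. \<bar>L\<bar> * (14 * \<delta>) + B * indicator (bad m (Suc K) \<delta>) \<omega>)"
      using bad_measurable by (simp add: emeasure_eq_measure)
    show "AE \<omega> in M. \<bar>H (path_of position \<omega>) - H (?P \<omega>)\<bar> \<le> \<bar>L\<bar> * (14 * \<delta>) + B * indicator (bad m (Suc K) \<delta>) \<omega>"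
      using T_pos AE_space
    proof eventually_elim
      case (elim \<omega>)
      show ?case
      proof (cases "\<omega> \<in> bad m (Suc K) \<delta>")
        case True
        have "\<bar>H (path_of position \<omega>) - H (?P \<omega>)\<bar> \<le> B"
          using B[OF path_of_position[OF elim(2)]] B[OF polygon_in_cont_paths[of m "m * Suc K" "\<lambda>j. vertex m j \<omega>"]] by linarith
        moreover have "0 \<le> \<bar>L\<bar> * (14 * \<delta>)" using \<delta> by simp
        ultimately have "\<bar>H (path_of position \<omega>) - H (?P \<omega>)\<bar> \<le> \<bar>L\<bar> * (14 * \<delta>) + B" by linarith
        then show ?thesis using True by (simp only: indicator_simps mult_1_right)
      next
        case False
        have "\<bar>H (path_of position \<omega>) - H (?P \<omega>)\<bar> \<le> L * (14 * \<delta>)"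
        proof (rule path_lipschitzD[OF H path_of_position[OF elim(2)] polygon_in_cont_paths])
          show "dist (path_of position \<omega> t) (?P \<omega> t) \<le> 14 * \<delta>" if "t \<in> {0..real K}" for t
            using near_polygon[OF m small elim(2) _ False, of t] elim(1) that by (simp add: path_of_def)
        qed (use \<delta> in simp)
        also have "\<dots> \<le> \<bar>L\<bar> * (14 * \<delta>)" using \<delta> by (intro mult_right_mono) auto
        finally show ?thesis using False by simp
      qed
    qed
  qed
  also have "\<dots> = \<bar>L\<bar> * (14 * \<delta>) + B * prob (bad m (Suc K) \<delta>)"
    using bad_measurable by (simp add: emeasure_eq_measure prob_space)
  also have "\<dots> \<le> \<bar>L\<bar> * (14 * \<delta>) + B * bad_bound CARD('n) c m (Suc K) \<delta> \<epsilon>"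
    using B0 prob_bad[OF m \<delta>, of "Suc K"] by (intro add_left_mono mult_left_mono)
  finally show ?thesis .
qed

end

text \<open>The least l with \<open>k < b (Suc l)\<close> is the block containing k. Empty blocks
  are passed over, so b may be constant on stretches.\<close>

lemma sum_over_blocks:
  fixes b :: "nat \<Rightarrow> nat" and f :: "nat \<Rightarrow> nat \<Rightarrow> 'c::comm_monoid_add"
  assumes b: "mono b" "b 0 = 0"
  shows "(\<Sum>k<b N. f (LEAST l. k < b (Suc l)) k) = (\<Sum>l<N. \<Sum>k\<in>{b l..<b (Suc l)}. f l k)"
proof (induction N)
  case (Suc N)
  have lev: "(LEAST l. k < b (Suc l)) = N" if k: "b N \<le> k" "k < b (Suc N)" for k
  proof (rule Least_equality)
    show "k < b (Suc N)" by (rule k(2))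
    fix y assume y: "k < b (Suc y)"
    show "N \<le> y"
    proof (rule ccontr)
      assume "\<not> N \<le> y"
      then have "b (Suc y) \<le> b N" by (intro monoD[OF b(1)]) simp
      then show False using y k by simp
    qed
  qed
  have "{..<b (Suc N)} = {..<b N} \<union> {b N..<b (Suc N)}" using monoD[OF b(1), of N "Suc N"] by auto
  then have "(\<Sum>k<b (Suc N). f (LEAST l. k < b (Suc l)) k) =
      (\<Sum>k<b N. f (LEAST l. k < b (Suc l)) k) + (\<Sum>k\<in>{b N..<b (Suc N)}. f (LEAST l. k < b (Suc l)) k)"
    by (simp add: sum.union_disjoint ivl_disj_int)
  also have "(\<Sum>k\<in>{b N..<b (Suc N)}. f (LEAST l. k < b (Suc l)) k) = (\<Sum>k\<in>{b N..<b (Suc N)}. f N k)"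
    by (intro sum.cong) (auto simp: lev)
  finally show ?case using Suc by simp
qed (simp add: b)

context evolution
begin

lemma vertex_0: "vertex m 0 \<omega> = x"
  by (simp add: vertex_def blk_0)

lemma vertex_diff: "vertex m (Suc l) \<omega> - vertex m l \<omega> = (\<Sum>k\<in>{blk m l..<blk m (Suc l)}. increment k \<omega>)"
proof -
  have "{..<blk m (Suc l)} = {..<blk m l} \<union> {blk m l..<blk m (Suc l)}" using monoD[OF mono_blk[of m], of l "Suc l"] by auto
  then show ?thesis by (simp add: vertex_def sum.union_disjoint ivl_disj_int)
qed

lemma vertex_measurable[measurable]: "vertex m j \<in> borel_measurable M"
  unfolding vertex_def[abs_def] by measurable

text \<open>Each step costs a multiple of \<open>\<epsilon>^3 + \<epsilon>^4\<close>, and there are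
  at most \<open>N / (m * \<epsilon>^2)\<close> steps, so the total error is of order \<epsilon>.
  The constant \<open>E\<close> dominates all test vectors at once.\<close>

lemma vertex_increments_iexp:
  fixes \<eta> :: "nat \<Rightarrow> (real, 'n) vec"
  assumes m: "0 < m" and E: "E = (\<Sum>l<N. norm (\<eta> l))"
  shows "cmod ((CLINT \<omega>|M. iexp (\<Sum>l<N. \<eta> l \<bullet> (vertex m (Suc l) \<omega> - vertex m l \<omega>))) -
      of_real (exp (- (\<Sum>l<N. (real (blk m (Suc l) - blk m l) * \<epsilon>\<^sup>2) * (c\<^sup>2 / CARD('n) * (\<eta> l \<bullet> \<eta> l))))))
    \<le> real N / m * (6 * (\<bar>c\<bar> * (E * CARD('n))) ^ 3 * \<epsilon> + (2 * c\<^sup>2 / CARD('n) * E\<^sup>2)\<^sup>2 * \<epsilon>\<^sup>2)"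
proof -
  let ?lev = "\<lambda>k. LEAST l. k < blk m (Suc l)"
  define s where "s k = 2 * c\<^sup>2 * \<epsilon>\<^sup>2 / CARD('n) * (\<eta> (?lev k) \<bullet> \<eta> (?lev k))" for k
  define \<rho> where "\<rho> k = 6 * (\<bar>c\<bar> * (norm (\<eta> (?lev k)) * CARD('n))) ^ 3 * \<epsilon> ^ 3" for k
  have e1: "(\<Sum>l<N. \<eta> l \<bullet> (vertex m (Suc l) \<omega> - vertex m l \<omega>)) = (\<Sum>k<blk m N. \<eta> (?lev k) \<bullet> increment k \<omega>)" for \<omega>
    unfolding vertex_diff inner_sum_right by (rule sum_over_blocks[OF mono_blk blk_0, symmetric])
  have "(\<Sum>k<blk m N. s k) = (\<Sum>l<N. \<Sum>k\<in>{blk m l..<blk m (Suc l)}. 2 * c\<^sup>2 * \<epsilon>\<^sup>2 / CARD('n) * (\<eta> l \<bullet> \<eta> l))"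
    unfolding s_def by (rule sum_over_blocks[OF mono_blk blk_0, of "\<lambda>l k. 2 * c\<^sup>2 * \<epsilon>\<^sup>2 / CARD('n) * (\<eta> l \<bullet> \<eta> l)"])
  also have "\<dots> = 2 * (\<Sum>l<N. (real (blk m (Suc l) - blk m l) * \<epsilon>\<^sup>2) * (c\<^sup>2 / CARD('n) * (\<eta> l \<bullet> \<eta> l)))"
    unfolding sum_distrib_left by (intro sum.cong refl) simp
  finally have e2: "- (\<Sum>k<blk m N. s k) / 2 = - (\<Sum>l<N. (real (blk m (Suc l) - blk m l) * \<epsilon>\<^sup>2) * (c\<^sup>2 / CARD('n) * (\<eta> l \<bullet> \<eta> l)))"
    by simp
  have E0: "0 \<le> E" unfolding E by (intro sum_nonneg) simp
  have le: "norm (\<eta> (?lev k)) \<le> E" if "k < blk m N" for k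
  proof -
    obtain N' where N': "N = Suc N'" using \<open>k < blk m N\<close> blk_0[of m] by (cases N) auto
    then have "?lev k \<le> N'" using \<open>k < blk m N\<close> by (intro Least_le) simp
    then have "?lev k \<in> {..<N}" using N' by simp
    then show ?thesis unfolding E by (intro member_le_sum) auto
  qed
  have "cmod ((CLINT \<omega>|M. iexp (\<Sum>k<blk m N. \<eta> (?lev k) \<bullet> increment k \<omega>)) - of_real (exp (- (\<Sum>k<blk m N. s k) / 2))) \<le> (\<Sum>k<blk m N. \<rho> k + (s k)\<^sup>2)"
    unfolding s_def \<rho>_def
    by (rule indep_sum_iexp_approx[OF inner_increment_indep inner_increment_power(1) inner_increment_mean inner_increment_second_moment inner_increment_third_moment])
  also have "\<dots> \<le> (\<Sum>k<blk m N. 6 * (\<bar>c\<bar> * (E * CARD('n))) ^ 3 * \<epsilon> ^ 3 + (2 * c\<^sup>2 * \<epsilon>\<^sup>2 / CARD('n) * E\<^sup>2)\<^sup>2)"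
  proof (rule sum_mono, rule add_mono)
    fix k assume "k \<in> {..<blk m N}"
    then have l: "norm (\<eta> (?lev k)) \<le> E" using le by simp
    show "\<rho> k \<le> 6 * (\<bar>c\<bar> * (E * CARD('n))) ^ 3 * \<epsilon> ^ 3"
      unfolding \<rho>_def using \<epsilon> l by (intro mult_right_mono mult_left_mono power_mono) auto
    have "\<eta> (?lev k) \<bullet> \<eta> (?lev k) \<le> E\<^sup>2" using power_mono[OF l norm_ge_zero, of 2] by (simp add: power2_norm_eq_inner)
    then have "s k \<le> 2 * c\<^sup>2 * \<epsilon>\<^sup>2 / CARD('n) * E\<^sup>2" unfolding s_def by (intro mult_left_mono) auto
    moreover have "0 \<le> s k" by (simp add: s_def)
    ultimately show "(s k)\<^sup>2 \<le> (2 * c\<^sup>2 * \<epsilon>\<^sup>2 / CARD('n) * E\<^sup>2)\<^sup>2" by (intro power_mono)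
  qed
  also have "\<dots> = (real (blk m N) * \<epsilon>\<^sup>2) * (6 * (\<bar>c\<bar> * (E * CARD('n))) ^ 3 * \<epsilon> + (2 * c\<^sup>2 / CARD('n) * E\<^sup>2)\<^sup>2 * \<epsilon>\<^sup>2)"
    by (simp add: power2_eq_square power3_eq_cube algebra_simps)
  also have "\<dots> \<le> real N / m * (6 * (\<bar>c\<bar> * (E * CARD('n))) ^ 3 * \<epsilon> + (2 * c\<^sup>2 / CARD('n) * E\<^sup>2)\<^sup>2 * \<epsilon>\<^sup>2)"
    using \<epsilon> E0 by (intro mult_right_mono blk_bounds(1)[OF m] add_nonneg_nonneg mult_nonneg_nonneg) auto
  finally show ?thesis unfolding e1 e2 .
qed

lemma block_length:
  assumes "0 < m"
  shows "\<bar>real (blk m (Suc l) - blk m l) * \<epsilon>\<^sup>2 - 1 / m\<bar> \<le> \<epsilon>\<^sup>2"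
proof -
  have "blk m l \<le> blk m (Suc l)" by (rule monoD[OF mono_blk]) simp
  then have "real (blk m (Suc l) - blk m l) * \<epsilon>\<^sup>2 = (real (Suc (blk m (Suc l))) * \<epsilon>\<^sup>2 - \<epsilon>\<^sup>2) - real (blk m l) * \<epsilon>\<^sup>2"
    by (simp add: of_nat_diff algebra_simps)
  moreover have "real (Suc l) / m = real l / m + 1 / m" by (simp add: add_divide_distrib)
  ultimately have "1 / m - \<epsilon>\<^sup>2 \<le> real (blk m (Suc l) - blk m l) * \<epsilon>\<^sup>2"
    using blk_bounds[OF assms, of l] blk_bounds[OF assms, of "Suc l"] by linarith
  then show ?thesis using blk_diff_bound[OF assms, of l] by linarith
qed

end

section \<open>Weak convergence\<close>

lemma inner_over_components:
  fixes v :: "nat \<Rightarrow> real ^ 'n::finite"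
  shows "(\<Sum>p\<in>{..<N} \<times> UNIV. \<zeta> p * (\<lambda>p\<in>{..<N} \<times> UNIV. v (fst p) $ snd p) p) = (\<Sum>l<N. (\<chi> i. \<zeta> (l, i)) \<bullet> v l)"
  by (simp add: sum.cartesian_product' inner_vec_def)

text \<open>Inverse to taking increments componentwise. Cutting at N makes the value depend only on
  coordinates in a finite index set, for every j.\<close>

definition vertices :: "real ^ 'n::finite \<Rightarrow> nat \<Rightarrow> (nat \<times> 'n \<Rightarrow> real) \<Rightarrow> nat \<Rightarrow> real ^ 'n" where
  "vertices x N z j = x + (\<Sum>l<min j N. \<chi> i. z (l, i))"

lemma vertices_increments:
  assumes "j \<le> N" "y 0 = x"
  shows "vertices x N (\<lambda>p\<in>{..<N} \<times> UNIV. (y (Suc (fst p)) - y (fst p)) $ snd p) j = y j"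
proof -
  have "(\<Sum>l<min j N. \<chi> i. (\<lambda>p\<in>{..<N} \<times> UNIV. (y (Suc (fst p)) - y (fst p)) $ snd p) (l, i)) = (\<Sum>l<j. y (Suc l) - y l)"
    using assms(1) by (intro sum.cong) (auto simp: vec_eq_iff min_def)
  also have "\<dots> = y j - y 0" by (rule sum_lessThan_telescope)
  finally show ?thesis by (simp add: vertices_def assms(2))
qed

lemma vertices_dist:
  assumes "j \<le> N"
  shows "dist (vertices x N z j) (vertices x N z' j) \<le> (\<Sum>p\<in>{..<N} \<times> (UNIV :: 'n::finite set). \<bar>z p - z' p\<bar>)"
proof -
  have "dist (vertices x N z j) (vertices x N z' j) = norm (\<Sum>l<min j N. (\<chi> i. z (l, i)) - (\<chi> i. z' (l, i)))"
    by (simp add: vertices_def dist_norm sum_subtractf)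
  also have "\<dots> \<le> (\<Sum>l<min j N. norm ((\<chi> i. z (l, i)) - (\<chi> i. z' (l, i))))" by (rule norm_sum)
  also have "\<dots> \<le> (\<Sum>l<min j N. \<Sum>i\<in>UNIV. \<bar>z (l, i) - z' (l, i)\<bar>)"
  proof (rule sum_mono)
    fix l
    show "norm ((\<chi> i. z (l, i)) - (\<chi> i. z' (l, i))) \<le> (\<Sum>i\<in>UNIV. \<bar>z (l, i) - z' (l, i)\<bar>)"
      using norm_le_l1_cart[of "(\<chi> i. z (l, i)) - (\<chi> i. z' (l, i))"] by simp
  qed
  also have "\<dots> \<le> (\<Sum>l<N. \<Sum>i\<in>UNIV. \<bar>z (l, i) - z' (l, i)\<bar>)"
    by (rule sum_mono2) (auto intro: sum_nonneg)
  finally show ?thesis by (simp add: sum.cartesian_product')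
qed

lemma vertices_measurable:
  "(\<lambda>z. vertices x N z j) \<in> borel_measurable (PiM ({..<N} \<times> (UNIV :: 'n::finite set)) (\<lambda>_. borel))"
proof -
  have "(\<lambda>z. \<chi> i. z (l, i)) \<in> borel_measurable (PiM ({..<N} \<times> (UNIV :: 'n set)) (\<lambda>_. borel :: real measure))" if "l < N" for l
  proof (subst borel_measurable_euclidean_space, intro ballI)
    fix b :: "real ^ 'n" assume "b \<in> Basis"
    then obtain i where "b = axis i 1" by (auto simp: Basis_vec_def)
    then show "(\<lambda>z. (\<chi> i. z (l, i)) \<bullet> b) \<in> borel_measurable (PiM ({..<N} \<times> (UNIV :: 'n set)) (\<lambda>_. borel :: real measure))"
      using that by (simp add: inner_axis)
  qed
  then show ?thesis unfolding vertices_def by (intro borel_measurable_add borel_measurable_sum borel_measurable_const) auto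
qed

text \<open>As a function of the components of the R increments, \<open>H\<close> of the polygon is
  bounded and Lipschitz, so convergence of characteristic functions suffices. Increments are used
  because the limiting characteristic function is explicit for them.\<close>

lemma polygon_functional_LIMSEQ:
  fixes x :: "real ^ 'n::finite" and M :: "nat \<Rightarrow> 'a measure" and N :: "'b measure"
    and y :: "nat \<Rightarrow> nat \<Rightarrow> 'a \<Rightarrow> real ^ 'n" and u :: "nat \<Rightarrow> 'b \<Rightarrow> real ^ 'n"
  assumes M: "\<And>k. prob_space (M k)" and N: "prob_space N"
    and y: "\<And>k j. y k j \<in> borel_measurable (M k)" and u: "\<And>j. u j \<in> borel_measurable N"
    and y0: "\<And>k \<omega>. \<omega> \<in> space (M k) \<Longrightarrow> y k 0 \<omega> = x" and u0: "\<And>\<omega>. \<omega> \<in> space N \<Longrightarrow> u 0 \<omega> = x"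
    and char: "\<And>\<eta>. (\<lambda>k. CLINT \<omega>|M k. iexp (\<Sum>l<R. \<eta> l \<bullet> (y k (Suc l) \<omega> - y k l \<omega>))) \<longlonglongrightarrow>
      (CLINT \<omega>|N. iexp (\<Sum>l<R. \<eta> l \<bullet> (u (Suc l) \<omega> - u l \<omega>)))"
    and H: "path_lipschitz K L H" and B: "\<And>f. f \<in> cont_paths \<Longrightarrow> 0 \<le> H f \<and> H f \<le> B"
  shows "(\<lambda>k. LINT \<omega>|M k. H (polygon m R (\<lambda>j. y k j \<omega>))) \<longlonglongrightarrow> (LINT \<omega>|N. H (polygon m R (\<lambda>j. u j \<omega>)))"
proof -
  let ?J = "{..<R} \<times> (UNIV :: 'n set)"
  define g where "g z = H (polygon m R (vertices x R z))" for z
  define X where "X k \<omega> = (\<lambda>p\<in>?J. (y k (Suc (fst p)) \<omega> - y k (fst p) \<omega>) $ snd p)" for k \<omega>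
  define Y where "Y \<omega> = (\<lambda>p\<in>?J. (u (Suc (fst p)) \<omega> - u (fst p) \<omega>) $ snd p)" for \<omega>
  have Xm: "X k \<in> M k \<rightarrow>\<^sub>M PiM ?J (\<lambda>_. borel)" for k
    unfolding X_def[abs_def] using y[of k] by (intro measurable_restrict) (simp add: cart_eq_inner_axis)
  have Ym: "Y \<in> N \<rightarrow>\<^sub>M PiM ?J (\<lambda>_. borel)"
    unfolding Y_def[abs_def] using u by (intro measurable_restrict) (simp add: cart_eq_inner_axis)
  have gX: "g (X k \<omega>) = H (polygon m R (\<lambda>j. y k j \<omega>))" if "\<omega> \<in> space (M k)" for k \<omega>
    unfolding g_def X_def using vertices_increments[of _ R "\<lambda>j. y k j \<omega>", OF _ y0[OF that]]
    by (intro arg_cong[of _ _ H] polygon_cong) auto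
  have gY: "g (Y \<omega>) = H (polygon m R (\<lambda>j. u j \<omega>))" if "\<omega> \<in> space N" for \<omega>
    unfolding g_def Y_def using vertices_increments[of _ R "\<lambda>j. u j \<omega>", OF _ u0[OF that]]
    by (intro arg_cong[of _ _ H] polygon_cong) auto
  have "(\<lambda>k. LINT \<omega>|M k. g (X k \<omega>)) \<longlonglongrightarrow> (LINT \<omega>|N. g (Y \<omega>))"
  proof (rule char_LIMSEQ_imp_expectation_LIMSEQ[OF _ M N Xm Ym])
    fix \<zeta> :: "nat \<times> 'n \<Rightarrow> real"
    have a: "(\<Sum>p\<in>?J. \<zeta> p * X k \<omega> p) = (\<Sum>l<R. (\<chi> i. \<zeta> (l, i)) \<bullet> (y k (Suc l) \<omega> - y k l \<omega>))" for k \<omega>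
      unfolding X_def by (rule inner_over_components[where v = "\<lambda>l. y k (Suc l) \<omega> - y k l \<omega>"])
    have b: "(\<Sum>p\<in>?J. \<zeta> p * Y \<omega> p) = (\<Sum>l<R. (\<chi> i. \<zeta> (l, i)) \<bullet> (u (Suc l) \<omega> - u l \<omega>))" for \<omega>
      unfolding Y_def by (rule inner_over_components[where v = "\<lambda>l. u (Suc l) \<omega> - u l \<omega>"])
    show "(\<lambda>k. CLINT \<omega>|M k. iexp (\<Sum>p\<in>?J. \<zeta> p * X k \<omega> p)) \<longlonglongrightarrow> (CLINT \<omega>|N. iexp (\<Sum>p\<in>?J. \<zeta> p * Y \<omega> p))"
      unfolding a b by (rule char)
  next
    show "g \<in> borel_measurable (PiM ?J (\<lambda>_. borel))"
      unfolding g_def[abs_def] by (rule polygon_measurable[OF H vertices_measurable])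
    show "\<bar>g z\<bar> \<le> B" for z using B[OF polygon_in_cont_paths[of m R "vertices x R z"]] by (simp add: g_def)
    show "\<bar>g z - g z'\<bar> \<le> (L * (1 + 2 * real R)) * (\<Sum>p\<in>?J. \<bar>z p - z' p\<bar>)" for z z'
    proof -
      have "\<bar>g z - g z'\<bar> \<le> L * ((1 + 2 * real R) * (\<Sum>p\<in>?J. \<bar>z p - z' p\<bar>))"
        unfolding g_def
        by (rule path_lipschitzD[OF H polygon_in_cont_paths polygon_in_cont_paths])
           (auto intro!: polygon_diff vertices_dist mult_nonneg_nonneg sum_nonneg)
      then show ?thesis by (simp add: mult.assoc)
    qed
  qed simp
  then show ?thesis using gX gY by (simp cong: Bochner_Integration.integral_cong)
qed

lemma wiener_processD:
  assumes w: "wiener_process (\<lambda>\<phi> y. a * laplacian \<phi> y) x N w"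
  shows "prob_space N" "\<And>t. 0 \<le> t \<Longrightarrow> w t \<in> borel_measurable N" "\<And>\<omega>. \<omega> \<in> space N \<Longrightarrow> w 0 \<omega> = x"
    "\<And>\<omega>. \<omega> \<in> space N \<Longrightarrow> path_of w \<omega> \<in> cont_paths"
proof -
  show "prob_space N" "\<And>t. 0 \<le> t \<Longrightarrow> w t \<in> borel_measurable N" "\<And>\<omega>. \<omega> \<in> space N \<Longrightarrow> w 0 \<omega> = x"
    using w by (auto simp: wiener_process_def markov_process_def)
  fix \<omega> assume "\<omega> \<in> space N"
  then have "continuous_on {0..} (\<lambda>t. w t \<omega>)" using w by (simp add: wiener_process_def)
  then have "continuous_on {0..} (path_of w \<omega>)"
    unfolding path_of_def by (subst continuous_on_cong[OF refl]) auto
  then show "path_of w \<omega> \<in> cont_paths" by (simp add: cont_paths_def path_of_def)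
qed

lemma wiener_increments_iexp:
  assumes w: "wiener_process (\<lambda>\<phi> y. a * laplacian \<phi> y) x N w" and a: "0 \<le> a"
  shows "(CLINT \<omega>|N. iexp (\<Sum>l<R. \<eta> l \<bullet> (w (real (Suc l) / real m) \<omega> - w (real l / real m) \<omega>))) =
    of_real (exp (- (\<Sum>l<R. 1 / m * (a * (\<eta> l \<bullet> \<eta> l)))))"
proof -
  obtain K where K: "markov_semigroup K" "generated_by K C02 (\<lambda>\<phi> y. a * laplacian \<phi> y)" "markov_process N w K"
    using w by (auto simp: wiener_process_def)
  have "- a * (1 / real m) * (\<Sum>l<R. \<eta> l \<bullet> \<eta> l) = - (\<Sum>l<R. 1 / m * (a * (\<eta> l \<bullet> \<eta> l)))"
    by (simp add: sum_distrib_left sum_negf)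
  then show ?thesis
    using increments_iexp[OF K(1,2) a K(3), of "1 / m" \<eta> R] by simp
qed

text \<open>Order of choices: \<delta> from the accuracy r, then m for the oscillation and for the
  polygons of w, and only then k large.\<close>

lemma evolution_functional_LIMSEQ:
  fixes x :: "real ^ 'n::{finite,linorder}" and M :: "nat \<Rightarrow> 'a measure" and N :: "'b measure"
  assumes ev: "\<And>k. evolution TYPE('n::{finite,linorder}) (M k) (e k) (Z k) (T k)" and e0: "e \<longlonglongrightarrow> 0"
    and w: "wiener_process (\<lambda>\<phi> y. c\<^sup>2 / real CARD('n::{finite,linorder}) * laplacian \<phi> y) x N w"
    and H: "path_lipschitz (real K) L H" and B: "\<And>f. f \<in> cont_paths \<Longrightarrow> 0 \<le> H f \<and> H f \<le> B"
  shows "(\<lambda>k. LINT \<omega>|M k. H (path_of (evolution.position (e k) (Z k) (T k) x c) \<omega>)) \<longlonglongrightarrow> (LINT \<omega>|N. H (path_of w \<omega>))"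
proof -
  interpret E: evolution "M k" "e k" "Z k" "T k" x c for k by (rule ev)
  note wD = wiener_processD[OF w]
  interpret N: prob_space N by (rule wD)
  let ?n = "CARD('n)" and ?a = "c\<^sup>2 / real CARD('n)"
  have e_right: "filterlim e (at_right 0) sequentially"
    using e0 E.\<epsilon> by (intro filterlim_atI tendsto_intros filterlim_at_withinI) (auto simp: filterlim_at)
  have poly: "(\<lambda>k. LINT \<omega>|M k. H (polygon m (m * Suc K) (\<lambda>j. E.vertex k m j \<omega>))) \<longlonglongrightarrow>
      (LINT \<omega>|N. H (polygon m (m * Suc K) (\<lambda>j. w (real j / real m) \<omega>)))" if m: "0 < m" for m
  proof (rule polygon_functional_LIMSEQ[where y = "\<lambda>k. E.vertex k m" and u = "\<lambda>j. w (real j / real m)" and x = x])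
    show "prob_space (M k)" "E.vertex k m j \<in> borel_measurable (M k)" "E.vertex k m 0 \<omega> = x" for k j \<omega>
      by (rule E.prob_space_axioms E.vertex_measurable E.vertex_0)+
    show "prob_space N" "path_lipschitz (real K) L H" "\<And>f. f \<in> cont_paths \<Longrightarrow> 0 \<le> H f \<and> H f \<le> B"
      by (rule wD(1) H B)+
    show "w (real j / real m) \<in> borel_measurable N" for j by (rule wD(2)) simp
    show "w (real 0 / real m) \<omega> = x" if "\<omega> \<in> space N" for \<omega> using wD(3)[OF that] by simp
    fix \<eta> :: "nat \<Rightarrow> real ^ 'n::{finite,linorder}"
    let ?R = "m * Suc K"
    define F where "F = (\<Sum>l<?R. norm (\<eta> l))"
    \<comment> \<open>Gaussian characteristic function with the actual block lengths, which are
      integer multiples of \<open>(e k)^2\<close>; that these tend to \<open>1 / m\<close> is shown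
      separately.\<close>
    let ?t = "\<lambda>k. of_real (exp (- (\<Sum>l<?R. (real (E.blk k m (Suc l) - E.blk k m l) * (e k)\<^sup>2) * (?a * (\<eta> l \<bullet> \<eta> l))))) :: complex"
    have "(\<lambda>k. real ?R / m * (6 * (\<bar>c\<bar> * (F * ?n)) ^ 3 * e k + (2 * c\<^sup>2 / ?n * F\<^sup>2)\<^sup>2 * (e k)\<^sup>2)) \<longlonglongrightarrow>
        real ?R / m * (6 * (\<bar>c\<bar> * (F * ?n)) ^ 3 * 0 + (2 * c\<^sup>2 / ?n * F\<^sup>2)\<^sup>2 * 0\<^sup>2)"
      by (intro tendsto_intros e0)
    then have z: "(\<lambda>k. real ?R / m * (6 * (\<bar>c\<bar> * (F * ?n)) ^ 3 * e k + (2 * c\<^sup>2 / ?n * F\<^sup>2)\<^sup>2 * (e k)\<^sup>2)) \<longlonglongrightarrow> 0" by simp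
    have d: "(\<lambda>k. (CLINT \<omega>|M k. iexp (\<Sum>l<?R. \<eta> l \<bullet> (E.vertex k m (Suc l) \<omega> - E.vertex k m l \<omega>))) - ?t k) \<longlonglongrightarrow> 0"
      by (rule Lim_null_comparison[OF always_eventually z]) (intro allI E.vertex_increments_iexp[OF m F_def])
    have bl: "(\<lambda>k. real (E.blk k m (Suc l) - E.blk k m l) * (e k)\<^sup>2) \<longlonglongrightarrow> 1 / m" for l
    proof (rule LIM_zero_cancel, rule Lim_null_comparison)
      show "eventually (\<lambda>k. norm (real (E.blk k m (Suc l) - E.blk k m l) * (e k)\<^sup>2 - 1 / m) \<le> (e k)\<^sup>2) sequentially"
        using E.block_length[OF m] by simp
      show "(\<lambda>k. (e k)\<^sup>2) \<longlonglongrightarrow> 0" using tendsto_power[OF e0, of 2] by simp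
    qed
    have "?t \<longlonglongrightarrow> of_real (exp (- (\<Sum>l<?R. 1 / m * (?a * (\<eta> l \<bullet> \<eta> l)))))"
      by (intro tendsto_intros bl)
    from tendsto_add[OF d this]
    show "(\<lambda>k. CLINT \<omega>|M k. iexp (\<Sum>l<?R. \<eta> l \<bullet> (E.vertex k m (Suc l) \<omega> - E.vertex k m l \<omega>))) \<longlonglongrightarrow>
        (CLINT \<omega>|N. iexp (\<Sum>l<?R. \<eta> l \<bullet> (w (real (Suc l) / real m) \<omega> - w (real l / real m) \<omega>)))"
      by (subst wiener_increments_iexp[OF w]) simp_all
  qed
  have w_poly: "(\<lambda>m. LINT \<omega>|N. H (polygon m (m * Suc K) (\<lambda>j. w (real j / real m) \<omega>))) \<longlonglongrightarrow> (LINT \<omega>|N. H (path_of w \<omega>))"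
  proof (rule integral_dominated_convergence[where w = "\<lambda>_. B"])
    show "(\<lambda>\<omega>. H (path_of w \<omega>)) \<in> borel_measurable N" by (rule path_lipschitz_measurable[OF H wD(2,4)])
    show "(\<lambda>\<omega>. H (polygon m (m * Suc K) (\<lambda>j. w (real j / real m) \<omega>))) \<in> borel_measurable N" for m
      by (rule polygon_measurable[OF H]) (rule wD(2), simp)
    show "AE \<omega> in N. (\<lambda>m. H (polygon m (m * Suc K) (\<lambda>j. w (real j / real m) \<omega>))) \<longlonglongrightarrow> H (path_of w \<omega>)"
    proof (rule AE_I2)
      fix \<omega> assume "\<omega> \<in> space N"
      then show "(\<lambda>m. H (polygon m (m * Suc K) (\<lambda>j. w (real j / real m) \<omega>))) \<longlonglongrightarrow> H (path_of w \<omega>)"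
        using path_lipschitz_polygon_LIMSEQ[OF H wD(4)] by (simp add: path_of_def)
    qed
    show "AE \<omega> in N. norm (H (polygon m (m * Suc K) (\<lambda>j. w (real j / real m) \<omega>))) \<le> B" for m
      using B[OF polygon_in_cont_paths] by simp
  qed simp
  show ?thesis
  proof (rule LIMSEQ_I)
    fix r :: real assume r: "0 < r"
    \<comment> \<open>84 is 14 times 6: the Lipschitz error becomes at most \<open>r / 6\<close>,
      and four errors of this size stay below r.\<close>
    define \<delta> where "\<delta> = r / (84 * (\<bar>L\<bar> + 1))"
    have \<delta>: "0 < \<delta>" using r by (simp add: \<delta>_def add_nonneg_pos)
    have "q * (14 * (r / (84 * q))) = r / 6" if "q \<noteq> 0" for q :: real using that by simp
    from this[of "\<bar>L\<bar> + 1"] have "(\<bar>L\<bar> + 1) * (14 * \<delta>) = r / 6" unfolding \<delta>_def by linarith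
    then have L\<delta>: "\<bar>L\<bar> * (14 * \<delta>) \<le> r / 6" using \<delta> by (simp add: distrib_right)
    \<comment> \<open>m times the limit of \<open>bad_bound\<close> as \<epsilon> tends to
      0.\<close>
    define C where "C = 12 * c ^ 4 * real ?n ^ 3 * (real (Suc K) + 3) / \<delta> ^ 4"
    have "(\<lambda>m. B * (C / real m)) \<longlonglongrightarrow> B * 0" by (intro tendsto_intros lim_const_over_n)
    then have "eventually (\<lambda>m. B * (C / real m) < r / 6) sequentially"
      by (rule order_tendstoD) (use r in simp)
    moreover have "eventually (\<lambda>m. dist (LINT \<omega>|N. H (polygon m (m * Suc K) (\<lambda>j. w (real j / real m) \<omega>))) (LINT \<omega>|N. H (path_of w \<omega>)) < r / 6) sequentially"
      using w_poly by (rule tendstoD) (use r in simp)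
    ultimately have "eventually (\<lambda>m. 0 < m \<and> B * (C / real m) < r / 6 \<and>
        dist (LINT \<omega>|N. H (polygon m (m * Suc K) (\<lambda>j. w (real j / real m) \<omega>))) (LINT \<omega>|N. H (path_of w \<omega>)) < r / 6) sequentially"
      using eventually_gt_at_top[of "0::nat"] by eventually_elim simp
    then obtain m where m: "0 < m" "B * (C / real m) < r / 6"
      "dist (LINT \<omega>|N. H (polygon m (m * Suc K) (\<lambda>j. w (real j / real m) \<omega>))) (LINT \<omega>|N. H (path_of w \<omega>)) < r / 6"
      by (auto simp: eventually_sequentially)
    have "((\<lambda>\<epsilon>. B * bad_bound ?n c m (Suc K) \<delta> \<epsilon>) \<longlongrightarrow> B * (C / m)) (at_right 0)"
      unfolding C_def using m(1) \<delta> by (intro tendsto_mult[OF tendsto_const] bad_bound_tendsto) simp_all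
    then have "(\<lambda>k. B * bad_bound ?n c m (Suc K) \<delta> (e k)) \<longlonglongrightarrow> B * (C / m)"
      by (rule filterlim_compose[OF _ e_right])
    then have ev1: "eventually (\<lambda>k. B * bad_bound ?n c m (Suc K) \<delta> (e k) < r / 6) sequentially"
      by (rule order_tendstoD) (rule m(2))
    have "(\<lambda>k. (e k)\<^sup>2) \<longlonglongrightarrow> 0" using tendsto_power[OF e0, of 2] by simp
    then have ev2: "eventually (\<lambda>k. (e k)\<^sup>2 < 1 / (2 * real m)) sequentially"
      by (rule order_tendstoD) (use m(1) in simp)
    have ev3: "eventually (\<lambda>k. dist (LINT \<omega>|M k. H (polygon m (m * Suc K) (\<lambda>j. E.vertex k m j \<omega>)))
      (LINT \<omega>|N. H (polygon m (m * Suc K) (\<lambda>j. w (real j / real m) \<omega>))) < r / 6) sequentially"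
      using poly[OF m(1)] by (rule tendstoD) (use r in simp)
    have "eventually (\<lambda>k. norm ((LINT \<omega>|M k. H (path_of (E.position k) \<omega>)) - (LINT \<omega>|N. H (path_of w \<omega>))) < r) sequentially"
      using ev1 ev2 ev3
    proof eventually_elim
      case (elim k)
      show ?case
        using E.polygon_functional_error[OF m(1) \<delta> less_imp_le[OF elim(2)] H B] elim(1,3) m(3) L\<delta> r
        unfolding dist_real_def real_norm_def by linarith
    qed
    then show "\<exists>no. \<forall>k\<ge>no. norm ((LINT \<omega>|M k. H (path_of (E.position k) \<omega>)) - (LINT \<omega>|N. H (path_of w \<omega>))) < r"
      by (simp add: eventually_sequentially)
  qed
qed

theorem theorem1:
  fixes x :: "real ^ 'n::{finite,linorder}" and c :: real
    and P :: "real \<Rightarrow> 'a measure" and \<theta> :: "real \<Rightarrow> real \<Rightarrow> 'a \<Rightarrow> nat \<Rightarrow> real"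
    and \<xi> :: "real \<Rightarrow> real \<Rightarrow> 'a \<Rightarrow> real ^ 'n::{finite,linorder}"
    and W :: "'b measure" and w :: "real \<Rightarrow> 'b \<Rightarrow> real ^ 'n::{finite,linorder}"
  assumes "CARD('n) \<ge> 2"
    and "\<And>\<epsilon>. \<epsilon> > 0 \<Longrightarrow> switching_process CARD('n) (1 / \<epsilon>\<^sup>2) (P \<epsilon>) (\<theta> \<epsilon>)"
    and "\<And>\<epsilon>. \<epsilon> > 0 \<Longrightarrow> \<xi> \<epsilon> = random_evolution x (c / \<epsilon>) (\<theta> \<epsilon>)"
    and "wiener_process (\<lambda>\<phi> y. c\<^sup>2 / real CARD('n) * laplacian \<phi> y) x W w"
  shows "(\<forall>\<epsilon>>0. path_of (\<xi> \<epsilon>) \<in> P \<epsilon> \<rightarrow>\<^sub>M borel_sets_of skorokhod) \<and>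
    path_of w \<in> W \<rightarrow>\<^sub>M borel_sets_of skorokhod \<and>
    converges_weakly skorokhod (\<lambda>\<epsilon>. path_law (P \<epsilon>) (\<xi> \<epsilon>)) (path_law W w) (at_right 0)"
proof -
  have "\<exists>Z T. evolution TYPE('n) (P \<epsilon>) \<epsilon> Z T \<and>
      (\<forall>\<omega>\<in>space (P \<epsilon>). \<forall>t\<ge>0. \<theta> \<epsilon> t \<omega> = Z (jump_count (\<lambda>k. T k \<omega>) t) \<omega>)" if \<epsilon>: "0 < \<epsilon>" for \<epsilon>
  proof -
    from assms(2)[OF \<epsilon>] obtain Z T where ZT: "prob_space (P \<epsilon>)"
        "prob_space.indep_vars (P \<epsilon>) (\<lambda>_. angle_law CARD('n)) Z UNIV"
        "prob_space.indep_vars (P \<epsilon>) (\<lambda>_. borel) T UNIV"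
        "prob_space.indep_set (P \<epsilon>)
          (sets (vimage_algebra (space (P \<epsilon>)) (\<lambda>\<omega> k. Z k \<omega>) (\<Pi>\<^sub>M k\<in>UNIV. angle_law CARD('n))))
          (sets (vimage_algebra (space (P \<epsilon>)) (\<lambda>\<omega> k. T k \<omega>) (\<Pi>\<^sub>M k\<in>UNIV. borel)))"
        "\<forall>k\<ge>1. distr (P \<epsilon>) (angle_law CARD('n)) (Z k) = angle_law CARD('n)"
        "\<forall>k. distributed (P \<epsilon>) lborel (T k) (exponential_density (1 / \<epsilon>\<^sup>2))"
        "\<forall>\<omega>\<in>space (P \<epsilon>). \<forall>t\<ge>0. \<theta> \<epsilon> t \<omega> = Z (jump_count (\<lambda>k. T k \<omega>) t) \<omega>"
      unfolding switching_process_def by blast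
    have "evolution TYPE('n) (P \<epsilon>) \<epsilon> Z T"
      by (intro evolution.intro switching.intro switching_axioms.intro evolution_axioms.intro)
         (use ZT \<epsilon> assms(1) in auto)
    then show ?thesis using ZT(7) by blast
  qed
  \<comment> \<open>Values and holding times are chosen separately for every \<epsilon>, since the
    probability space may vary with it.\<close>
  then obtain Z T where ev: "\<And>\<epsilon>. 0 < \<epsilon> \<Longrightarrow> evolution TYPE('n) (P \<epsilon>) \<epsilon> (Z \<epsilon>) (T \<epsilon>)"
    and \<theta>: "\<And>\<epsilon> \<omega> t. 0 < \<epsilon> \<Longrightarrow> \<omega> \<in> space (P \<epsilon>) \<Longrightarrow> 0 \<le> t \<Longrightarrow> \<theta> \<epsilon> t \<omega> = Z \<epsilon> (jump_count (\<lambda>k. T \<epsilon> k \<omega>) t) \<omega>"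
    by metis
  \<comment> \<open>\<open>\<theta> \<epsilon>\<close> is prescribed at nonnegative times only, and
    the integral over [0, t] sees no others.\<close>
  have \<xi>: "\<xi> \<epsilon> t \<omega> = evolution.position \<epsilon> (Z \<epsilon>) (T \<epsilon>) x c t \<omega>" if "0 < \<epsilon>" "\<omega> \<in> space (P \<epsilon>)" for \<epsilon> t \<omega>
  proof -
    interpret E: evolution "P \<epsilon>" \<epsilon> "Z \<epsilon>" "T \<epsilon>" x c by (rule ev) fact
    have "(LINT \<tau>:{0..t}|lborel. direction (\<theta> \<epsilon> \<tau> \<omega>)) = (LINT \<tau>:{0..t}|lborel. E.speed \<omega> \<tau>)"
      unfolding E.speed_def set_lebesgue_integral_def
      using \<theta>[OF that] by (intro Bochner_Integration.integral_cong refl) (auto simp: indicator_def)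
    then show ?thesis by (simp add: assms(3)[OF that(1)] random_evolution_def E.position_def)
  qed
  have \<xi>p: "path_of (\<xi> \<epsilon>) \<omega> = path_of (evolution.position \<epsilon> (Z \<epsilon>) (T \<epsilon>) x c) \<omega>" if "0 < \<epsilon>" "\<omega> \<in> space (P \<epsilon>)" for \<epsilon> \<omega>
    unfolding path_of_def using \<xi>[OF that] by simp
  have \<xi>m: "\<xi> \<epsilon> t \<in> borel_measurable (P \<epsilon>)" and \<xi>c: "\<omega> \<in> space (P \<epsilon>) \<Longrightarrow> path_of (\<xi> \<epsilon>) \<omega> \<in> cont_paths"
    if "0 < \<epsilon>" for \<epsilon> t \<omega>
  proof -
    interpret E: evolution "P \<epsilon>" \<epsilon> "Z \<epsilon>" "T \<epsilon>" x c by (rule ev) fact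
    show "\<xi> \<epsilon> t \<in> borel_measurable (P \<epsilon>)"
      using E.position_measurable[of t] \<xi>[OF that] by (simp cong: measurable_cong)
    show "path_of (\<xi> \<epsilon>) \<omega> \<in> cont_paths" if "\<omega> \<in> space (P \<epsilon>)"
      using E.path_of_position[OF that] \<xi>p[OF \<open>0 < \<epsilon>\<close> that] by simp
  qed
  note wD = wiener_processD[OF assms(4)]
  have 1: "path_of (\<xi> \<epsilon>) \<in> P \<epsilon> \<rightarrow>\<^sub>M borel_sets_of skorokhod" if "0 < \<epsilon>" for \<epsilon>
    by (rule path_of_measurable[OF \<xi>m[OF that] \<xi>c[OF that]])
  have 2: "path_of w \<in> W \<rightarrow>\<^sub>M borel_sets_of skorokhod"
    by (rule path_of_measurable[OF wD(2,4)])
  have 3: "((\<lambda>\<epsilon>. LINT z|path_law (P \<epsilon>) (\<xi> \<epsilon>). F z) \<longlongrightarrow> (LINT z|path_law W w. F z)) (at_right 0)"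
    if F: "continuous_map skorokhod euclideanreal F" "bounded (F ` topspace skorokhod)" for F
    \<comment> \<open>The limit along \<open>at_right 0\<close> is tested on sequences, the form in
      which convergence of path laws has been prepared.\<close>
    unfolding tendsto_at_iff_sequentially comp_def
  proof (intro allI impI)
    fix e :: "nat \<Rightarrow> real" assume e: "\<forall>i. e i \<in> {0<..} - {0}" "e \<longlonglongrightarrow> 0"
    then have pos: "0 < e k" for k by auto
    show "(\<lambda>k. LINT z|path_law (P (e k)) (\<xi> (e k)). F z) \<longlonglongrightarrow> (LINT z|path_law W w. F z)"
    proof (rule path_law_LIMSEQ[OF _ wD(1) \<xi>m[OF pos] \<xi>c[OF pos] wD(2,4) _ F])
      show "prob_space (P (e k))" for k using assms(2)[OF pos] by (simp add: switching_process_def)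
      fix K L B and H :: "(real \<Rightarrow> (real, 'n) vec) \<Rightarrow> real"
      assume H: "path_lipschitz (real K) L H" "\<And>f. f \<in> cont_paths \<Longrightarrow> 0 \<le> H f \<and> H f \<le> B"
      have "(\<lambda>k. LINT \<omega>|P (e k). H (path_of (evolution.position (e k) (Z (e k)) (T (e k)) x c) \<omega>)) \<longlonglongrightarrow> (LINT \<omega>|W. H (path_of w \<omega>))"
        by (rule evolution_functional_LIMSEQ[OF ev[OF pos] e(2) assms(4) H])
      then show "(\<lambda>k. LINT \<omega>|P (e k). H (path_of (\<xi> (e k)) \<omega>)) \<longlonglongrightarrow> (LINT \<omega>|W. H (path_of w \<omega>))"
        using \<xi>p[OF pos] by (simp cong: Bochner_Integration.integral_cong)
    qed
  qed
  show ?thesis using 1 2 3 by (simp add: converges_weakly_def)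
qed

end
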